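(* Let $R$ be either an integral domain in which $2$ is a unit or a field of characteristic $2$. If $(C,\Psi)$ is a formal Alexander-Whitney coalgebra over $R$ (with $C_1=C_2=0$), then $\mathfrak L_2(C,\Psi)$ is weakly equivalent (i.e. connected by a zig-zag of quasi-isomorphisms of chain algebras) to a chain algebra with underlying graded algebra $T\big(\mathfrak A^{\mathbb N}(s^{-1}H)(s^{-1}\overline H)\big)$, where $H=\mathrm H_*(C)$.
   Context: Chain (co)algebras are over $R$, with $R$-free underlying graded modules; the Koszul sign convention is used. $V_+=V_{>0}$; $s^{-1}$ is desuspension; $s^{-1}1:=0$. A chain coalgebra $C$ is coassociative, counital, coaugmented and non-negatively graded with $C_0=R$; it is simply connected if also $C_1=0$. $\Omega C=(T(s^{-1}C_+),d_\Omega)$, $d_\Omega(s^{-1}c)=-s^{-1}(dc)+\sum(-1)^{|c_i|}s^{-1}c_i\,s^{-1}c^i$, where $\overline\Delta(c)=\sum c_i\otimes c^i$ is the reduced comultiplication. Strong homotopy maps. The linear part of a chain algebra map $\theta:\Omega C\to\Omega C'$ is the chain map $\theta_1:C\to C'$ with $\theta(s^{-1}c)-s^{-1}\theta_1(c)$ of word length $\ge2$. Write $\theta(s^{-1}c)=\sum_k\sum s^{-1}c_1\cdots s^{-1}c_k$ and let $\Delta^{(k)}(d)=\sum d_{(1)}\otimes\cdots\otimes d_{(k)}$ be the $k$-fold unreduced comultiplication. Define chain algebra maps $\theta\curlywedge D:\Omega(C\otimes D)\to\Omega(C'\otimes D)$ and $D\curlywedge\theta:\Omega(D\otimes C)\to\Omega(D\otimes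 C')$ by $s^{-1}(1\otimes d)\mapsto s^{-1}(1\otimes d)$, $s^{-1}(d\otimes1)\mapsto s^{-1}(d\otimes1)$ respectively and, for $c\in C_+$, $s^{-1}(c\otimes d)\mapsto\sum\pm s^{-1}(c_1\otimes d_{(1)})\cdots s^{-1}(c_k\otimes d_{(k)})$ and $s^{-1}(d\otimes c)\mapsto\sum\pm s^{-1}(d_{(1)}\otimes c_1)\cdots s^{-1}(d_{(k)}\otimes c_k)$, with the Koszul sign of interleaving the symbols $s^{-1}c_j$ and $d_{(j)}$. Put $\theta\curlywedge\theta=(C'\curlywedge\theta)\circ(\theta\curlywedge C)$. Alexander-Whitney coalgebras. Milgram's map $q:\Omega(C\otimes D)\to\Omega C\otimes\Omega D$ is the chain algebra map with $q(s^{-1}(c\otimes1))=s^{-1}c\otimes1$, $q(s^{-1}(1\otimes d))=1\otimes s^{-1}d$, $q(s^{-1}(c\otimes d))=0$ for $c\in C_+,d\in D_+$. An Alexander-Whitney coalgebra is a pair $(C,\Psi)$ with $C$ simply connected and $\Psi:\Omega C\to\Omega(C\otimes C)$ a chain algebra map with linear part the comultiplication $\Delta$, such that $\psi=q\Psi$ is coassociative. A morphism $\theta:(C,\Psi)\to(C',\Psi')$ is a chain algebra map $\theta:\Omega C\to\Omega C'$ with $\Psi'\theta=(\theta\curlywedge\theta)\Psi$; it is an $\mathbf F$-quasi-isomorphism if its linear part $C\to C'$ is a quasi-isomorphism. Two Alexander-Whitney coalgebras are weakly equivalent if connected by a zig-zag of $\mathbf F$-quasi-isomorphisms. $(C,\Psi)$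 is formal if it is weakly equivalent to $(H,\Psi_H)$, where $H=\mathrm H_*(C)$ is the homology coalgebra (cocommutative, zero differential, comultiplication $\Delta_H$) and $\Psi_H=\Omega(\Delta_H):\Omega H\to\Omega(H\otimes H)$. Double-loop construction. For $C$ with $C_1=C_2=0$, $\mathfrak P(C)=R\oplus C_+\oplus\overline C_+$, $\overline C_+=s^{-1}C_+$, $\bar c=s^{-1}c$, with $\tilde dc=dc-\bar c$, $\tilde d\bar c=-\overline{dc}$, comultiplication extending $\Delta$ and $\widetilde\Delta(\bar c)=(\sigma\otimes\iota+\iota\otimes\sigma)\Delta(c)$, where $\iota(c)=c$, $\sigma(c)=\bar c$, $\sigma(1)=0$; $\pi:\mathfrak P(C)\to C$ is the projection killing $\overline C_+$. Let $\iota:\Omega C\to\Omega\mathfrak P(C)$ be the (nondifferential) inclusion of algebras and $\kappa:\Omega C\to\Omega\mathfrak P(C)$ the degree $-1$ $(\iota,\iota)$-derivation with $\kappa(s^{-1}c)=-s^{-1}\bar c$. $\Omega\mathfrak P(C)$ is a chain Hopf algebra with comultiplication the algebra map $\tilde\psi$ with $\tilde\psi(s^{-1}c)=(\iota\otimes\iota)\psi(s^{-1}c)$, $\tilde\psi(s^{-1}\bar c)=-(\kappa\otimes\iota+\iota\otimes\kappa)\psi(s^{-1}c)$, and $\mathfrak L_2(C,\Psi)=\{x\in\Omega\mathfrak P(C):(1\otimes\Omega\pi)\tilde\psi(x)=x\otimes1\}$, a sub chain algebra. For graded modules $V$, $W$, $\mathfrak A^{\mathbb N}(V)(W)$ denotes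 the graded submodule of the free graded Lie algebra $\mathbb L(V\oplus W)$ (inside $T(V\oplus W)$) spanned by all iterated graded commutators $[v_1,[v_2,[\dots[v_k,w]\dots]]]$ with $k\ge0$, $v_i\in V$, $w\in W$. In the statement $s^{-1}H$, $s^{-1}\overline H$ mean $s^{-1}H_+$ and $s^{-1}(s^{-1}H_+)$. *)

theory Defs
  imports Complex_Main "HOL-Library.Poly_Mapping"
begin

text \<open>
  A free \<open>R\<close>-module with a chosen basis indexed by elements of a type is given by finitely
  supported functions \<open>'x \<Rightarrow>\<^sub>0 'r\<close>. The set of basis elements that are
  really present is a separate carrier set, so that a fixed type can host many different modules.
  A map given on basis elements is extended linearly by \<open>lin\<close>.
\<close>

definition gen :: "'x \<Rightarrow> ('x \<Rightarrow>\<^sub>0 'r::comm_ring_1)" where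
  "gen x = Poly_Mapping.single x 1"

definition smul :: "'r \<Rightarrow> ('x \<Rightarrow>\<^sub>0 'r) \<Rightarrow> ('x \<Rightarrow>\<^sub>0 'r::comm_ring_1)" where
  "smul r p = Poly_Mapping.map ((*) r) p"

lemma lookup_smul [simp]: "Poly_Mapping.lookup (smul r p) x = r * Poly_Mapping.lookup p x"
  by (simp add: smul_def Poly_Mapping.map.rep_eq when_def)

global_interpretation pm: module "smul :: 'r::comm_ring_1 \<Rightarrow> ('x \<Rightarrow>\<^sub>0 'r) \<Rightarrow> ('x \<Rightarrow>\<^sub>0 'r)"
  by standard (auto intro!: poly_mapping_eqI simp: lookup_add algebra_simps)

definition lin :: "('x \<Rightarrow> ('y \<Rightarrow>\<^sub>0 'r)) \<Rightarrow> ('x \<Rightarrow>\<^sub>0 'r) \<Rightarrow> ('y \<Rightarrow>\<^sub>0 'r::comm_ring_1)" where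
  "lin f p = (\<Sum>x\<in>Poly_Mapping.keys p. smul (Poly_Mapping.lookup p x) (f x))"

definition bilin :: "('x \<Rightarrow> 'y \<Rightarrow> ('z \<Rightarrow>\<^sub>0 'r)) \<Rightarrow> ('x \<Rightarrow>\<^sub>0 'r) \<Rightarrow> ('y \<Rightarrow>\<^sub>0 'r)
    \<Rightarrow> ('z \<Rightarrow>\<^sub>0 'r::comm_ring_1)" where
  "bilin h p q = lin (\<lambda>x. lin (\<lambda>y. h x y) q) p"

definition tens :: "('x \<Rightarrow>\<^sub>0 'r) \<Rightarrow> ('y \<Rightarrow>\<^sub>0 'r) \<Rightarrow> ('x \<times> 'y \<Rightarrow>\<^sub>0 'r::comm_ring_1)" where
  "tens = bilin (\<lambda>x y. gen (x, y))"

definition sg :: "nat \<Rightarrow> 'r::comm_ring_1" where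
  "sg n = (- 1) ^ n"

text \<open>
  \<open>tmap k deg f g\<close> is \<open>f \<otimes> g\<close> for a map \<open>g\<close> whose degree is congruent to \<open>k\<close> modulo 2,
  \<open>deg\<close> being the degree function on the first factor:
  \<open>(f \<otimes> g)(x \<otimes> y) = (-1)\<^bsup>|g||x|\<^esup> f x \<otimes> g y\<close>.
\<close>

definition tmap :: "nat \<Rightarrow> ('x \<Rightarrow> nat) \<Rightarrow> ('x \<Rightarrow> ('u \<Rightarrow>\<^sub>0 'r)) \<Rightarrow> ('y \<Rightarrow> ('v \<Rightarrow>\<^sub>0 'r))
    \<Rightarrow> ('x \<times> 'y \<Rightarrow>\<^sub>0 'r) \<Rightarrow> ('u \<times> 'v \<Rightarrow>\<^sub>0 'r::comm_ring_1)" where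
  "tmap k deg f g = lin (\<lambda>(x, y). smul (sg (k * deg x)) (tens (f x) (g y)))"

definition assoc :: "(('x \<times> 'y) \<times> 'z \<Rightarrow>\<^sub>0 'r) \<Rightarrow> ('x \<times> ('y \<times> 'z) \<Rightarrow>\<^sub>0 'r::comm_ring_1)" where
  "assoc = lin (\<lambda>((x, y), z). gen (x, (y, z)))"

section \<open>Homology\<close>

text \<open>A chain complex is a family \<open>G n\<close> of submodules together with a differential \<open>d\<close>;
  its homology in degree \<open>n\<close> is the set of cosets of boundaries in the cycles.\<close>

definition cycles :: "(nat \<Rightarrow> 'm set) \<Rightarrow> ('m \<Rightarrow> 'm) \<Rightarrow> nat \<Rightarrow> 'm::ab_group_add set" where
  "cycles G d n = {x \<in> G n. d x = 0}"

definition hrel :: "(nat \<Rightarrow> 'm set) \<Rightarrow> ('m \<Rightarrow> 'm) \<Rightarrow> nat \<Rightarrow> ('m \<times> 'm::ab_group_add) set" where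
  "hrel G d n = {(x, y). x \<in> cycles G d n \<and> y \<in> cycles G d n \<and> x - y \<in> d ` G (Suc n)}"

definition homology :: "(nat \<Rightarrow> 'm set) \<Rightarrow> ('m \<Rightarrow> 'm) \<Rightarrow> nat \<Rightarrow> 'm::ab_group_add set set" where
  "homology G d n = cycles G d n // hrel G d n"

definition quasi_iso :: "(nat \<Rightarrow> 'm set) \<Rightarrow> ('m \<Rightarrow> 'm) \<Rightarrow> (nat \<Rightarrow> 'k set) \<Rightarrow> ('k \<Rightarrow> 'k)
    \<Rightarrow> ('m::ab_group_add \<Rightarrow> 'k::ab_group_add) \<Rightarrow> bool" where
  "quasi_iso G d G' d' f \<longleftrightarrow>
     (\<forall>n. bij_betw (\<lambda>X. \<Union>z\<in>X. hrel G' d' n `` {f z}) (homology G d n) (homology G' d' n))"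

section \<open>Graded algebras and chain algebras\<close>

record (overloaded) ('x, 'r) galg =
  grade :: "nat \<Rightarrow> ('x \<Rightarrow>\<^sub>0 'r) set"
  mul :: "('x \<Rightarrow>\<^sub>0 'r) \<Rightarrow> ('x \<Rightarrow>\<^sub>0 'r) \<Rightarrow> ('x \<Rightarrow>\<^sub>0 'r)"
  one :: "'x \<Rightarrow>\<^sub>0 'r"

record (overloaded) ('x, 'r) dga = "('x, 'r) galg" +
  dif :: "('x \<Rightarrow>\<^sub>0 'r) \<Rightarrow> ('x \<Rightarrow>\<^sub>0 'r)"

definition carr :: "(nat \<Rightarrow> ('x \<Rightarrow>\<^sub>0 'r) set) \<Rightarrow> ('x \<Rightarrow>\<^sub>0 'r::comm_ring_1) set" where
  "carr G = pm.span (\<Union>n. G n)"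

definition free_graded_module :: "(nat \<Rightarrow> ('x \<Rightarrow>\<^sub>0 'r::comm_ring_1) set) \<Rightarrow> bool" where
  "free_graded_module G \<longleftrightarrow>
     (\<forall>n. \<exists>X. pm.independent X \<and> pm.span X = G n) \<and>
     (\<forall>x. (\<forall>n. x n \<in> G n) \<and> finite {n. x n \<noteq> 0} \<and> (\<Sum>n | x n \<noteq> 0. x n) = 0 \<longrightarrow> (\<forall>n. x n = 0))"

definition linear_on :: "('x \<Rightarrow>\<^sub>0 'r) set \<Rightarrow> (('x \<Rightarrow>\<^sub>0 'r) \<Rightarrow> ('y \<Rightarrow>\<^sub>0 'r::comm_ring_1)) \<Rightarrow> bool" where
  "linear_on M f \<longleftrightarrow> (\<forall>x\<in>M. \<forall>y\<in>M. f (x + y) = f x + f y) \<and> (\<forall>r. \<forall>x\<in>M. f (smul r x) = smul r (f x))"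

definition graded_algebra :: "('x, 'r::comm_ring_1, 'z) galg_scheme \<Rightarrow> bool" where
  "graded_algebra A \<longleftrightarrow>
     free_graded_module (grade A) \<and>
     (\<forall>x\<in>carr (grade A). linear_on (carr (grade A)) (mul A x)
        \<and> linear_on (carr (grade A)) (\<lambda>y. mul A y x)) \<and>
     (\<forall>m n. \<forall>x\<in>grade A m. \<forall>y\<in>grade A n. mul A x y \<in> grade A (m + n)) \<and>
     (\<forall>x\<in>carr (grade A). \<forall>y\<in>carr (grade A). \<forall>z\<in>carr (grade A).
        mul A (mul A x y) z = mul A x (mul A y z)) \<and>
     one A \<in> grade A 0 \<and>
     (\<forall>x\<in>carr (grade A). mul A (one A) x = x \<and> mul A x (one A) = x)"

definition chain_algebra :: "('x, 'r::comm_ring_1) dga \<Rightarrow> bool" where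
  "chain_algebra A \<longleftrightarrow>
     graded_algebra A \<and>
     linear_on (carr (grade A)) (dif A) \<and>
     (\<forall>x\<in>grade A 0. dif A x = 0) \<and>
     (\<forall>n. \<forall>x\<in>grade A (Suc n). dif A x \<in> grade A n) \<and>
     (\<forall>x\<in>carr (grade A). dif A (dif A x) = 0) \<and>
     (\<forall>m. \<forall>x\<in>grade A m. \<forall>y\<in>carr (grade A).
        dif A (mul A x y) = mul A (dif A x) y + smul (sg m) (mul A x (dif A y)))"

definition alg_hom :: "('x, 'r, 'z) galg_scheme \<Rightarrow> ('y, 'r, 'w) galg_scheme
    \<Rightarrow> (('x \<Rightarrow>\<^sub>0 'r) \<Rightarrow> ('y \<Rightarrow>\<^sub>0 'r::comm_ring_1)) \<Rightarrow> bool" where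
  "alg_hom A B f \<longleftrightarrow>
     linear_on (carr (grade A)) f \<and>
     (\<forall>n. f ` grade A n \<subseteq> grade B n) \<and>
     (\<forall>x\<in>carr (grade A). \<forall>y\<in>carr (grade A). f (mul A x y) = mul B (f x) (f y)) \<and>
     f (one A) = one B"

definition alg_isomorphic :: "('x, 'r, 'z) galg_scheme \<Rightarrow> ('y, 'r::comm_ring_1, 'w) galg_scheme \<Rightarrow> bool" where
  "alg_isomorphic A B \<longleftrightarrow> (\<exists>f. alg_hom A B f \<and> (\<forall>n. bij_betw f (grade A n) (grade B n)))"

definition chain_alg_hom :: "('x, 'r) dga \<Rightarrow> ('y, 'r) dga
    \<Rightarrow> (('x \<Rightarrow>\<^sub>0 'r) \<Rightarrow> ('y \<Rightarrow>\<^sub>0 'r::comm_ring_1)) \<Rightarrow> bool" where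
  "chain_alg_hom A B f \<longleftrightarrow> alg_hom A B f \<and> (\<forall>x\<in>carr (grade A). f (dif A x) = dif B (f x))"

definition alg_quasi_iso :: "('x, 'r) dga \<Rightarrow> ('x, 'r::comm_ring_1) dga \<Rightarrow> bool" where
  "alg_quasi_iso A B \<longleftrightarrow> chain_algebra A \<and> chain_algebra B \<and>
     (\<exists>f. chain_alg_hom A B f \<and> quasi_iso (grade A) (dif A) (grade B) (dif B) f)"

definition chain_alg_weakly_equivalent :: "('x, 'r) dga \<Rightarrow> ('x, 'r::comm_ring_1) dga \<Rightarrow> bool" where
  "chain_alg_weakly_equivalent A B \<longleftrightarrow>
     chain_algebra A \<and> chain_algebra B \<and> equivclp alg_quasi_iso A B"

section \<open>Tensor algebras\<close>

text \<open>
  The tensor algebra on the free graded module with homogeneous basis \<open>S\<close> and degrees \<open>dg\<close> has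
  the words in \<open>S\<close> as basis and concatenation as product.
\<close>

definition cat :: "('x list \<Rightarrow>\<^sub>0 'r) \<Rightarrow> ('x list \<Rightarrow>\<^sub>0 'r) \<Rightarrow> ('x list \<Rightarrow>\<^sub>0 'r::comm_ring_1)" where
  "cat = bilin (\<lambda>u v. gen (u @ v))"

definition wdeg :: "('x \<Rightarrow> nat) \<Rightarrow> 'x list \<Rightarrow> nat" where
  "wdeg dg w = (\<Sum>x\<leftarrow>w. dg x)"

definition tensor_algebra :: "'x set \<Rightarrow> ('x \<Rightarrow> nat) \<Rightarrow> ('x list, 'r::comm_ring_1) galg" where
  "tensor_algebra S dg =
     \<lparr> grade = (\<lambda>n. {p. \<forall>w\<in>Poly_Mapping.keys p. set w \<subseteq> S \<and> wdeg dg w = n}),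
       mul = cat, one = gen [] \<rparr>"

text \<open>The algebra map out of a tensor algebra with given values \<open>f\<close> on the letters; \<open>m\<close> and \<open>e\<close>
  are the product and the unit of the target.\<close>

definition alg_ext :: "(('y \<Rightarrow>\<^sub>0 'r) \<Rightarrow> ('y \<Rightarrow>\<^sub>0 'r) \<Rightarrow> ('y \<Rightarrow>\<^sub>0 'r)) \<Rightarrow> ('y \<Rightarrow>\<^sub>0 'r)
    \<Rightarrow> ('x \<Rightarrow> ('y \<Rightarrow>\<^sub>0 'r)) \<Rightarrow> ('x list \<Rightarrow>\<^sub>0 'r) \<Rightarrow> ('y \<Rightarrow>\<^sub>0 'r::comm_ring_1)" where
  "alg_ext m e f = lin (\<lambda>w. foldr (\<lambda>x acc. m (f x) acc) w e)"

text \<open>The derivation of odd degree with values \<open>f\<close> on the letters, with respect to the algebra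
  map that relabels letters by \<open>j\<close> (on both sides).\<close>

fun wder :: "('x \<Rightarrow> nat) \<Rightarrow> ('x \<Rightarrow> 'y) \<Rightarrow> ('x \<Rightarrow> ('y list \<Rightarrow>\<^sub>0 'r)) \<Rightarrow> 'x list
    \<Rightarrow> ('y list \<Rightarrow>\<^sub>0 'r::comm_ring_1)" where
  "wder dg j f [] = 0"
| "wder dg j f (x # w) =
     cat (f x) (gen (map j w)) + smul (sg (dg x)) (cat (gen [j x]) (wder dg j f w))"

section \<open>Chain coalgebras\<close>

text \<open>
  A chain coalgebra on a free graded module with homogeneous basis \<open>basis C\<close>; \<open>cunit C\<close> is the
  basis element \<open>1\<close> of \<open>C\<^sub>0 = R\<close>, so coaugmentation and counit are both determined by it.
\<close>

record (overloaded) ('b, 'r) coalg =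
  basis :: "'b set"
  deg :: "'b \<Rightarrow> nat"
  cunit :: "'b"
  cdif :: "'b \<Rightarrow> ('b \<Rightarrow>\<^sub>0 'r)"
  comul :: "'b \<Rightarrow> ('b \<times> 'b \<Rightarrow>\<^sub>0 'r)"

definition cgrade :: "('b, 'r::comm_ring_1) coalg \<Rightarrow> nat \<Rightarrow> ('b \<Rightarrow>\<^sub>0 'r) set" where
  "cgrade C n = {p. \<forall>b\<in>Poly_Mapping.keys p. b \<in> basis C \<and> deg C b = n}"

definition basis_pos :: "('b, 'r) coalg \<Rightarrow> 'b set" where
  "basis_pos C = {b \<in> basis C. deg C b > 0}"

definition tcoalg :: "('b, 'r) coalg \<Rightarrow> ('d, 'r) coalg \<Rightarrow> ('b \<times> 'd, 'r::comm_ring_1) coalg"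
    (infixr \<open>\<otimes>\<^sub>c\<close> 70) where
  "C \<otimes>\<^sub>c D =
     \<lparr> basis = basis C \<times> basis D,
       deg = (\<lambda>(c, d). deg C c + deg D d),
       cunit = (cunit C, cunit D),
       cdif = (\<lambda>(c, d). tens (cdif C c) (gen d) + smul (sg (deg C c)) (tens (gen c) (cdif D d))),
       comul = (\<lambda>(c, d). bilin (\<lambda>(c1, c2) (d1, d2).
           smul (sg (deg C c2 * deg D d1)) (gen ((c1, d1), (c2, d2)))) (comul C c) (comul D d)) \<rparr>"

definition chain_coalgebra :: "('b, 'r::comm_ring_1) coalg \<Rightarrow> bool" where
  "chain_coalgebra C \<longleftrightarrow>
     {b \<in> basis C. deg C b = 0} = {cunit C} \<and>
     (\<forall>b\<in>basis C.
        Poly_Mapping.keys (cdif C b) \<subseteq> {b' \<in> basis C. deg C b' + 1 = deg C b} \<and>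
        cunit C \<notin> Poly_Mapping.keys (cdif C b) \<and>
        lin (cdif C) (cdif C b) = 0 \<and>
        Poly_Mapping.keys (comul C b) \<subseteq>
          {(x, y). x \<in> basis C \<and> y \<in> basis C \<and> deg C x + deg C y = deg C b} \<and>
        lin (comul C) (cdif C b) = lin (cdif (C \<otimes>\<^sub>c C)) (comul C b) \<and>
        assoc (tmap 0 (deg C) (comul C) gen (comul C b)) = tmap 0 (deg C) gen (comul C) (comul C b) \<and>
        lin (\<lambda>(x, y). if x = cunit C then gen y else 0) (comul C b) = gen b \<and>
        lin (\<lambda>(x, y). if y = cunit C then gen x else 0) (comul C b) = gen b) \<and>
     comul C (cunit C) = gen (cunit C, cunit C)"

definition simply_connected :: "('b, 'r::comm_ring_1) coalg \<Rightarrow> bool" where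
  "simply_connected C \<longleftrightarrow> chain_coalgebra C \<and> (\<forall>b\<in>basis C. deg C b \<noteq> 1)"

definition cocommutative :: "('b, 'r::comm_ring_1) coalg \<Rightarrow> bool" where
  "cocommutative C \<longleftrightarrow> (\<forall>b\<in>basis C.
     lin (\<lambda>(x, y). smul (sg (deg C x * deg C y)) (gen (y, x))) (comul C b) = comul C b)"

definition reduced_comul :: "('b, 'r::comm_ring_1) coalg \<Rightarrow> 'b \<Rightarrow> ('b \<times> 'b \<Rightarrow>\<^sub>0 'r)" where
  "reduced_comul C c = comul C c - gen (c, cunit C) - gen (cunit C, c)"

text \<open>\<open>k\<close>-fold unreduced comultiplication; for \<open>k = 0\<close> it is the counit.\<close>

fun iter_comul :: "('b, 'r::comm_ring_1) coalg \<Rightarrow> nat \<Rightarrow> 'b \<Rightarrow> ('b list \<Rightarrow>\<^sub>0 'r)" where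
  "iter_comul C 0 c = (if c = cunit C then gen [] else 0)"
| "iter_comul C (Suc 0) c = gen [c]"
| "iter_comul C (Suc (Suc k)) c =
     lin (\<lambda>(x, y). lin (\<lambda>w. gen (x # w)) (iter_comul C (Suc k) y)) (comul C c)"

section \<open>The cobar construction\<close>

text \<open>
  The word \<open>[c\<^sub>1, \<dots>, c\<^sub>n]\<close> stands for \<open>s\<^sup>-\<^sup>1c\<^sub>1 \<cdots> s\<^sup>-\<^sup>1c\<^sub>n\<close>. Desuspension sends the unit to 0.
\<close>

definition desusp :: "('b, 'r) coalg \<Rightarrow> 'b \<Rightarrow> ('b list \<Rightarrow>\<^sub>0 'r::comm_ring_1)" where
  "desusp C c = (if c = cunit C then 0 else gen [c])"

definition sdeg :: "('b, 'r) coalg \<Rightarrow> 'b \<Rightarrow> nat" where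
  "sdeg C c = deg C c - 1"

definition cobar_dgen :: "('b, 'r::comm_ring_1) coalg \<Rightarrow> 'b \<Rightarrow> ('b list \<Rightarrow>\<^sub>0 'r)" where
  "cobar_dgen C c = - lin (desusp C) (cdif C c)
     + lin (\<lambda>(x, y). smul (sg (deg C x)) (cat (desusp C x) (desusp C y))) (reduced_comul C c)"

definition cobar :: "('b, 'r::comm_ring_1) coalg \<Rightarrow> ('b list, 'r) dga" where
  "cobar C = galg.extend (tensor_algebra (basis_pos C) (sdeg C))
     \<lparr> dif = lin (wder (sdeg C) id (cobar_dgen C)) \<rparr>"

definition cobar_map :: "('b, 'r) coalg \<Rightarrow> ('d, 'r) coalg \<Rightarrow> ('b \<Rightarrow> ('d \<Rightarrow>\<^sub>0 'r))
    \<Rightarrow> ('b list \<Rightarrow>\<^sub>0 'r) \<Rightarrow> ('d list \<Rightarrow>\<^sub>0 'r::comm_ring_1)" where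
  "cobar_map C D f = alg_ext cat (gen []) (\<lambda>c. lin (desusp D) (f c))"

definition tensor_mul :: "('x \<Rightarrow> nat) \<Rightarrow> ('y \<Rightarrow> nat) \<Rightarrow> ('x list \<times> 'y list \<Rightarrow>\<^sub>0 'r)
    \<Rightarrow> ('x list \<times> 'y list \<Rightarrow>\<^sub>0 'r) \<Rightarrow> ('x list \<times> 'y list \<Rightarrow>\<^sub>0 'r::comm_ring_1)" where
  "tensor_mul dg dg' = bilin (\<lambda>(x, y) (x', y').
     smul (sg (wdeg dg' y * wdeg dg x')) (gen (x @ x', y @ y')))"

section \<open>Strong homotopy maps\<close>

definition linear_part :: "('b, 'r) coalg \<Rightarrow> ('d, 'r) coalg
    \<Rightarrow> (('b list \<Rightarrow>\<^sub>0 'r) \<Rightarrow> ('d list \<Rightarrow>\<^sub>0 'r)) \<Rightarrow> 'b \<Rightarrow> ('d \<Rightarrow>\<^sub>0 'r::comm_ring_1)" where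
  "linear_part C D \<theta> c = (if c = cunit C then gen (cunit D)
     else lin (\<lambda>w. if length w = 1 then gen (hd w) else 0) (\<theta> (gen [c])))"

text \<open>
  Exponent of the Koszul sign of \<open>u\<^sub>1\<cdots>u\<^sub>k v\<^sub>1\<cdots>v\<^sub>k \<mapsto> u\<^sub>1v\<^sub>1\<cdots>u\<^sub>kv\<^sub>k\<close>, given the lists of degrees.
\<close>

fun interleave_exp :: "nat list \<Rightarrow> nat list \<Rightarrow> nat" where
  "interleave_exp (u # us) (v # vs) = v * sum_list us + interleave_exp us vs"
| "interleave_exp _ _ = 0"

text \<open>
  The maps \<open>\<theta> \<curlywedge> D\<close> and \<open>D \<curlywedge> \<theta>\<close>. In the second one the symbols to be interleaved are
  \<open>d\<^sub>(\<^sub>1\<^sub>)\<cdots>d\<^sub>(\<^sub>k\<^sub>)\<close> and \<open>s\<^sup>-\<^sup>1c\<^sub>1\<cdots>s\<^sup>-\<^sup>1c\<^sub>k\<close>; the sign of moving \<open>s\<^sup>-\<^sup>1\<close> in \<open>s\<^sup>-\<^sup>1(d \<otimes> c)\<close> past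
  \<open>d\<close> cancels against those of moving the \<open>s\<^sup>-\<^sup>1\<close> in front of the \<open>d\<^sub>(\<^sub>j\<^sub>)\<close>.
\<close>

definition wedge_left :: "('b, 'r) coalg \<Rightarrow> ('c, 'r) coalg \<Rightarrow> ('d, 'r) coalg
    \<Rightarrow> (('b list \<Rightarrow>\<^sub>0 'r) \<Rightarrow> ('c list \<Rightarrow>\<^sub>0 'r))
    \<Rightarrow> (('b \<times> 'd) list \<Rightarrow>\<^sub>0 'r) \<Rightarrow> (('c \<times> 'd) list \<Rightarrow>\<^sub>0 'r::comm_ring_1)" where
  "wedge_left C C' D \<theta> = alg_ext cat (gen []) (\<lambda>(c, d).
     if c = cunit C then gen [(cunit C', d)]
     else lin (\<lambda>cs. lin (\<lambda>ds.
            smul (sg (interleave_exp (map (sdeg C') cs) (map (deg D) ds))) (gen (zip cs ds)))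
          (iter_comul D (length cs) d)) (\<theta> (gen [c])))"

definition wedge_right :: "('b, 'r) coalg \<Rightarrow> ('c, 'r) coalg \<Rightarrow> ('d, 'r) coalg
    \<Rightarrow> (('b list \<Rightarrow>\<^sub>0 'r) \<Rightarrow> ('c list \<Rightarrow>\<^sub>0 'r))
    \<Rightarrow> (('d \<times> 'b) list \<Rightarrow>\<^sub>0 'r) \<Rightarrow> (('d \<times> 'c) list \<Rightarrow>\<^sub>0 'r::comm_ring_1)" where
  "wedge_right C C' D \<theta> = alg_ext cat (gen []) (\<lambda>(d, c).
     if c = cunit C then gen [(d, cunit C')]
     else lin (\<lambda>cs. lin (\<lambda>ds.
            smul (sg (interleave_exp (map (deg D) ds) (map (sdeg C') cs))) (gen (zip ds cs)))
          (iter_comul D (length cs) d)) (\<theta> (gen [c])))"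

definition wedge_square :: "('b, 'r) coalg \<Rightarrow> ('c, 'r) coalg
    \<Rightarrow> (('b list \<Rightarrow>\<^sub>0 'r) \<Rightarrow> ('c list \<Rightarrow>\<^sub>0 'r))
    \<Rightarrow> (('b \<times> 'b) list \<Rightarrow>\<^sub>0 'r) \<Rightarrow> (('c \<times> 'c) list \<Rightarrow>\<^sub>0 'r::comm_ring_1)" where
  "wedge_square C C' \<theta> = wedge_right C C' C' \<theta> \<circ> wedge_left C C' C \<theta>"

section \<open>Alexander-Whitney coalgebras\<close>

definition milgram :: "('b, 'r) coalg \<Rightarrow> ('d, 'r) coalg
    \<Rightarrow> (('b \<times> 'd) list \<Rightarrow>\<^sub>0 'r) \<Rightarrow> ('b list \<times> 'd list \<Rightarrow>\<^sub>0 'r::comm_ring_1)" where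
  "milgram C D = alg_ext (tensor_mul (sdeg C) (sdeg D)) (gen ([], [])) (\<lambda>(c, d).
     if d = cunit D then gen ([c], []) else if c = cunit C then gen ([], [d]) else 0)"

definition aw_psi :: "('b, 'r) coalg \<Rightarrow> (('b list \<Rightarrow>\<^sub>0 'r) \<Rightarrow> (('b \<times> 'b) list \<Rightarrow>\<^sub>0 'r))
    \<Rightarrow> ('b list \<Rightarrow>\<^sub>0 'r) \<Rightarrow> ('b list \<times> 'b list \<Rightarrow>\<^sub>0 'r::comm_ring_1)" where
  "aw_psi C \<Psi> = milgram C C \<circ> \<Psi>"

type_synonym ('b, 'r) aw_pair =
  "('b, 'r) coalg \<times> (('b list \<Rightarrow>\<^sub>0 'r) \<Rightarrow> (('b \<times> 'b) list \<Rightarrow>\<^sub>0 'r))"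

definition aw_coalgebra :: "('b, 'r::comm_ring_1) aw_pair \<Rightarrow> bool" where
  "aw_coalgebra = (\<lambda>(C, \<Psi>).
     simply_connected C \<and>
     chain_alg_hom (cobar C) (cobar (C \<otimes>\<^sub>c C)) \<Psi> \<and>
     (\<forall>c\<in>basis C. linear_part C (C \<otimes>\<^sub>c C) \<Psi> c = comul C c) \<and>
     (\<forall>x\<in>carr (grade (cobar C)).
        assoc (tmap 0 (wdeg (sdeg C)) (\<lambda>w. aw_psi C \<Psi> (gen w)) gen (aw_psi C \<Psi> x))
          = tmap 0 (wdeg (sdeg C)) gen (\<lambda>w. aw_psi C \<Psi> (gen w)) (aw_psi C \<Psi> x)))"

definition aw_morphism :: "('b, 'r) aw_pair \<Rightarrow> ('c, 'r) aw_pair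
    \<Rightarrow> (('b list \<Rightarrow>\<^sub>0 'r) \<Rightarrow> ('c list \<Rightarrow>\<^sub>0 'r::comm_ring_1)) \<Rightarrow> bool" where
  "aw_morphism = (\<lambda>(C, \<Psi>) (C', \<Psi>') \<theta>.
     chain_alg_hom (cobar C) (cobar C') \<theta> \<and>
     (\<forall>x\<in>carr (grade (cobar C)). \<Psi>' (\<theta> x) = wedge_square C C' \<theta> (\<Psi> x)))"

definition F_quasi_iso :: "('b, 'r::comm_ring_1) aw_pair \<Rightarrow> ('b, 'r) aw_pair \<Rightarrow> bool" where
  "F_quasi_iso P P' \<longleftrightarrow> aw_coalgebra P \<and> aw_coalgebra P' \<and>
     (\<exists>\<theta>. aw_morphism P P' \<theta> \<and>
        quasi_iso (cgrade (fst P)) (lin (cdif (fst P))) (cgrade (fst P')) (lin (cdif (fst P')))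
          (lin (linear_part (fst P) (fst P') \<theta>)))"

definition aw_weakly_equivalent :: "('b, 'r::comm_ring_1) aw_pair \<Rightarrow> ('b, 'r) aw_pair \<Rightarrow> bool" where
  "aw_weakly_equivalent P P' \<longleftrightarrow> aw_coalgebra P \<and> aw_coalgebra P' \<and> equivclp F_quasi_iso P P'"

text \<open>
  \<open>H\<close> is the homology coalgebra of \<open>C\<close>: a coalgebra with zero differential and an isomorphism
  \<open>H \<cong> H\<^sub>*(C)\<close>, written as \<open>h \<mapsto> [\<zeta> h]\<close> for a choice \<open>\<zeta>\<close> of representing cycles (possible since
  \<open>H\<close> is free), under which \<open>\<Delta>\<^sub>H\<close> corresponds to the map induced by \<open>\<Delta>\<close> and the cross product
  \<open>[x] \<otimes> [y] \<mapsto> [x \<otimes> y]\<close>.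
\<close>

definition homology_coalgebra :: "('b, 'r) coalg \<Rightarrow> ('h, 'r::comm_ring_1) coalg \<Rightarrow> bool" where
  "homology_coalgebra C H \<longleftrightarrow>
     chain_coalgebra H \<and> (\<forall>h\<in>basis H. cdif H h = 0) \<and>
     (\<exists>\<zeta>. (\<forall>h\<in>basis H. \<zeta> h \<in> cycles (cgrade C) (lin (cdif C)) (deg H h)) \<and>
        (\<forall>n. bij_betw (\<lambda>x. hrel (cgrade C) (lin (cdif C)) n `` {lin \<zeta> x})
               (cgrade H n) (homology (cgrade C) (lin (cdif C)) n)) \<and>
        \<zeta> (cunit H) = gen (cunit C) \<and>
        (\<forall>h\<in>basis H. (lin (comul C) (\<zeta> h), tmap 0 (deg H) \<zeta> \<zeta> (comul H h))
           \<in> hrel (cgrade (C \<otimes>\<^sub>c C)) (lin (cdif (C \<otimes>\<^sub>c C))) (deg H h)))"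

text \<open>
  All coalgebras in a zig-zag have their bases in the same type. This is no loss, since bases can
  be relabelled and a statement about all types \<open>'b\<close> covers arbitrarily large ones.
\<close>

definition aw_formal :: "('b, 'r::comm_ring_1) aw_pair \<Rightarrow> bool" where
  "aw_formal P \<longleftrightarrow> (\<exists>H. homology_coalgebra (fst P) H \<and> cocommutative H \<and>
     aw_weakly_equivalent P (H, cobar_map H (H \<otimes>\<^sub>c H) (comul H)))"

section \<open>The double-loop construction\<close>

text \<open>In the path coalgebra \<open>R \<oplus> C\<^sub>+ \<oplus> s\<^sup>-\<^sup>1C\<^sub>+\<close>, \<open>Inl c\<close> is \<open>c\<close> and \<open>Inr c\<close> is \<open>s\<^sup>-\<^sup>1c\<close>.\<close>

definition pbar :: "('b, 'r) coalg \<Rightarrow> 'b \<Rightarrow> ('b + 'b \<Rightarrow>\<^sub>0 'r::comm_ring_1)" where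
  "pbar C c = (if c = cunit C then 0 else gen (Inr c))"

definition pinc :: "'b \<Rightarrow> ('b + 'b \<Rightarrow>\<^sub>0 'r::comm_ring_1)" where
  "pinc c = gen (Inl c)"

definition path_coalg :: "('b, 'r) coalg \<Rightarrow> ('b + 'b, 'r::comm_ring_1) coalg" where
  "path_coalg C =
     \<lparr> basis = Inl ` basis C \<union> Inr ` basis_pos C,
       deg = case_sum (deg C) (\<lambda>c. deg C c - 1),
       cunit = Inl (cunit C),
       cdif = case_sum (\<lambda>c. lin pinc (cdif C c) - pbar C c) (\<lambda>c. - lin (pbar C) (cdif C c)),
       comul = case_sum (\<lambda>c. tmap 0 (deg C) pinc pinc (comul C c))
         (\<lambda>c. tmap 0 (deg C) (pbar C) pinc (comul C c) + tmap 1 (deg C) pinc (pbar C) (comul C c)) \<rparr>"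

definition path_proj :: "'b + 'b \<Rightarrow> ('b \<Rightarrow>\<^sub>0 'r::comm_ring_1)" where
  "path_proj = case_sum gen (\<lambda>_. 0)"

definition cobar_inc :: "'b list \<Rightarrow> (('b + 'b) list \<Rightarrow>\<^sub>0 'r::comm_ring_1)" where
  "cobar_inc w = gen (map Inl w)"

definition kappa :: "('b, 'r) coalg \<Rightarrow> 'b list \<Rightarrow> (('b + 'b) list \<Rightarrow>\<^sub>0 'r::comm_ring_1)" where
  "kappa C = wder (sdeg C) Inl (\<lambda>c. - gen [Inr c])"

definition path_psi :: "('b, 'r) aw_pair
    \<Rightarrow> (('b + 'b) list \<Rightarrow>\<^sub>0 'r) \<Rightarrow> (('b + 'b) list \<times> ('b + 'b) list \<Rightarrow>\<^sub>0 'r::comm_ring_1)" where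
  "path_psi = (\<lambda>(C, \<Psi>).
     alg_ext (tensor_mul (sdeg (path_coalg C)) (sdeg (path_coalg C))) (gen ([], []))
       (case_sum
         (\<lambda>c. tmap 0 (wdeg (sdeg C)) cobar_inc cobar_inc (aw_psi C \<Psi> (gen [c])))
         (\<lambda>c. - (tmap 0 (wdeg (sdeg C)) (kappa C) cobar_inc (aw_psi C \<Psi> (gen [c]))
                 + tmap 1 (wdeg (sdeg C)) cobar_inc (kappa C) (aw_psi C \<Psi> (gen [c]))))))"

definition double_loop :: "('b, 'r) aw_pair \<Rightarrow> (('b + 'b) list, 'r::comm_ring_1) dga" where
  "double_loop = (\<lambda>(C, \<Psi>). (cobar (path_coalg C))
     \<lparr> grade := (\<lambda>n. {x \<in> grade (cobar (path_coalg C)) n.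
         tmap 0 (wdeg (sdeg (path_coalg C))) gen
             (\<lambda>w. cobar_map (path_coalg C) C path_proj (gen w)) (path_psi (C, \<Psi>) x)
           = tens x (gen [])}) \<rparr>)"

section \<open>Iterated brackets\<close>

definition gbracket :: "('x \<Rightarrow> nat) \<Rightarrow> ('x list \<Rightarrow>\<^sub>0 'r) \<Rightarrow> ('x list \<Rightarrow>\<^sub>0 'r)
    \<Rightarrow> ('x list \<Rightarrow>\<^sub>0 'r::comm_ring_1)" where
  "gbracket dg = bilin (\<lambda>u v. gen (u @ v) - smul (sg (wdeg dg u * wdeg dg v)) (gen (v @ u)))"

inductive_set iter_brackets :: "('x \<Rightarrow> nat) \<Rightarrow> ('x list \<Rightarrow>\<^sub>0 'r) set \<Rightarrow> ('x list \<Rightarrow>\<^sub>0 'r) set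
    \<Rightarrow> ('x list \<Rightarrow>\<^sub>0 'r::comm_ring_1) set"
  for dg V W where
  base: "w \<in> W \<Longrightarrow> w \<in> iter_brackets dg V W"
| step: "v \<in> V \<Longrightarrow> x \<in> iter_brackets dg V W \<Longrightarrow> gbracket dg v x \<in> iter_brackets dg V W"

text \<open>The graded module \<open>\<AA>\<^sup>\<nat>(V)(W)\<close>, as a submodule of \<open>T(V \<oplus> W)\<close>, for free graded modules \<open>V\<close>,
  \<open>W\<close> with homogeneous bases \<open>SV\<close>, \<open>SW\<close>; the letters of \<open>T(V \<oplus> W)\<close> are \<open>SV <+> SW\<close>.\<close>

definition ad_module :: "'v set \<Rightarrow> ('v \<Rightarrow> nat) \<Rightarrow> 'w set \<Rightarrow> ('w \<Rightarrow> nat)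
    \<Rightarrow> nat \<Rightarrow> (('v + 'w) list \<Rightarrow>\<^sub>0 'r::comm_ring_1) set" where
  "ad_module SV dv SW dw n =
     pm.span (iter_brackets (case_sum dv dw)
        (pm.span ((\<lambda>v. gen [Inl v]) ` SV)) (pm.span ((\<lambda>w. gen [Inr w]) ` SW)))
     \<inter> grade (tensor_algebra (SV <+> SW) (case_sum dv dw)) n"

definition homogeneous_basis :: "(nat \<Rightarrow> ('x \<Rightarrow>\<^sub>0 'r) set) \<Rightarrow> ('x \<Rightarrow>\<^sub>0 'r::comm_ring_1) set \<Rightarrow> bool" where
  "homogeneous_basis G X \<longleftrightarrow> X \<subseteq> (\<Union>n. G n) \<and> pm.independent X \<and> pm.span X = carr G"

definition elem_degree :: "(nat \<Rightarrow> 'm set) \<Rightarrow> 'm \<Rightarrow> nat" where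
  "elem_degree G x = (THE n. x \<in> G n)"

text \<open>The graded module \<open>G\<close> is free and the graded algebra \<open>B\<close> is isomorphic to \<open>T(G)\<close>, formed on
  the words in a homogeneous basis of \<open>G\<close>.\<close>

definition is_tensor_algebra_on :: "('y, 'r, 'z) galg_scheme \<Rightarrow> (nat \<Rightarrow> ('x \<Rightarrow>\<^sub>0 'r::comm_ring_1) set) \<Rightarrow> bool" where
  "is_tensor_algebra_on B G \<longleftrightarrow>
     (\<exists>X. homogeneous_basis G X \<and> alg_isomorphic (tensor_algebra X (elem_degree G)) B)"

end

theory Submission
  imports Defs
begin

text \<open>
  Write \<open>A = \<Omega>C = T(V)\<close> with the comultiplication \<open>\<psi>\<close>. In \<open>\<Omega>\<PP>(C)\<close> one has \<open>d\<iota> = \<iota>d + \<lambda>\<close> and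
  \<open>d\<lambda> = -\<lambda>d\<close> for \<open>\<lambda> = -\<kappa>\<close>, and \<open>(1 \<otimes> \<Omega>\<pi>)\<psi>~\<close> restricts to \<open>(\<iota> \<otimes> 1)\<psi>\<close> and \<open>(\<lambda> \<otimes> 1)\<psi>\<close> along
  \<open>\<iota>\<close> and \<open>\<lambda>\<close>. Since \<open>\<psi>\<close> is conilpotent, the convolution equation \<open>\<tau> * \<iota> = \<lambda>\<close> has a unique solution \<open>\<tau>\<close>;
  cancelling \<open>\<iota>\<close> shows that \<open>\<tau>\<close> has values in the double-loop algebra and is a twisting cochain,
  \<open>d\<tau> = -\<tau>d + \<tau> * \<tau>\<close> (with Koszul signs). Hence \<open>s\<^sup>-\<^sup>1w \<mapsto> \<tau>(w)\<close> is a chain algebra map \<open>\<Phi>\<close> from the cobar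
  construction \<open>\<Omega>A\<close> to the double-loop algebra, and a triangularity argument in \<open>\<Omega>\<PP>(C)\<close> shows that it is an isomorphism.

  As \<open>H\<close> is free, \<open>C\<close> contracts onto \<open>H\<close>. The tensor trick and the basic perturbation lemma turn this into a
  contraction of \<open>\<Omega>C\<close> onto \<open>T(s\<^sup>-\<^sup>1H)\<close> with some differential, and, applied a second time, into a
  contraction of \<open>\<Omega>A\<close> onto \<open>T(s\<^sup>-\<^sup>1T\<^sub>+(s\<^sup>-\<^sup>1H))\<close> whose inclusion \<open>I\<close> is multiplicative. The image of \<open>\<Phi> \<circ> I\<close> is a
  quasi-isomorphic sub chain algebra of the double-loop algebra, and it is free on words that correspond to the iterated
  brackets \<open>[v\<^sub>1,[\<dots>,[v\<^sub>k,w]]]\<close>.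
\<close>

section \<open>Linear maps between free modules\<close>

text \<open>Connectivity makes both perturbations finite. As \<open>C_1 = C_2 = 0\<close>, the
  letters of \<Omega>C have degree at least 2, so nonempty words in them keep positive degree after
  a second desuspension. At either level the perturbation followed by the homotopy preserves degree
  and lengthens words, and letters of positive degree bound the length by the degree. The one-sided
  form of the tensor trick is essential: with the identity to the left of the homotopy and the
  projection to its right, the perturbed inclusion is an algebra map, and this is what makes the
  small model free as an algebra. The definition of the comultiplication \<psi> gives
  coassociativity only. Its counit identities have to be derived first: they start the recursion for
  \<tau>, and they identify the coinvariants. Brackets enter through their terms: among the words of
  \<open>[v_1,[...,[v_k,w]]]\<close> only \<open>v_1 ... v_k w\<close> ends in a letter of W. Hence
  brackets of letters are indexed by nonempty words in the letters of \<open>s^-1 H\<close>, and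
  their degrees are those of the desuspended words.\<close>

abbreviation lmap :: "(('x \<Rightarrow>\<^sub>0 'r) \<Rightarrow> ('y \<Rightarrow>\<^sub>0 'r::comm_ring_1)) \<Rightarrow> bool" where
  "lmap \<equiv> linear_on UNIV"

text \<open>Homogeneous parts, tensor algebras on part of an alphabet and modules of remainder terms
  all have this form, so that degree bookkeeping becomes inclusion of sets of basis
  elements.\<close>

definition fsupp :: "'x set \<Rightarrow> ('x \<Rightarrow>\<^sub>0 'r::comm_ring_1) set" where
  "fsupp S = {p. Poly_Mapping.keys p \<subseteq> S}"

lemma fsuppD: "p \<in> fsupp S \<Longrightarrow> x \<in> Poly_Mapping.keys p \<Longrightarrow> x \<in> S"
  by (auto simp: fsupp_def)

lemma fsupp_mono: "S \<subseteq> T \<Longrightarrow> fsupp S \<subseteq> fsupp T"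
  by (auto simp: fsupp_def)

lemma keys_gen [simp]: "Poly_Mapping.keys (gen x :: 'x \<Rightarrow>\<^sub>0 'r::comm_ring_1) = {x}"
  by (simp add: gen_def)

lemma gen_nonzero [simp]: "(gen x :: 'x \<Rightarrow>\<^sub>0 'r::comm_ring_1) \<noteq> 0"
  using keys_gen[of x] by (metis insert_not_empty keys_zero)

lemma lookup_gen: "Poly_Mapping.lookup (gen x :: 'x \<Rightarrow>\<^sub>0 'r::comm_ring_1) y = (if x = y then 1 else 0)"
  by (simp add: gen_def lookup_single when_def)

lemma gen_in_fsupp [simp]: "gen x \<in> (fsupp S :: ('x \<Rightarrow>\<^sub>0 'r::comm_ring_1) set) \<longleftrightarrow> x \<in> S"
  by (auto simp: fsupp_def)

lemma keys_smul: "Poly_Mapping.keys (smul r p) \<subseteq> Poly_Mapping.keys p"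
  by (auto simp: in_keys_iff)

lemma subspace_fsupp [simp, intro]: "pm.subspace (fsupp S :: ('x \<Rightarrow>\<^sub>0 'r::comm_ring_1) set)"
proof (rule pm.subspaceI)
  show "x + y \<in> fsupp S" if "x \<in> fsupp S" "y \<in> fsupp S" for x y :: "'x \<Rightarrow>\<^sub>0 'r"
    using that Poly_Mapping.keys_add[of x y] by (auto simp: fsupp_def)
  show "smul c x \<in> fsupp S" if "x \<in> fsupp S" for c and x :: "'x \<Rightarrow>\<^sub>0 'r"
    using that keys_smul[of c x] by (auto simp: fsupp_def)
qed (simp add: fsupp_def)

lemma zero_in_fsupp [simp, intro]: "0 \<in> fsupp S"
  by (simp add: fsupp_def)

lemma add_in_fsupp [intro]: "p \<in> fsupp S \<Longrightarrow> q \<in> fsupp S \<Longrightarrow> p + q \<in> fsupp S"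
  by (rule pm.subspace_add) auto

lemma diff_in_fsupp [intro]: "p \<in> fsupp S \<Longrightarrow> q \<in> fsupp S \<Longrightarrow> p - q \<in> fsupp S"
  by (rule pm.subspace_diff) auto

lemma uminus_in_fsupp [intro]: "p \<in> fsupp S \<Longrightarrow> - p \<in> fsupp S"
  by (rule pm.subspace_neg) auto

lemma smul_in_fsupp [intro]: "p \<in> fsupp S \<Longrightarrow> smul r p \<in> fsupp S"
  by (rule pm.subspace_scale) auto

lemma fsupp_empty: "fsupp {} = {0}"
  by (auto simp: fsupp_def)

lemma fsupp_disjoint: "p \<in> fsupp S \<Longrightarrow> p \<in> fsupp T \<Longrightarrow> S \<inter> T = {} \<Longrightarrow> p = 0"
  by (metis disjoint_iff fsuppD keys_eq_empty subset_empty subset_iff)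

lemma lmapI: "(\<And>x y. f (x + y) = f x + f y) \<Longrightarrow> (\<And>r x. f (smul r x) = smul r (f x)) \<Longrightarrow> lmap f"
  by (simp add: linear_on_def)

lemma lmap_add: "lmap f \<Longrightarrow> f (x + y) = f x + f y"
  and lmap_smul: "lmap f \<Longrightarrow> f (smul r x) = smul r (f x)"
  by (simp_all add: linear_on_def)

lemma lmap_zero: "lmap f \<Longrightarrow> f 0 = 0"
  using lmap_add[of f 0 0] by simp

lemma lmap_uminus: "lmap f \<Longrightarrow> f (- x) = - f x"
  using lmap_add[of f x "- x"] by (simp add: lmap_zero minus_unique)

lemma lmap_diff: "lmap f \<Longrightarrow> f (x - y) = f x - f y"
  using lmap_add[of f x "- y"] by (simp add: lmap_uminus)

lemma lmap_sum: "lmap f \<Longrightarrow> f (\<Sum>i\<in>I. g i) = (\<Sum>i\<in>I. f (g i))"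
  by (induction I rule: infinite_finite_induct) (simp_all add: lmap_zero lmap_add)

lemma lin_superset:
  assumes "finite F" "Poly_Mapping.keys p \<subseteq> F"
  shows "lin f p = (\<Sum>x\<in>F. smul (Poly_Mapping.lookup p x) (f x))"
  unfolding lin_def by (rule sum.mono_neutral_left) (use assms in \<open>auto simp: in_keys_iff\<close>)

lemma lmap_lin [simp]: "lmap (lin f)"
proof (rule lmapI)
  fix x y :: "'a \<Rightarrow>\<^sub>0 'b" and r
  let ?F = "Poly_Mapping.keys x \<union> Poly_Mapping.keys y"
  have "Poly_Mapping.keys (x + y) \<subseteq> ?F" by (rule Poly_Mapping.keys_add)
  then show "lin f (x + y) = lin f x + lin f y"
    by (simp add: lin_superset[of ?F] lookup_add pm.scale_left_distrib sum.distrib)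
  show "lin f (smul r x) = smul r (lin f x)"
    by (simp add: lin_superset[of "Poly_Mapping.keys x"] keys_smul pm.scale_sum_right)
qed

lemmas lin_add [simp] = lmap_add[OF lmap_lin]
  and lin_smul [simp] = lmap_smul[OF lmap_lin]
  and lin_zero [simp] = lmap_zero[OF lmap_lin]
  and lin_uminus [simp] = lmap_uminus[OF lmap_lin]
  and lin_diff [simp] = lmap_diff[OF lmap_lin]
  and lin_sum = lmap_sum[OF lmap_lin]

lemma lin_gen [simp]: "lin f (gen x) = f x"
  by (simp add: lin_def lookup_gen)

lemma lin_gen_id [simp]: "lin gen p = p"
proof (rule poly_mapping_eqI)
  fix k
  show "Poly_Mapping.lookup (lin gen p) k = Poly_Mapping.lookup p k"
    by (auto simp: lin_def lookup_sum lookup_gen if_distrib in_keys_iff cong: if_cong)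
qed

lemma lin_cong [fundef_cong]:
  "p = q \<Longrightarrow> (\<And>x. x \<in> Poly_Mapping.keys q \<Longrightarrow> f x = g x) \<Longrightarrow> lin f p = lin g q"
  by (simp add: lin_def)

lemma lmap_comp_lin: "lmap f \<Longrightarrow> f (lin g p) = lin (\<lambda>x. f (g x)) p"
  by (simp add: lin_def lmap_sum lmap_smul)

lemma lin_lin: "lin f (lin g p) = lin (\<lambda>x. lin f (g x)) p"
  by (rule lmap_comp_lin) simp

lemma lmap_eq_lin: "lmap f \<Longrightarrow> f p = lin (\<lambda>x. f (gen x)) p"
  using lmap_comp_lin[of f gen p] by simp

lemma lmap_eqI:
  assumes "lmap f" "lmap g" "\<And>x. x \<in> Poly_Mapping.keys p \<Longrightarrow> f (gen x) = g (gen x)"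
  shows "f p = g p"
  unfolding lmap_eq_lin[OF assms(1), of p] lmap_eq_lin[OF assms(2), of p]
  by (rule lin_cong) (auto simp: assms(3))

lemma lmap_eq_onI:
  assumes "p \<in> fsupp S" "lmap f" "lmap g" "\<And>x. x \<in> S \<Longrightarrow> f (gen x) = g (gen x)"
  shows "f p = g p"
  by (rule lmap_eqI) (use assms in \<open>auto dest: fsuppD\<close>)

lemma lin_add_fun: "lin (\<lambda>x. f x + g x) p = lin f p + lin g p"
  by (simp add: lin_def pm.scale_right_distrib sum.distrib)

lemma lin_smul_fun: "lin (\<lambda>x. smul r (f x)) p = smul r (lin f p)"
  by (simp add: lin_def pm.scale_sum_right mult.commute)

lemma lin_zero_fun [simp]: "lin (\<lambda>x. 0) p = 0"
  by (simp add: lin_def)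

lemma lin_uminus_fun: "lin (\<lambda>x. - f x) p = - lin f p"
  by (simp add: lin_def sum_negf)

lemma lin_diff_fun: "lin (\<lambda>x. f x - g x) p = lin f p - lin g p"
  by (simp add: lin_def pm.scale_right_diff_distrib sum_subtractf)

lemma lin_mem:
  assumes "pm.subspace V" "\<And>x. x \<in> Poly_Mapping.keys p \<Longrightarrow> f x \<in> V"
  shows "lin f p \<in> V"
  unfolding lin_def using assms by (intro pm.subspace_sum pm.subspace_scale) auto

lemma lmap_mem:
  assumes "lmap f" "p \<in> fsupp S" "pm.subspace V" "\<And>x. x \<in> S \<Longrightarrow> f (gen x) \<in> V"
  shows "f p \<in> V"
  unfolding lmap_eq_lin[OF assms(1), of p]
  by (rule lin_mem) (use assms in \<open>auto dest: fsuppD\<close>)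

lemma lin_mem_on: "p \<in> fsupp S \<Longrightarrow> pm.subspace V \<Longrightarrow> (\<And>x. x \<in> S \<Longrightarrow> f x \<in> V) \<Longrightarrow> lin f p \<in> V"
  by (rule lin_mem) (auto dest: fsuppD)

text \<open>A structure map such as \<Psi> is linear only on a carrier. There it may still be
  replaced by the linear extension of its values on basis elements.\<close>

lemma linear_on_eq_lin:
  assumes "linear_on (fsupp S) f" "p \<in> fsupp S"
  shows "f p = lin (\<lambda>x. f (gen x)) p"
proof -
  have z: "f 0 = 0" using assms(1) unfolding linear_on_def
    by (metis add.left_neutral add_cancel_left_left zero_in_fsupp)
  have "f (\<Sum>x\<in>F. smul (c x) (gen x)) = (\<Sum>x\<in>F. smul (c x) (f (gen x)))"
    if "finite F" "F \<subseteq> S" for F and c :: "_ \<Rightarrow> 'b"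
    using that
  proof (induction F)
    case (insert x F)
    have "smul (c x) (gen x) \<in> fsupp S" "(\<Sum>x\<in>F. smul (c x) (gen x)) \<in> fsupp S"
      using insert by (auto intro!: smul_in_fsupp pm.subspace_sum)
    with assms(1) insert show ?case unfolding linear_on_def by auto
  qed (simp add: z)
  from this[of "Poly_Mapping.keys p" "Poly_Mapping.lookup p"] assms(2)
  show ?thesis by (simp add: lin_def[symmetric] fsupp_def)
qed

text \<open>Most identities below are proved by comparing two linear maps on basis elements; these
  rules discharge the linearity of the two sides.\<close>

named_theorems lmap_intros

lemma lmap_intros_basic [lmap_intros]:
  "lmap (\<lambda>x. x)" "lmap (\<lambda>x. 0)"
  "lmap f \<Longrightarrow> lmap (\<lambda>x. smul r (f x))"
  "lmap f \<Longrightarrow> lmap (\<lambda>x. - f x)"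
  "lmap f \<Longrightarrow> lmap g \<Longrightarrow> lmap (\<lambda>x. f x + g x)"
  "lmap f \<Longrightarrow> lmap g \<Longrightarrow> lmap (\<lambda>x. f x - g x)"
  "lmap f \<Longrightarrow> lmap (\<lambda>x. lin k (f x))"
  "lmap (lin k)"
  by (auto intro!: lmapI simp: lmap_add lmap_smul algebra_simps pm.scale_right_distrib
      pm.scale_right_diff_distrib mult.commute)

lemma lmap_lin_fun [lmap_intros]: "(\<And>y. lmap (F y)) \<Longrightarrow> lmap (\<lambda>x. lin (\<lambda>y. F y x) p)"
  by (rule lmapI) (simp_all add: lmap_add lmap_smul lin_add_fun lin_smul_fun)

lemma lmap_bilin1: "lmap f \<Longrightarrow> lmap (\<lambda>x. bilin k (f x) c)"
  unfolding bilin_def by (intro lmap_intros)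

lemma lmap_bilin2: "lmap f \<Longrightarrow> lmap (\<lambda>x. bilin k c (f x))"
  unfolding bilin_def by (intro lmap_intros) 

lemma bilin_gen [simp]: "bilin k (gen x) (gen y) = k x y"
  by (simp add: bilin_def)

lemma bilin_gen1: "bilin k (gen x) q = lin (k x) q"
  by (simp add: bilin_def)

lemma bilin_eqI:
  assumes "\<And>y. lmap (\<lambda>x. m x y)" "\<And>x. lmap (m x)" "\<And>y. lmap (\<lambda>x. m' x y)" "\<And>x. lmap (m' x)"
    and "\<And>x y. x \<in> Poly_Mapping.keys p \<Longrightarrow> y \<in> Poly_Mapping.keys q \<Longrightarrow> m (gen x) (gen y) = m' (gen x) (gen y)"
  shows "m p q = m' p q"
  by (rule lmap_eqI[of "\<lambda>p. m p q" "\<lambda>p. m' p q"], rule assms, rule assms, rule lmap_eqI) (use assms in auto)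

lemma bilin_mem:
  assumes "p \<in> fsupp S" "q \<in> fsupp T" "pm.subspace V" "\<And>x y. x \<in> S \<Longrightarrow> y \<in> T \<Longrightarrow> k x y \<in> V"
  shows "bilin k p q \<in> V"
  unfolding bilin_def by (rule lin_mem_on[OF assms(1,3)], rule lin_mem_on[OF assms(2,3)], rule assms)

lemma lmap_cat1 [lmap_intros]: "lmap f \<Longrightarrow> lmap (\<lambda>x. cat (f x) c)"
  and lmap_cat2 [lmap_intros]: "lmap f \<Longrightarrow> lmap (\<lambda>x. cat c (f x))"
  unfolding cat_def by (simp_all add: lmap_bilin1 lmap_bilin2)

lemma lmap_tens1 [lmap_intros]: "lmap f \<Longrightarrow> lmap (\<lambda>x. tens (f x) c)"
  and lmap_tens2 [lmap_intros]: "lmap f \<Longrightarrow> lmap (\<lambda>x. tens c (f x))"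
  unfolding tens_def by (simp_all add: lmap_bilin1 lmap_bilin2)

lemma lmap_tmul1 [lmap_intros]: "lmap f \<Longrightarrow> lmap (\<lambda>x. tensor_mul a b (f x) c)"
  and lmap_tmul2 [lmap_intros]: "lmap f \<Longrightarrow> lmap (\<lambda>x. tensor_mul a b c (f x))"
  unfolding tensor_mul_def by (simp_all add: lmap_bilin1 lmap_bilin2)

lemma lmap_cat [simp]: "lmap (cat x)" "lmap (\<lambda>x. cat x y)"
  by (intro lmap_intros)+

lemma lmap_tens [simp]: "lmap (tens x)" "lmap (\<lambda>x. tens x y)"
  by (intro lmap_intros)+

lemma lmap_tmul [simp]: "lmap (tensor_mul a b x)" "lmap (\<lambda>x. tensor_mul a b x y)"
  by (intro lmap_intros)+

lemmas cat_simps [simp] =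
  lmap_add[OF lmap_cat(1)] lmap_add[OF lmap_cat(2)] lmap_smul[OF lmap_cat(1)] lmap_smul[OF lmap_cat(2)]
  lmap_zero[OF lmap_cat(1)] lmap_zero[OF lmap_cat(2)] lmap_uminus[OF lmap_cat(1)] lmap_uminus[OF lmap_cat(2)]
  lmap_diff[OF lmap_cat(1)] lmap_diff[OF lmap_cat(2)]

lemmas tens_simps [simp] =
  lmap_add[OF lmap_tens(1)] lmap_add[OF lmap_tens(2)] lmap_smul[OF lmap_tens(1)] lmap_smul[OF lmap_tens(2)]
  lmap_zero[OF lmap_tens(1)] lmap_zero[OF lmap_tens(2)] lmap_uminus[OF lmap_tens(1)] lmap_uminus[OF lmap_tens(2)]
  lmap_diff[OF lmap_tens(1)] lmap_diff[OF lmap_tens(2)]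

lemmas tmul_simps [simp] =
  lmap_add[OF lmap_tmul(1)] lmap_add[OF lmap_tmul(2)] lmap_smul[OF lmap_tmul(1)] lmap_smul[OF lmap_tmul(2)]
  lmap_zero[OF lmap_tmul(1)] lmap_zero[OF lmap_tmul(2)] lmap_uminus[OF lmap_tmul(1)] lmap_uminus[OF lmap_tmul(2)]
  lmap_diff[OF lmap_tmul(1)] lmap_diff[OF lmap_tmul(2)]

lemma cat_gen [simp]: "cat (gen u) (gen v) = gen (u @ v)"
  by (simp add: cat_def)

lemma tens_gen [simp]: "tens (gen u) (gen v) = gen (u, v)"
  by (simp add: tens_def)

lemma tmul_gen [simp]: "tensor_mul a b (gen (x, y)) (gen (x', y')) = smul (sg (wdeg b y * wdeg a x')) (gen (x @ x', y @ y'))"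
  by (simp add: tensor_mul_def)

lemma cat_one [simp]: "cat (gen []) p = p" "cat p (gen []) = p"
proof -
  show "cat (gen []) p = p"
    by (rule lmap_eqI[where f = "cat (gen [])" and g = "\<lambda>p. p"]) (auto intro: lmap_intros)
  show "cat p (gen []) = p"
    by (rule lmap_eqI[where f = "\<lambda>p. cat p (gen [])" and g = "\<lambda>p. p"]) (auto intro: lmap_intros)
qed

lemma trilin_eqI:
  assumes "\<And>y z. lmap (\<lambda>x. m x y z)" "\<And>x z. lmap (\<lambda>y. m x y z)" "\<And>x y. lmap (\<lambda>z. m x y z)"
    and "\<And>y z. lmap (\<lambda>x. m' x y z)" "\<And>x z. lmap (\<lambda>y. m' x y z)" "\<And>x y. lmap (\<lambda>z. m' x y z)"
    and "\<And>x y z. m (gen x) (gen y) (gen z) = m' (gen x) (gen y) (gen z)"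
  shows "m p q s = m' p q s"
  by (rule lmap_eqI[of "\<lambda>p. m p q s" "\<lambda>p. m' p q s"], rule assms, rule assms, rule bilin_eqI)
    (use assms in auto)

lemma cat_assoc: "cat (cat p q) s = cat p (cat q s)"
  by (rule trilin_eqI[where m = "\<lambda>p q s. cat (cat p q) s"]; (intro lmap_intros)?; simp)

lemma sg_simps [simp]: "sg 0 = 1" "sg (Suc n) = - sg n" "sg (m + n) = sg m * sg n"
  by (simp_all add: sg_def power_add)

lemma sg_sq [simp]: "sg n * sg n = (1 :: 'r::comm_ring_1)" "sg n * (sg n * (r :: 'r)) = r"
proof -
  show *: "sg n * sg n = (1 :: 'r)" by (simp add: sg_def power_mult_distrib[symmetric])
  show "sg n * (sg n * r) = r" using * by (simp add: mult.assoc[symmetric])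
qed

lemma sg_cases: "sg n = (1::'r::comm_ring_1) \<or> sg n = (-1 :: 'r)"
  by (simp add: sg_def minus_one_power_iff)

lemma smul_uminus [simp]: "smul (- r) x = - smul r x" "smul r (- x) = - smul r x"
  by (simp_all add: pm.scale_minus_left pm.scale_minus_right)

lemma wdeg_simps [simp]: "wdeg a [] = 0" "wdeg a (x # w) = a x + wdeg a w" "wdeg a (u @ v) = wdeg a u + wdeg a v"
  by (simp_all add: wdeg_def)

lemma tmul_one [simp]: "tensor_mul a b (gen ([], [])) p = p" "tensor_mul a b p (gen ([], [])) = p"
proof -
  show "tensor_mul a b (gen ([], [])) p = p"
    by (rule lmap_eqI[where f = "tensor_mul a b (gen ([], []))" and g = "\<lambda>p. p"])
      (auto intro: lmap_intros simp: split_paired_all)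
  show "tensor_mul a b p (gen ([], [])) = p"
    by (rule lmap_eqI[where f = "\<lambda>p. tensor_mul a b p (gen ([], []))" and g = "\<lambda>p. p"])
      (auto intro: lmap_intros simp: split_paired_all)
qed

lemma tmul_assoc: "tensor_mul a b (tensor_mul a b p q) s = tensor_mul a b p (tensor_mul a b q s)"
proof (rule trilin_eqI[where m = "\<lambda>p q s. tensor_mul a b (tensor_mul a b p q) s"]; (intro lmap_intros)?)
  fix x y z :: "'a list \<times> 'b list"
  show "tensor_mul a b (tensor_mul a b (gen x) (gen y)) (gen z) = tensor_mul a b (gen x) (tensor_mul a b (gen y) (gen z))"
    by (cases x, cases y, cases z) (simp add: algebra_simps)
qed

section \<open>Words\<close>

definition wset :: "'x set \<Rightarrow> ('x \<Rightarrow> nat) \<Rightarrow> nat \<Rightarrow> 'x list set" where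
  "wset S dg n = {w. set w \<subseteq> S \<and> wdeg dg w = n}"

definition lt :: "('x \<Rightarrow>\<^sub>0 'r::comm_ring_1) \<Rightarrow> ('x list \<Rightarrow>\<^sub>0 'r)" where
  "lt = lin (\<lambda>x. gen [x])"

lemma lmap_lt [lmap_intros]: "lmap f \<Longrightarrow> lmap (\<lambda>x. lt (f x))"
  unfolding lt_def by (intro lmap_intros)

lemma lmap_lt' [simp]: "lmap lt" by (simp add: lt_def)

lemma lt_gen [simp]: "lt (gen x) = gen [x]" by (simp add: lt_def)

lemmas lt_simps [simp] = lmap_add[OF lmap_lt'] lmap_smul[OF lmap_lt'] lmap_zero[OF lmap_lt']
  lmap_uminus[OF lmap_lt'] lmap_diff[OF lmap_lt']

lemma grade_tensor [simp]: "grade (tensor_algebra S dg) n = fsupp (wset S dg n)"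
  by (auto simp: tensor_algebra_def fsupp_def wset_def)

lemma cat_fsupp: "p \<in> fsupp S \<Longrightarrow> q \<in> fsupp T \<Longrightarrow> (\<And>u v. u \<in> S \<Longrightarrow> v \<in> T \<Longrightarrow> u @ v \<in> U) \<Longrightarrow> cat p q \<in> fsupp U"
  unfolding cat_def by (rule bilin_mem) auto

lemma cat_wset: "p \<in> fsupp (wset S dg m) \<Longrightarrow> q \<in> fsupp (wset S dg n) \<Longrightarrow> m + n = k \<Longrightarrow> cat p q \<in> fsupp (wset S dg k)"
  by (erule cat_fsupp, assumption) (auto simp: wset_def)

lemma span_gen_image: "pm.span (gen ` S) = (fsupp S :: ('x \<Rightarrow>\<^sub>0 'r::comm_ring_1) set)"
proof (rule antisym)
  show "pm.span (gen ` S) \<subseteq> (fsupp S :: ('x \<Rightarrow>\<^sub>0 'r::comm_ring_1) set)"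
    by (rule pm.span_minimal) auto
  show "(fsupp S :: ('x \<Rightarrow>\<^sub>0 'r::comm_ring_1) set) \<subseteq> pm.span (gen ` S)"
  proof
    fix p :: "'x \<Rightarrow>\<^sub>0 'r" assume "p \<in> fsupp S"
    then have "lin gen p \<in> pm.span (gen ` S)"
      by (rule lin_mem_on) (auto intro: pm.span_base)
    then show "p \<in> pm.span (gen ` S)" by simp
  qed
qed

lemma carr_fsupp: "carr (\<lambda>n. fsupp (X n)) = fsupp (\<Union>n. X n)"
proof (rule antisym)
  show "carr (\<lambda>n. fsupp (X n)) \<subseteq> fsupp (\<Union>n. X n)"
    unfolding carr_def by (rule pm.span_minimal) (auto dest: fsuppD intro: subsetD[OF fsupp_mono, rotated])
  show "fsupp (\<Union>n. X n) \<subseteq> carr (\<lambda>n. fsupp (X n))"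
    unfolding carr_def span_gen_image[symmetric] by (rule pm.span_mono) (auto intro: pm.span_base)
qed

lemma carr_tensor [simp]:
  "carr (grade (tensor_algebra S dg)) = (fsupp (lists S) :: ('x list \<Rightarrow>\<^sub>0 'r::comm_ring_1) set)"
proof -
  have "(\<Union>n. wset S dg n) = lists S" by (auto simp: wset_def)
  moreover have "grade (tensor_algebra S dg) = (\<lambda>n. fsupp (wset S dg n) :: ('x list \<Rightarrow>\<^sub>0 'r) set)"
    by (rule ext) simp
  ultimately show ?thesis by (simp add: carr_fsupp)
qed

lemma wset_lists: "w \<in> wset S dg n \<Longrightarrow> w \<in> lists S" by (auto simp: wset_def)

lemma alg_ext_gen: "alg_ext m e f (gen w) = foldr (\<lambda>x acc. m (f x) acc) w e"
  by (simp add: alg_ext_def)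

lemma lmap_alg_ext [simp]: "lmap (alg_ext m e f)"
  by (simp add: alg_ext_def)

lemma lmap_alg_ext' [lmap_intros]: "lmap g \<Longrightarrow> lmap (\<lambda>x. alg_ext m e f (g x))"
  unfolding alg_ext_def by (intro lmap_intros)

lemmas alg_ext_lin_simps [simp] = lmap_add[OF lmap_alg_ext] lmap_smul[OF lmap_alg_ext] lmap_zero[OF lmap_alg_ext]
  lmap_uminus[OF lmap_alg_ext] lmap_diff[OF lmap_alg_ext]

lemma alg_ext_Nil [simp]: "alg_ext m e f (gen []) = e"
  and alg_ext_Cons: "alg_ext m e f (gen (x # w)) = m (f x) (alg_ext m e f (gen w))"
  by (simp_all add: alg_ext_gen)

lemma alg_ext_cat:
  assumes "\<And>p q s. m (m p q) s = m p (m q s)" "\<And>p. m e p = p"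
    and [lmap_intros]: "\<And>x. lmap (m x)" "\<And>y. lmap (\<lambda>x. m x y)"
  shows "alg_ext m e f (cat p q) = m (alg_ext m e f p) (alg_ext m e f q)"
proof -
  have l1: "lmap g \<Longrightarrow> lmap (\<lambda>x. m (g x) c)" and l2: "lmap g \<Longrightarrow> lmap (\<lambda>x. m c (g x))" for g :: "('z \<Rightarrow>\<^sub>0 'b) \<Rightarrow> _" and c
    using assms(3)[of c] assms(4)[of c] by (simp_all add: linear_on_def)
  show ?thesis
  proof (rule bilin_eqI[where m = "\<lambda>p q. alg_ext m e f (cat p q)"]; (intro lmap_intros l1 l2)?)
    fix u v
    show "alg_ext m e f (cat (gen u) (gen v)) = m (alg_ext m e f (gen u)) (alg_ext m e f (gen v))"
      by (induction u) (simp_all add: assms alg_ext_Cons)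
  qed
qed

abbreviation aext :: "('x \<Rightarrow> ('y list \<Rightarrow>\<^sub>0 'r)) \<Rightarrow> ('x list \<Rightarrow>\<^sub>0 'r) \<Rightarrow> ('y list \<Rightarrow>\<^sub>0 'r::comm_ring_1)" where
  "aext \<equiv> alg_ext cat (gen [])"

lemma aext_cat: "aext f (cat p q) = cat (aext f p) (aext f q)"
  by (rule alg_ext_cat) (auto simp: cat_assoc)

lemma aext_append: "aext f (gen (u @ v)) = cat (aext f (gen u)) (aext f (gen v))"
  using aext_cat[of f "gen u" "gen v"] by simp

lemma wder_append:
  fixes f :: "'x \<Rightarrow> ('y list \<Rightarrow>\<^sub>0 'c::comm_ring_1)"
  shows "wder dg j f (u @ v) = cat (wder dg j f u) (gen (map j v)) + smul (sg (wdeg dg u)) (cat (gen (map j u)) (wder dg j f v))"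
proof (induction u)
  case (Cons x u)
  have "cat (gen (j x # map j u)) y = cat (gen [j x]) (cat (gen (map j u)) y)" for y :: "_ \<Rightarrow>\<^sub>0 'c"
    using cat_assoc[of "gen [j x]" "gen (map j u)" y] by simp
  moreover have "cat (f x) (gen (map j u @ map j v)) = cat (cat (f x) (gen (map j u))) (gen (map j v))"
    by (simp add: cat_assoc)
  ultimately show ?case using Cons
    by (simp add: cat_assoc pm.scale_right_distrib add.assoc)
qed simp

section \<open>The basic perturbation lemma\<close>

text \<open>A strong deformation retract with its three side conditions, on explicit submodules. The
  convention \<open>dh + hd = ip - 1\<close> is chosen so that the perturbation series is the sum of
  the powers of \<open>ht\<close>, without alternating signs.\<close>

locale sdr =
  fixes A :: "('x \<Rightarrow>\<^sub>0 'r::comm_ring_1) set" and B :: "('y \<Rightarrow>\<^sub>0 'r) set"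
    and d h :: "('x \<Rightarrow>\<^sub>0 'r) \<Rightarrow> ('x \<Rightarrow>\<^sub>0 'r)" and i :: "('y \<Rightarrow>\<^sub>0 'r) \<Rightarrow> ('x \<Rightarrow>\<^sub>0 'r)"
    and p :: "('x \<Rightarrow>\<^sub>0 'r) \<Rightarrow> ('y \<Rightarrow>\<^sub>0 'r)" and \<delta> :: "('y \<Rightarrow>\<^sub>0 'r) \<Rightarrow> ('y \<Rightarrow>\<^sub>0 'r)"
  assumes lmaps: "lmap d" "lmap h" "lmap i" "lmap p" "lmap \<delta>"
    and subspaces: "pm.subspace A" "pm.subspace B"
    and closed: "x \<in> A \<Longrightarrow> d x \<in> A" "x \<in> A \<Longrightarrow> h x \<in> A" "y \<in> B \<Longrightarrow> i y \<in> A" "x \<in> A \<Longrightarrow> p x \<in> B"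
      "y \<in> B \<Longrightarrow> \<delta> y \<in> B"
    and dd: "x \<in> A \<Longrightarrow> d (d x) = 0"
    and \<delta>\<delta>: "y \<in> B \<Longrightarrow> \<delta> (\<delta> y) = 0"
    and di: "y \<in> B \<Longrightarrow> d (i y) = i (\<delta> y)"
    and pd: "x \<in> A \<Longrightarrow> p (d x) = \<delta> (p x)"
    and dh: "x \<in> A \<Longrightarrow> d (h x) + h (d x) = i (p x) - x"
    and pi: "y \<in> B \<Longrightarrow> p (i y) = y"
    and hi: "y \<in> B \<Longrightarrow> h (i y) = 0"
    and ph: "x \<in> A \<Longrightarrow> p (h x) = 0"
    and hh: "x \<in> A \<Longrightarrow> h (h x) = 0"

text \<open>\<open>N\<close> is the inverse of \<open>1 - ht\<close>, given by its two defining
  equations. The algebra is thereby separated from the question of convergence, which is settled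
  where \<open>N\<close> is constructed.\<close>

locale perturbation = sdr A B d h i p \<delta>
  for A :: "('x \<Rightarrow>\<^sub>0 'r::comm_ring_1) set" and B :: "('y \<Rightarrow>\<^sub>0 'r) set" and d h i p \<delta> +
  fixes t N :: "('x \<Rightarrow>\<^sub>0 'r) \<Rightarrow> ('x \<Rightarrow>\<^sub>0 'r)"
  assumes lmap_t: "lmap t" and lmap_N: "lmap N"
    and closed_t: "x \<in> A \<Longrightarrow> t x \<in> A" and closed_N: "x \<in> A \<Longrightarrow> N x \<in> A"
    and N1: "x \<in> A \<Longrightarrow> N x = x + h (t (N x))"
    and N2: "x \<in> A \<Longrightarrow> N x = x + N (h (t x))"
    and square: "x \<in> A \<Longrightarrow> d (t x) + t (d x) + t (t x) = 0"
begin

lemmas lmaps' = lmaps lmap_t lmap_N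
lemmas add_rules = lmaps'[THEN lmap_add] lmaps'[THEN lmap_diff] lmaps'[THEN lmap_uminus] lmaps'[THEN lmap_zero]
lemmas closed' = closed closed_t closed_N pm.subspace_add[OF subspaces(1)] pm.subspace_add[OF subspaces(2)]
  pm.subspace_diff[OF subspaces(1)]

text \<open>\<open>N\<close> is the sum of the powers of \<open>ht\<close>.\<close>

definition "I y = N (i y)"
definition "H x = N (h x)"
definition "P x = p x + p (t (H x))"
definition "D y = \<delta> y + p (t (I y))"

text \<open>This takes the place of computations with the series: an element equals
  \<open>N x\<close> as soon as it solves the fixed-point equation
  \<open>y = x + h t y\<close>.\<close>

lemma N_unique: "y \<in> A \<Longrightarrow> x \<in> A \<Longrightarrow> y = x + h (t y) \<Longrightarrow> y = N x"
  using N2[of y] lmap_add[OF lmap_N, of x "h (t y)"] by (metis add_right_cancel)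

lemma closed_IHPD: "y \<in> B \<Longrightarrow> I y \<in> A" "x \<in> A \<Longrightarrow> H x \<in> A" "x \<in> A \<Longrightarrow> P x \<in> B" "y \<in> B \<Longrightarrow> D y \<in> B"
  by (simp_all add: I_def H_def P_def D_def closed')

lemma I_eq: "y \<in> B \<Longrightarrow> I y = i y + h (t (I y))"
  unfolding I_def by (rule N1) (simp add: closed')

lemma H_eq: "x \<in> A \<Longrightarrow> H x = h x + h (t (H x))"
  unfolding H_def by (rule N1) (simp add: closed')

lemma hI: "y \<in> B \<Longrightarrow> h (I y) = 0"
  by (subst I_eq) (simp_all add: add_rules hi hh closed' closed_IHPD)

lemma pI: "y \<in> B \<Longrightarrow> p (I y) = y"
  by (subst I_eq) (simp_all add: add_rules pi ph closed' closed_IHPD)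

lemma hH: "x \<in> A \<Longrightarrow> h (H x) = 0"
  by (subst H_eq) (simp_all add: add_rules hh closed' closed_IHPD)

lemma pH: "x \<in> A \<Longrightarrow> p (H x) = 0"
  by (subst H_eq) (simp_all add: add_rules ph closed' closed_IHPD)

lemma HI: "y \<in> B \<Longrightarrow> H (I y) = 0" and HH: "x \<in> A \<Longrightarrow> H (H x) = 0"
  by (simp_all add: H_def[of "I y"] H_def[of "H x"] hI hH add_rules)

lemma PI: "y \<in> B \<Longrightarrow> P (I y) = y" and PH: "x \<in> A \<Longrightarrow> P (H x) = 0"
  by (simp_all add: P_def pI pH HI HH add_rules)

lemma lmap_IHPD: "lmap I" "lmap H" "lmap P" "lmap D"
  unfolding I_def H_def P_def D_def
  by (rule lmapI; simp add: add_rules lmap_smul[OF lmaps(1)] lmap_smul[OF lmaps(2)] lmap_smul[OF lmaps(3)]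
    lmap_smul[OF lmaps(4)] lmap_smul[OF lmaps(5)] lmap_smul[OF lmap_t] lmap_smul[OF lmap_N] pm.scale_right_distrib)+

lemma t_d: "x \<in> A \<Longrightarrow> d (t x) = - t (d x + t x)"
proof -
  assume "x \<in> A"
  then have "d (t x) = - (t (d x) + t (t x))" using square[of x] by (simp only: eq_neg_iff_add_eq_0 add.assoc)
  then show "d (t x) = - t (d x + t x)" by (simp only: lmap_add[OF lmap_t])
qed

lemma d_ht: "x \<in> A \<Longrightarrow> d (h (t x)) = i (p (t x)) - t x + h (t (d x + t x))"
  using dh[of "t x"] by (simp add: closed' t_d add_rules algebra_simps)

text \<open>The left side solves the fixed-point equation with constant term \<open>i (D y)\<close>,
  whose solution is \<open>I (D y)\<close>. The same method proves the homotopy identity that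
  follows.\<close>

lemma dI: assumes y: "y \<in> B" shows "d (I y) + t (I y) = I (D y)"
proof -
  define z where "z = h (t (d (I y) + t (I y)))"
  have "d (I y) = d (i y) + d (h (t (I y)))"
    using arg_cong[OF I_eq[OF y], of d] by (simp only: lmap_add[OF lmaps(1)])
  also have "\<dots> = i (\<delta> y) + (i (p (t (I y))) - t (I y) + z)"
    using d_ht[of "I y"] di[OF y] closed_IHPD(1)[OF y] by (simp add: z_def)
  finally have "d (I y) + t (I y) = i (D y) + h (t (d (I y) + t (I y)))"
    unfolding z_def[symmetric] by (simp add: D_def lmap_add[OF lmaps(3)])
  then show ?thesis unfolding I_def[of "D y"]
    by (intro N_unique) (use y in \<open>auto simp: closed' closed_IHPD\<close>)
qed

lemma dH: assumes x: "x \<in> A" shows "d (H x) + t (H x) + H (d x + t x) = I (P x) - x"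
proof -
  let ?y = "d (H x) + t (H x)"
  define z where "z = h (t ?y)"
  have "d (H x) = d (h x) + d (h (t (H x)))"
    using arg_cong[OF H_eq[OF x], of d] by (simp only: lmap_add[OF lmaps(1)])
  also have "d (h x) = i (p x) - x - h (d x)"
    using dh[OF x] by (simp add: algebra_simps)
  also have "d (h (t (H x))) = i (p (t (H x))) - t (H x) + z"
    using d_ht[of "H x"] closed_IHPD(2)[OF x] by (simp add: z_def)
  finally have "?y = (i (P x) - x - h (d x)) + h (t ?y)"
    unfolding z_def[symmetric] by (simp add: P_def lmap_add[OF lmaps(3)])
  then have "?y = N (i (P x) - x - h (d x))"
    by (intro N_unique) (use x in \<open>auto simp: closed' closed_IHPD\<close>)
  also have "\<dots> = I (P x) - (x + H (t x)) - H (d x)"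
    using N2[OF x] by (simp add: add_rules I_def H_def)
  finally show ?thesis by (simp add: algebra_simps lmap_add[OF lmap_IHPD(2)])
qed

lemma dd': assumes x: "x \<in> A" shows "d (d x + t x) + t (d x + t x) = 0"
  using square[OF x] dd[OF x] by (simp add: add_rules add.assoc)

text \<open>As \<open>P I = 1\<close>, it suffices to compare images under \<open>I\<close>. Apply
  the perturbed differential to the homotopy identity at \<open>x\<close> and subtract the homotopy
  identity at the differential of \<open>x\<close>.\<close>

lemma Pd: assumes x: "x \<in> A" shows "P (d x + t x) = D (P x)"
proof -
  let ?d = "\<lambda>x. d x + t x"
  have l: "lmap ?d" using lmaps(1) lmap_t by (intro lmap_intros)
  have cl: "?d x \<in> A" "H x \<in> A" "H (?d x) \<in> A" "P x \<in> B" using x by (auto simp: closed' closed_IHPD)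
  have "?d (?d (H x)) = 0" "?d (?d x) = 0" using dd' cl x by auto
  moreover have "?d (?d (H x) + H (?d x)) = ?d (I (P x) - x)" by (simp only: dH[OF x])
  ultimately have "?d (H (?d x)) = ?d (I (P x)) - ?d x" by (simp only: lmap_add[OF l] lmap_diff[OF l] add_0_left)
  moreover have "?d (H (?d x)) + H (?d (?d x)) = I (P (?d x)) - ?d x" by (rule dH[OF cl(1)])
  ultimately have "?d (I (P x)) = I (P (?d x))"
    using \<open>?d (?d x) = 0\<close> by (simp add: lmap_zero[OF lmap_IHPD(2)])
  then have "I (D (P x)) = I (P (?d x))" using dI cl by simp
  then show ?thesis using PI by (metis cl closed_IHPD)
qed

lemma DD: assumes y: "y \<in> B" shows "D (D y) = 0"
proof -
  have "I (D (D y)) = 0" using dI dd' y by (metis closed_IHPD)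
  then show ?thesis using PI[of "D (D y)"] y by (simp add: closed_IHPD lmap_zero[OF lmap_IHPD(3)])
qed

lemma perturbed: "sdr A B (\<lambda>x. d x + t x) H I P D"
  by unfold_locales
    (use lmap_IHPD lmaps(1) lmap_t in \<open>auto intro: lmap_intros simp: subspaces closed' closed_IHPD dd' DD dI Pd dH PI HI PH HH\<close>)

end

section \<open>The tensor trick\<close>

text \<open>The sum of the maps \<open>1 ... 1 h q ... q\<close> with Koszul signs, where
  \<open>q\<close> will be the projection \<open>ip\<close>. The asymmetry is deliberate: it leads
  to the side conditions and to a multiplicative inclusion.\<close>

fun whom :: "('x \<Rightarrow> nat) \<Rightarrow> ('x \<Rightarrow> ('x list \<Rightarrow>\<^sub>0 'r)) \<Rightarrow> ('x \<Rightarrow> ('x list \<Rightarrow>\<^sub>0 'r)) \<Rightarrow> 'x list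
    \<Rightarrow> ('x list \<Rightarrow>\<^sub>0 'r::comm_ring_1)" where
  "whom dg h q [] = 0"
| "whom dg h q (x # w) = cat (h x) (aext q (gen w)) + smul (sg (dg x)) (cat (gen [x]) (whom dg h q w))"

lemma cat_gen_Cons: "cat (gen (x # w)) y = cat (gen [x]) (cat (gen w) y)"
  by (simp add: cat_assoc[symmetric])

lemma whom_append:
  "whom dg h q (u @ v) = cat (whom dg h q u) (aext q (gen v)) + smul (sg (wdeg dg u)) (cat (gen u) (whom dg h q v))"
proof (induction u)
  case (Cons x u)
  show ?case using Cons cat_gen_Cons[of x u "whom dg h q v"]
    by (simp add: aext_append cat_assoc pm.scale_right_distrib add.assoc)
qed simp

lemma lin_whom_cat:
  assumes a: "a \<in> fsupp (wset S dg m)"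
  shows "lin (whom dg h q) (cat a b) = cat (lin (whom dg h q) a) (aext q b) + smul (sg m) (cat a (lin (whom dg h q) b))"
proof (rule lmap_eq_onI[OF a, of "\<lambda>a. lin (whom dg h q) (cat a b)"
      "\<lambda>a. cat (lin (whom dg h q) a) (aext q b) + smul (sg m) (cat a (lin (whom dg h q) b))"]; (intro lmap_intros)?)
  fix u assume "u \<in> wset S dg m"
  then show "lin (whom dg h q) (cat (gen u) b) = cat (lin (whom dg h q) (gen u)) (aext q b) + smul (sg m) (cat (gen u) (lin (whom dg h q) b))"
    by - (rule lmap_eqI[where f = "\<lambda>b. lin (whom dg h q) (cat (gen u) b)"]; (intro lmap_intros)?;
      simp add: whom_append wset_def)
qed

lemma lin_wder_cat:
  assumes a: "a \<in> fsupp (wset S dg m)"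
  shows "lin (wder dg j f) (cat a b) = cat (lin (wder dg j f) a) (lin (\<lambda>w. gen (map j w)) b)
     + smul (sg m) (cat (lin (\<lambda>w. gen (map j w)) a) (lin (wder dg j f) b))"
proof (rule lmap_eq_onI[OF a, of "\<lambda>a. lin (wder dg j f) (cat a b)"]; (intro lmap_intros)?)
  fix u assume "u \<in> wset S dg m"
  then show "lin (wder dg j f) (cat (gen u) b) = cat (lin (wder dg j f) (gen u)) (lin (\<lambda>w. gen (map j w)) b)
     + smul (sg m) (cat (lin (\<lambda>w. gen (map j w)) (gen u)) (lin (wder dg j f) b))"
    by - (rule lmap_eqI[where f = "\<lambda>b. lin (wder dg j f) (cat (gen u) b)"]; (intro lmap_intros)?;
      simp add: wder_append wset_def)
qed

section \<open>Odd derivations of a tensor algebra, and the filtration of words by length\<close>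

definition der :: "('x \<Rightarrow> nat) \<Rightarrow> ('x \<Rightarrow> ('x list \<Rightarrow>\<^sub>0 'r)) \<Rightarrow> ('x list \<Rightarrow>\<^sub>0 'r) \<Rightarrow> ('x list \<Rightarrow>\<^sub>0 'r::comm_ring_1)" where
  "der dg f = lin (wder dg id f)"

lemma lmap_der [lmap_intros]: "lmap g \<Longrightarrow> lmap (\<lambda>x. der dg f (g x))"
  unfolding der_def by (intro lmap_intros)

lemma lmap_der' [simp]: "lmap (der dg f)"
  by (simp add: der_def)

lemmas der_lin_simps [simp] = lmap_add[OF lmap_der'] lmap_smul[OF lmap_der'] lmap_zero[OF lmap_der']
  lmap_uminus[OF lmap_der'] lmap_diff[OF lmap_der']

lemma der_simps [simp]: "der dg f (gen []) = 0"
  "der dg f (gen (x # w)) = cat (f x) (gen w) + smul (sg (dg x)) (cat (gen [x]) (der dg f (gen w)))"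
  by (simp_all add: der_def)

lemma der_cat:
  "a \<in> fsupp (wset S dg m) \<Longrightarrow> der dg f (cat a b) = cat (der dg f a) b + smul (sg m) (cat a (der dg f b))"
  unfolding der_def using lin_wder_cat[of a S dg m id f b] by simp

lemma der_add_fun: "der dg (\<lambda>x. f x + g x) p = der dg f p + der dg g p"
proof -
  have "wder dg id (\<lambda>x. f x + g x) w = wder dg id f w + wder dg id g w" for w
    by (induction w) (simp_all del: id_apply add: algebra_simps pm.scale_right_distrib)
  then show ?thesis unfolding der_def lin_add_fun[symmetric] by (rule lin_cong[OF refl])
qed

lemma der_cong: "p \<in> fsupp (lists S) \<Longrightarrow> (\<And>x. x \<in> S \<Longrightarrow> f x = g x) \<Longrightarrow> der dg f p = der dg g p"
proof (erule lmap_eq_onI, rule lmap_der', rule lmap_der')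
  fix w assume "w \<in> lists S" "\<And>x. x \<in> S \<Longrightarrow> f x = g x"
  then show "der dg f (gen w) = der dg g (gen w)"
    by (induction w) auto
qed

lemma lt_mem: "p \<in> fsupp X \<Longrightarrow> (\<And>x. x \<in> X \<Longrightarrow> [x] \<in> Y) \<Longrightarrow> lt p \<in> fsupp Y"
  unfolding lt_def by (rule lin_mem_on) auto

lemma der_lt [simp]: "der dg f (lt p) = lin f p"
  by (simp add: lt_def lmap_comp_lin[OF lmap_der'])

lemma lin_whom_lt [simp]: "lin (whom dg h q) (lt p) = lin h p"
  by (simp add: lt_def lin_lin)

lemma aext_lt [simp]: "aext f (lt p) = lin f p"
  unfolding lt_def by (subst lmap_comp_lin[of "aext f"]) (simp_all add: alg_ext_Cons)

lemma lin_lt: "lin (\<lambda>x. lt (f x)) p = lt (lin f p)"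
  by (simp add: lt_def lin_lin)

text \<open>\<open>m\<close> is the degree of the argument of a map and \<open>c\<close> the amount
  by which the map lowers it, written additively to avoid truncated subtraction; \<open>l\<close>
  bounds the word length from below.\<close>

definition WS :: "'x set \<Rightarrow> ('x \<Rightarrow> nat) \<Rightarrow> nat \<Rightarrow> nat \<Rightarrow> nat \<Rightarrow> 'x list set" where
  "WS S dg c m l = {v. set v \<subseteq> S \<and> wdeg dg v + c = m \<and> l \<le> length v}"

lemma cat_WS: "p \<in> fsupp (WS S dg c m l) \<Longrightarrow> q \<in> fsupp (WS S dg c' m' l') \<Longrightarrow>
    c + c' = c'' \<Longrightarrow> m + m' = m'' \<Longrightarrow> l + l' = l'' \<Longrightarrow> cat p q \<in> fsupp (WS S dg c'' m'' l'')"
  by (erule cat_fsupp, assumption) (auto simp: WS_def)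

lemma gen_WS: "set w \<subseteq> S \<Longrightarrow> gen w \<in> fsupp (WS S dg 0 (wdeg dg w) (length w))"
  by (simp add: WS_def)

lemma der_WS:
  assumes "\<And>x. x \<in> S \<Longrightarrow> f x \<in> fsupp (WS S dg 1 (dg x) (Suc l))" "set w \<subseteq> S"
  shows "der dg f (gen w) \<in> fsupp (WS S dg 1 (wdeg dg w) (length w + l))"
  using assms(2)
proof (induction w)
  case (Cons x w)
  have "cat (f x) (gen w) \<in> fsupp (WS S dg 1 (wdeg dg (x # w)) (length (x # w) + l))"
    by (rule cat_WS[OF assms(1) gen_WS]) (use Cons in auto)
  moreover have "cat (gen [x]) (der dg f (gen w)) \<in> fsupp (WS S dg 1 (wdeg dg (x # w)) (length (x # w) + l))"
    by (rule cat_WS[OF gen_WS Cons.IH]) (use Cons in auto)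
  ultimately show ?case by (simp only: der_simps add_in_fsupp smul_in_fsupp)
qed simp

lemma aext_WS:
  assumes "\<And>x. x \<in> S \<Longrightarrow> q x \<in> fsupp (WS S' dg' 0 (dg x) (Suc 0))" "set w \<subseteq> S"
  shows "aext q (gen w) \<in> fsupp (WS S' dg' 0 (wdeg dg w) (length w))"
  using assms(2)
proof (induction w)
  case (Cons x w)
  show ?case unfolding alg_ext_Cons
    by (rule cat_WS[OF assms(1) Cons.IH]) (use Cons in auto)
qed (simp add: WS_def)

lemma whom_WS:
  assumes "\<And>x. x \<in> S \<Longrightarrow> h x \<in> fsupp (WS S dg 0 (Suc (dg x)) (Suc 0))"
    "\<And>x. x \<in> S \<Longrightarrow> q x \<in> fsupp (WS S dg 0 (dg x) (Suc 0))" "set w \<subseteq> S"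
  shows "whom dg h q w \<in> fsupp (WS S dg 0 (Suc (wdeg dg w)) (length w))"
  using assms(3)
proof (induction w)
  case (Cons x w)
  have "cat (h x) (aext q (gen w)) \<in> fsupp (WS S dg 0 (Suc (wdeg dg (x # w))) (length (x # w)))"
    by (rule cat_WS[OF assms(1) aext_WS[OF assms(2)]]) (use Cons in auto)
  moreover have "cat (gen [x]) (whom dg h q w) \<in> fsupp (WS S dg 0 (Suc (wdeg dg (x # w))) (length (x # w)))"
    by (rule cat_WS[OF gen_WS Cons.IH]) (use Cons in auto)
  ultimately show ?case by auto
qed simp

lemma length_le_wdeg: "(\<And>x. x \<in> S \<Longrightarrow> 1 \<le> dg x) \<Longrightarrow> set w \<subseteq> S \<Longrightarrow> length w \<le> wdeg dg w"
  by (induction w) force+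

text \<open>A contraction of the letters, together with the part \<open>Q\<close> of a differential
  on words that produces words of length at least 2. It is instantiated twice, with letters from
  \<open>C\<close> and then with letters that are themselves words.\<close>

locale letter_sdr = sdr "fsupp S" "fsupp S'" "lin d" "lin h" "lin i" "lin p" "lin \<delta>"
  for S :: "'x set" and S' :: "'y set" and d h :: "'x \<Rightarrow> ('x \<Rightarrow>\<^sub>0 'r::comm_ring_1)"
    and i :: "'y \<Rightarrow> ('x \<Rightarrow>\<^sub>0 'r)" and p :: "'x \<Rightarrow> ('y \<Rightarrow>\<^sub>0 'r)" and \<delta> :: "'y \<Rightarrow> ('y \<Rightarrow>\<^sub>0 'r)" +
  fixes dg :: "'x \<Rightarrow> nat" and dg' :: "'y \<Rightarrow> nat" and Q :: "'x \<Rightarrow> ('x list \<Rightarrow>\<^sub>0 'r)"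
  assumes dg: "x \<in> S \<Longrightarrow> 1 \<le> dg x" and dg': "y \<in> S' \<Longrightarrow> 1 \<le> dg' y"
    and d_deg: "x \<in> S \<Longrightarrow> d x \<in> fsupp {y \<in> S. dg y + 1 = dg x}"
    and h_deg: "x \<in> S \<Longrightarrow> h x \<in> fsupp {y \<in> S. dg y = dg x + 1}"
    and i_deg: "y \<in> S' \<Longrightarrow> i y \<in> fsupp {x \<in> S. dg x = dg' y}"
    and p_deg: "x \<in> S \<Longrightarrow> p x \<in> fsupp {y \<in> S'. dg' y = dg x}"
    and \<delta>_deg: "y \<in> S' \<Longrightarrow> \<delta> y \<in> fsupp {x \<in> S'. dg' x + 1 = dg' y}"
    and Q_deg: "x \<in> S \<Longrightarrow> Q x \<in> fsupp (WS S dg 1 (dg x) 2)"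
    and Dsquare: "set w \<subseteq> S \<Longrightarrow> der dg (\<lambda>x. lt (d x) + Q x) (der dg (\<lambda>x. lt (d x) + Q x) (gen w)) = 0"
begin

abbreviation "Td \<equiv> der dg (\<lambda>x. lt (d x))"
abbreviation "T\<delta> \<equiv> der dg' (\<lambda>x. lt (\<delta> x))"
abbreviation "Ti \<equiv> aext (\<lambda>y. lt (i y))"
abbreviation "Tp \<equiv> aext (\<lambda>x. lt (p x))"
abbreviation "Th \<equiv> lin (whom dg (\<lambda>x. lt (h x)) (\<lambda>x. lt (lin i (p x))))"
abbreviation "Tt \<equiv> der dg Q"
abbreviation "Tq \<equiv> aext (\<lambda>x. lt (lin i (p x)))"

lemma letter:
  "x \<in> S \<Longrightarrow> lin d (d x) = 0" "y \<in> S' \<Longrightarrow> lin \<delta> (\<delta> y) = 0" "y \<in> S' \<Longrightarrow> lin d (i y) = lin i (\<delta> y)"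
  "x \<in> S \<Longrightarrow> lin p (d x) = lin \<delta> (p x)" "x \<in> S \<Longrightarrow> lin d (h x) + lin h (d x) = lin i (p x) - gen x"
  "y \<in> S' \<Longrightarrow> lin p (i y) = gen y" "y \<in> S' \<Longrightarrow> lin h (i y) = 0" "x \<in> S \<Longrightarrow> lin p (h x) = 0"
  "x \<in> S \<Longrightarrow> lin h (h x) = 0"
  using dd[of "gen x"] \<delta>\<delta>[of "gen y"] di[of "gen y"] pd[of "gen x"] dh[of "gen x"] pi[of "gen y"] hi[of "gen y"]
    ph[of "gen x"] hh[of "gen x"] by simp_all

lemma ip_deg: "x \<in> S \<Longrightarrow> lin i (p x) \<in> fsupp {z \<in> S. dg z = dg x}"
  by (rule lin_mem_on[OF p_deg]) (auto intro: subsetD[OF fsupp_mono i_deg])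

lemma lt_deg:
  "x \<in> S \<Longrightarrow> lt (d x) \<in> fsupp (wset S dg (dg x - 1))" "x \<in> S \<Longrightarrow> lt (h x) \<in> fsupp (wset S dg (dg x + 1))"
  "y \<in> S' \<Longrightarrow> lt (i y) \<in> fsupp (wset S dg (dg' y))" "x \<in> S \<Longrightarrow> lt (p x) \<in> fsupp (wset S' dg' (dg x))"
  "y \<in> S' \<Longrightarrow> lt (\<delta> y) \<in> fsupp (wset S' dg' (dg' y - 1))"
  "x \<in> S \<Longrightarrow> lt (lin i (p x)) \<in> fsupp (wset S dg (dg x))"
proof -
  show "x \<in> S \<Longrightarrow> lt (d x) \<in> fsupp (wset S dg (dg x - 1))"
    by (rule lt_mem[OF d_deg]) (auto simp: wset_def)
  show "x \<in> S \<Longrightarrow> lt (h x) \<in> fsupp (wset S dg (dg x + 1))"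
    by (rule lt_mem[OF h_deg]) (auto simp: wset_def)
  show "y \<in> S' \<Longrightarrow> lt (i y) \<in> fsupp (wset S dg (dg' y))"
    by (rule lt_mem[OF i_deg]) (auto simp: wset_def)
  show "x \<in> S \<Longrightarrow> lt (p x) \<in> fsupp (wset S' dg' (dg x))"
    by (rule lt_mem[OF p_deg]) (auto simp: wset_def)
  show "y \<in> S' \<Longrightarrow> lt (\<delta> y) \<in> fsupp (wset S' dg' (dg' y - 1))"
    by (rule lt_mem[OF \<delta>_deg]) (auto simp: wset_def)
  show "x \<in> S \<Longrightarrow> lt (lin i (p x)) \<in> fsupp (wset S dg (dg x))"
    by (rule lt_mem[OF ip_deg]) (auto simp: wset_def)
qed

lemma lt_WS:
  "x \<in> S \<Longrightarrow> lt (d x) \<in> fsupp (WS S dg 1 (dg x) (Suc 0))"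
  "x \<in> S \<Longrightarrow> lt (h x) \<in> fsupp (WS S dg 0 (Suc (dg x)) (Suc 0))"
  "y \<in> S' \<Longrightarrow> lt (i y) \<in> fsupp (WS S dg 0 (dg' y) (Suc 0))"
  "x \<in> S \<Longrightarrow> lt (p x) \<in> fsupp (WS S' dg' 0 (dg x) (Suc 0))"
  "y \<in> S' \<Longrightarrow> lt (\<delta> y) \<in> fsupp (WS S' dg' 1 (dg' y) (Suc 0))"
  "x \<in> S \<Longrightarrow> lt (lin i (p x)) \<in> fsupp (WS S dg 0 (dg x) (Suc 0))"
proof -
  show "x \<in> S \<Longrightarrow> lt (lin i (p x)) \<in> fsupp (WS S dg 0 (dg x) (Suc 0))"
    by (rule lt_mem[OF ip_deg]) (auto simp: WS_def)
  show "x \<in> S \<Longrightarrow> lt (d x) \<in> fsupp (WS S dg 1 (dg x) (Suc 0))"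
    by (rule lt_mem[OF d_deg]) (auto simp: WS_def)
  show "x \<in> S \<Longrightarrow> lt (h x) \<in> fsupp (WS S dg 0 (Suc (dg x)) (Suc 0))"
    by (rule lt_mem[OF h_deg]) (auto simp: WS_def)
  show "y \<in> S' \<Longrightarrow> lt (i y) \<in> fsupp (WS S dg 0 (dg' y) (Suc 0))"
    by (rule lt_mem[OF i_deg]) (auto simp: WS_def)
  show "x \<in> S \<Longrightarrow> lt (p x) \<in> fsupp (WS S' dg' 0 (dg x) (Suc 0))"
    by (rule lt_mem[OF p_deg]) (auto simp: WS_def)
  show "y \<in> S' \<Longrightarrow> lt (\<delta> y) \<in> fsupp (WS S' dg' 1 (dg' y) (Suc 0))"
    by (rule lt_mem[OF \<delta>_deg]) (auto simp: WS_def)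
qed

lemma Q_WS: "x \<in> S \<Longrightarrow> Q x \<in> fsupp (WS S dg 1 (dg x) (Suc 1))"
  using Q_deg by (simp add: numeral_2_eq_2)

lemma word_WS:
  "set w \<subseteq> S \<Longrightarrow> Td (gen w) \<in> fsupp (WS S dg 1 (wdeg dg w) (length w + 0))"
  "set v \<subseteq> S' \<Longrightarrow> T\<delta> (gen v) \<in> fsupp (WS S' dg' 1 (wdeg dg' v) (length v + 0))"
  "set v \<subseteq> S' \<Longrightarrow> Ti (gen v) \<in> fsupp (WS S dg 0 (wdeg dg' v) (length v))"
  "set w \<subseteq> S \<Longrightarrow> Tp (gen w) \<in> fsupp (WS S' dg' 0 (wdeg dg w) (length w))"
  "set w \<subseteq> S \<Longrightarrow> Th (gen w) \<in> fsupp (WS S dg 0 (Suc (wdeg dg w)) (length w))"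
  "set w \<subseteq> S \<Longrightarrow> Tt (gen w) \<in> fsupp (WS S dg 1 (wdeg dg w) (length w + 1))"
proof -
  show "set w \<subseteq> S \<Longrightarrow> Td (gen w) \<in> fsupp (WS S dg 1 (wdeg dg w) (length w + 0))"
    by (rule der_WS[OF lt_WS(1)])
  show "set v \<subseteq> S' \<Longrightarrow> T\<delta> (gen v) \<in> fsupp (WS S' dg' 1 (wdeg dg' v) (length v + 0))"
    by (rule der_WS[OF lt_WS(5)])
  show "set v \<subseteq> S' \<Longrightarrow> Ti (gen v) \<in> fsupp (WS S dg 0 (wdeg dg' v) (length v))"
    by (rule aext_WS[OF lt_WS(3)])
  show "set w \<subseteq> S \<Longrightarrow> Tp (gen w) \<in> fsupp (WS S' dg' 0 (wdeg dg w) (length w))"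
    by (rule aext_WS[OF lt_WS(4)])
  show "set w \<subseteq> S \<Longrightarrow> Th (gen w) \<in> fsupp (WS S dg 0 (Suc (wdeg dg w)) (length w))"
    unfolding lin_gen by (rule whom_WS[OF lt_WS(2) lt_WS(6)])
  show "set w \<subseteq> S \<Longrightarrow> Tt (gen w) \<in> fsupp (WS S dg 1 (wdeg dg w) (length w + 1))"
    by (rule der_WS[OF Q_WS])
qed

lemma WS_lists: "WS S dg c m l \<subseteq> lists S" by (auto simp: WS_def)

lemma T_closed:
  "x \<in> fsupp (lists S) \<Longrightarrow> Td x \<in> fsupp (lists S)"
  "x \<in> fsupp (lists S) \<Longrightarrow> Th x \<in> fsupp (lists S)"
  "y \<in> fsupp (lists S') \<Longrightarrow> Ti y \<in> fsupp (lists S)"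
  "x \<in> fsupp (lists S) \<Longrightarrow> Tp x \<in> fsupp (lists S')"
  "y \<in> fsupp (lists S') \<Longrightarrow> T\<delta> y \<in> fsupp (lists S')"
  "x \<in> fsupp (lists S) \<Longrightarrow> Tt x \<in> fsupp (lists S)"
proof -
  have sub: "fsupp (WS U e c m l) \<subseteq> fsupp (lists U)" for U :: "'z set" and e c m l
    by (rule fsupp_mono) (auto simp: WS_def)
  note word = word_WS[THEN subsetD[OF sub]]
  note l = lmap_der' lmap_lin lmap_alg_ext subspace_fsupp
  show "x \<in> fsupp (lists S) \<Longrightarrow> Td x \<in> fsupp (lists S)"
    by (rule lmap_mem[OF l(1)]) (auto intro!: word(1))
  show "x \<in> fsupp (lists S) \<Longrightarrow> Th x \<in> fsupp (lists S)"
    by (rule lmap_mem[OF l(2)], assumption, rule subspace_fsupp, rule word(5)) auto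
  show "y \<in> fsupp (lists S') \<Longrightarrow> Ti y \<in> fsupp (lists S)"
    by (rule lmap_mem[OF l(3)]) (auto intro!: word(3))
  show "x \<in> fsupp (lists S) \<Longrightarrow> Tp x \<in> fsupp (lists S')"
    by (rule lmap_mem[OF l(3)]) (auto intro!: word(4))
  show "y \<in> fsupp (lists S') \<Longrightarrow> T\<delta> y \<in> fsupp (lists S')"
    by (rule lmap_mem[OF l(1)]) (auto intro!: word(2))
  show "x \<in> fsupp (lists S) \<Longrightarrow> Tt x \<in> fsupp (lists S)"
    by (rule lmap_mem[OF l(1)]) (auto intro!: word(6))
qed

lemma Ti_Tp: "x \<in> fsupp (lists S) \<Longrightarrow> Ti (Tp x) = Tq x"
proof (erule lmap_eq_onI[of _ _ "\<lambda>x. Ti (Tp x)"]; (intro lmap_intros)?)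
  fix w assume "w \<in> lists S"
  then show "Ti (Tp (gen w)) = Tq (gen w)"
    by (induction w) (auto simp: alg_ext_Cons aext_cat lin_lt)
qed

lemma sg_pred: "x \<in> S \<Longrightarrow> sg (dg x - Suc 0) = (- sg (dg x) :: 'r)" "y \<in> S' \<Longrightarrow> sg (dg' y - Suc 0) = (- sg (dg' y) :: 'r)"
  using dg[of x] dg'[of y] by (cases "dg x"; cases "dg' y"; simp)+

lemma gen1_wset: "x \<in> S \<Longrightarrow> gen [x] \<in> fsupp (wset S dg (dg x))" "y \<in> S' \<Longrightarrow> gen [y] \<in> fsupp (wset S' dg' (dg' y))"
  by (simp_all add: wset_def)

lemma Tw_sdr: "sdr (fsupp (lists S)) (fsupp (lists S')) Td Th Ti Tp T\<delta>"
proof unfold_locales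
  show "Td (Td x) = 0" if "x \<in> fsupp (lists S)" for x
    using that
  proof (rule lmap_eq_onI[of _ _ "\<lambda>x. Td (Td x)"]; (intro lmap_intros)?)
    fix w assume "w \<in> lists S"
    then show "Td (Td (gen w)) = 0"
      by (induction w) (simp_all add: der_cat[OF lt_deg(1)] der_cat[OF gen1_wset(1)] sg_pred lin_lt letter)
  qed
  show "T\<delta> (T\<delta> x) = 0" if "x \<in> fsupp (lists S')" for x
    using that
  proof (rule lmap_eq_onI[of _ _ "\<lambda>x. T\<delta> (T\<delta> x)"]; (intro lmap_intros)?)
    fix w assume "w \<in> lists S'"
    then show "T\<delta> (T\<delta> (gen w)) = 0"
      by (induction w) (simp_all add: der_cat[OF lt_deg(5)] der_cat[OF gen1_wset(2)] sg_pred lin_lt letter)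
  qed
  show di': "Td (Ti x) = Ti (T\<delta> x)" if "x \<in> fsupp (lists S')" for x
    using that
  proof (rule lmap_eq_onI[of _ _ "\<lambda>x. Td (Ti x)"]; (intro lmap_intros)?)
    fix w assume "w \<in> lists S'"
    then show "Td (Ti (gen w)) = Ti (T\<delta> (gen w))"
      by (induction w) (simp_all add: alg_ext_Cons der_cat[OF lt_deg(3)] aext_cat lin_lt letter)
  qed
  show pd': "Tp (Td x) = T\<delta> (Tp x)" if "x \<in> fsupp (lists S)" for x
    using that
  proof (rule lmap_eq_onI[of _ _ "\<lambda>x. Tp (Td x)"]; (intro lmap_intros)?)
    fix w assume "w \<in> lists S"
    then show "Tp (Td (gen w)) = T\<delta> (Tp (gen w))"
      by (induction w) (simp_all add: alg_ext_Cons der_cat[OF lt_deg(4)] aext_cat lin_lt letter)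
  qed
  show pi': "Tp (Ti x) = x" if "x \<in> fsupp (lists S')" for x
    using that
  proof (rule lmap_eq_onI[of _ _ "\<lambda>x. Tp (Ti x)"]; (intro lmap_intros)?)
    fix w assume "w \<in> lists S'"
    then show "Tp (Ti (gen w)) = gen w"
      by (induction w) (simp_all add: alg_ext_Cons aext_cat lin_lt letter)
  qed
  show hi': "Th (Ti x) = 0" if "x \<in> fsupp (lists S')" for x
    using that
  proof (rule lmap_eq_onI[of _ _ "\<lambda>x. Th (Ti x)"]; (intro lmap_intros)?)
    fix w assume "w \<in> lists S'"
    then show "Th (Ti (gen w)) = 0"
      by (induction w) (simp_all add: alg_ext_Cons lin_whom_cat[OF lt_deg(3)] lin_lt letter)
  qed
  show ph': "Tp (Th x) = 0" if "x \<in> fsupp (lists S)" for x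
    using that
  proof (rule lmap_eq_onI[of _ _ "\<lambda>x. Tp (Th x)"]; (intro lmap_intros)?)
    fix w assume "w \<in> lists S"
    then show "Tp (Th (gen w)) = 0"
      by (induction w) (simp_all add: aext_cat lin_lt letter)
  qed
  show "Th (Th x) = 0" if "x \<in> fsupp (lists S)" for x
    using that
  proof (rule lmap_eq_onI[of _ _ "\<lambda>x. Th (Th x)"]; (intro lmap_intros)?)
    fix w assume "w \<in> lists S"
    then show "Th (Th (gen w)) = 0"
    proof (induction w)
      case (Cons x w)
      have g: "gen w \<in> fsupp (lists S)" "whom dg (\<lambda>x. lt (h x)) (\<lambda>x. lt (lin i (p x))) w \<in> fsupp (lists S)"
        using Cons T_closed(2)[of "gen w"] by auto
      \<comment> \<open>Applying \<open>Th\<close> twice to \<open>x # w\<close> leaves, besides the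
        squares on the letter and on the tail, only terms with \<open>Th Tq\<close> or
        \<open>Tq Th\<close> on the tail. Both vanish by the side conditions already proved.\<close>
      have "Th (Tq (gen w)) = 0" using hi'[of "Tp (gen w)"] T_closed(4)[OF g(1)] Ti_Tp[OF g(1)] by simp
      moreover have "Tq (Th (gen w)) = 0" using ph'[OF g(1)] Ti_Tp[OF g(2)] by simp
      ultimately show ?case using Cons
        by (simp add: lin_whom_cat[OF lt_deg(2)] lin_whom_cat[OF gen1_wset(1)] lin_lt letter)
    qed simp
  qed
  show "Td (Th x) + Th (Td x) = Ti (Tp x) - x" if "x \<in> fsupp (lists S)" for x
    using that
  proof (rule lmap_eq_onI[of _ _ "\<lambda>x. Td (Th x) + Th (Td x)"]; (intro lmap_intros)?)
    fix w assume "w \<in> lists S"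
    then have "Td (Th (gen w)) + Th (Td (gen w)) = Tq (gen w) - gen w"
    proof (induction w)
      case (Cons x w)
      have g: "gen w \<in> fsupp (lists S)" "Tp (gen w) \<in> fsupp (lists S')" "Td (gen w) \<in> fsupp (lists S)"
        using Cons T_closed(4)[of "gen w"] T_closed(1)[of "gen w"] by auto
      \<comment> \<open>The two terms with \<open>h x\<close> in front and a differential on the
        tail cancel because the differential commutes with the projection \<open>Tq\<close>.\<close>
      have c: "Td (Tq (gen w)) = Tq (Td (gen w))"
        using di'[OF g(2)] pd'[OF g(1)] Ti_Tp[OF g(1)] Ti_Tp[OF g(3)] by simp
      have l: "lt (lin d (h x)) + lt (lin h (d x)) = lt (lin i (p x)) - gen [x]"
        using arg_cong[OF letter(5)[of x], of lt] Cons by simp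
      have e: "Td (Th (gen (x # w))) + Th (Td (gen (x # w)))
        = cat (lt (lin d (h x)) + lt (lin h (d x))) (Tq (gen w)) + cat (gen [x]) (Td (Th (gen w)) + Th (Td (gen w)))"
        using Cons c by (simp add: der_cat[OF lt_deg(2)] der_cat[OF gen1_wset(1)]
            lin_whom_cat[OF lt_deg(1)] lin_whom_cat[OF gen1_wset(1)] lin_lt sg_pred algebra_simps pm.scale_right_distrib)
      show ?case unfolding e l using Cons by (simp add: alg_ext_Cons)
    qed simp
    with \<open>w \<in> lists S\<close> show "Td (Th (gen w)) + Th (Td (gen w)) = Ti (Tp (gen w)) - gen w"
      by (simp add: Ti_Tp)
  qed
qed (use T_closed in \<open>simp_all\<close>)

section \<open>The geometric series of homotopy and perturbation\<close>

definition "tht x = Th (Tt x)"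

text \<open>The series is cut off at the degree of the word; by \<open>tht_nilpotent\<close> nothing
  is lost.\<close>

definition "TN = lin (\<lambda>w. \<Sum>k\<le>wdeg dg w. (tht ^^ k) (gen w))"

lemma lmap_tht: "lmap tht" "lmap (tht ^^ k)"
proof -
  show l: "lmap tht" unfolding tht_def by (intro lmap_intros)
  show "lmap (tht ^^ k)"
  proof (induction k)
    case (Suc k)
    then show ?case using l by (simp add: linear_on_def)
  qed (simp add: linear_on_def)
qed

lemma WS_mono: "l' \<le> l \<Longrightarrow> a \<in> fsupp (WS S dg c m l) \<Longrightarrow> a \<in> fsupp (WS S dg c m l')"
  by (erule subsetD[OF fsupp_mono, rotated]) (auto simp: WS_def)

lemma Tt_WS: "x \<in> fsupp (WS S dg 0 n l) \<Longrightarrow> Tt x \<in> fsupp (WS S dg 1 n (Suc l))"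
proof (rule lmap_mem[OF lmap_der'], assumption, rule subspace_fsupp)
  fix w assume "w \<in> WS S dg 0 n l"
  then show "Tt (gen w) \<in> fsupp (WS S dg 1 n (Suc l))"
    using word_WS(6)[of w] by (intro WS_mono[of "Suc l" "Suc (length w)"]) (auto simp: WS_def)
qed

lemma Th_WS: "x \<in> fsupp (WS S dg 1 n l) \<Longrightarrow> Th x \<in> fsupp (WS S dg 0 n l)"
proof (rule lmap_mem[OF lmap_lin], assumption, rule subspace_fsupp)
  fix w assume "w \<in> WS S dg 1 n l"
  then show "Th (gen w) \<in> fsupp (WS S dg 0 n l)"
    using word_WS(5)[of w] by (intro WS_mono[of l "length w"]) (auto simp: WS_def)
qed

lemma tht_WS: "x \<in> fsupp (WS S dg 0 n l) \<Longrightarrow> tht x \<in> fsupp (WS S dg 0 n (Suc l))"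
  unfolding tht_def by (intro Th_WS Tt_WS)

lemma tht_pow_WS: "x \<in> fsupp (WS S dg 0 n l) \<Longrightarrow> (tht ^^ k) x \<in> fsupp (WS S dg 0 n (l + k))"
  by (induction k) (auto simp: tht_WS)

lemma WS_empty: "n < l \<Longrightarrow> WS S dg 0 n l = {}"
  using length_le_wdeg[of S dg] dg by (fastforce simp: WS_def)

text \<open>Each application keeps the degree and lengthens words by at least one letter, while a
  word in letters of degree at least 1 is no longer than its degree.\<close>

lemma tht_nilpotent: "x \<in> fsupp (WS S dg 0 n 0) \<Longrightarrow> n < k \<Longrightarrow> (tht ^^ k) x = 0"
  using tht_pow_WS[of x n 0 k] WS_empty[of n k] by (simp add: fsupp_empty)

lemma lmap_TN: "lmap TN"
  by (simp add: TN_def)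

lemma TN_homogeneous: "x \<in> fsupp (WS S dg 0 n 0) \<Longrightarrow> TN x = (\<Sum>k\<le>n. (tht ^^ k) x)"
proof (rule lmap_eq_onI[of _ _ TN], assumption, rule lmap_TN)
  show "lmap (\<lambda>x. \<Sum>k\<le>n. (tht ^^ k) x)"
    by (rule lmapI) (simp_all add: lmap_tht[THEN lmap_add] lmap_tht[THEN lmap_smul] sum.distrib pm.scale_sum_right)
qed (auto simp: TN_def WS_def)

lemma TN_WS: "x \<in> fsupp (WS S dg 0 n 0) \<Longrightarrow> TN x \<in> fsupp (WS S dg 0 n 0)"
  unfolding TN_homogeneous by (rule pm.subspace_sum) (auto intro: WS_mono[OF _ tht_pow_WS])

lemma lists_WS: "w \<in> lists S \<Longrightarrow> gen w \<in> fsupp (WS S dg 0 (wdeg dg w) 0)"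
  by (auto simp: WS_def)

lemma WS_lists_fsupp: "a \<in> fsupp (WS S dg c m l) \<Longrightarrow> a \<in> fsupp (lists S)"
  using fsupp_mono[OF WS_lists] by blast

lemma TN_eqs:
  assumes "x \<in> fsupp (lists S)"
  shows "TN x \<in> fsupp (lists S)" "TN x = x + Th (Tt (TN x))" "TN x = x + TN (Th (Tt x))"
proof -
  show "TN x \<in> fsupp (lists S)"
    by (rule lmap_mem[OF lmap_TN assms]) (auto intro: WS_lists_fsupp TN_WS lists_WS)
  have *: "(\<Sum>k\<le>n. (tht ^^ k) y) = y + (\<Sum>k\<le>n. (tht ^^ Suc k) y)" if "y \<in> fsupp (WS S dg 0 n 0)" for n y
    using sum.atMost_Suc_shift[of "\<lambda>k. (tht ^^ k) y" n] tht_nilpotent[OF that, of "Suc n"] by simp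
  have "TN x = x + tht (TN x)"
  proof (rule lmap_eq_onI[OF assms lmap_TN])
    show "lmap (\<lambda>x. x + tht (TN x))" unfolding tht_def TN_def by (intro lmap_intros)
    fix w assume "w \<in> lists S"
    note w = lists_WS[OF this]
    show "TN (gen w) = gen w + tht (TN (gen w))"
      using *[OF w] unfolding TN_homogeneous[OF w] lmap_sum[OF lmap_tht(1)] by simp
  qed
  then show "TN x = x + Th (Tt (TN x))" by (simp add: tht_def)
  have "TN x = x + TN (tht x)"
  proof (rule lmap_eq_onI[OF assms lmap_TN])
    show "lmap (\<lambda>x. x + TN (tht x))" unfolding tht_def TN_def by (intro lmap_intros)
    fix w assume "w \<in> lists S"
    note w = lists_WS[OF this]
    have "tht (gen w) \<in> fsupp (WS S dg 0 (wdeg dg w) 0)" using tht_WS[OF w] by (rule WS_mono[rotated]) simp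
    then show "TN (gen w) = gen w + TN (tht (gen w))"
      using *[OF w] by (simp add: TN_homogeneous[OF w] TN_homogeneous funpow_swap1)
  qed
  then show "TN x = x + TN (Th (Tt x))" by (simp add: tht_def)
qed

lemma square: "x \<in> fsupp (lists S) \<Longrightarrow> Td (Tt x) + Tt (Td x) + Tt (Tt x) = 0"
proof (erule lmap_eq_onI[of _ _ "\<lambda>x. Td (Tt x) + Tt (Td x) + Tt (Tt x)"]; (intro lmap_intros)?)
  fix w assume w: "w \<in> lists S"
  then show "Td (Tt (gen w)) + Tt (Td (gen w)) + Tt (Tt (gen w)) = 0"
    using Dsquare[of w] sdr.dd[OF Tw_sdr, of "gen w"]
    by (auto simp: der_add_fun add_ac lists_eq_set)
qed

sublocale word: perturbation "fsupp (lists S)" "fsupp (lists S')" Td Th Ti Tp T\<delta> Tt TN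
  by (rule perturbation.intro[OF Tw_sdr], rule perturbation_axioms.intro)
    (fact lmap_der' lmap_TN T_closed TN_eqs square)+

lemma wset_WS: "wset U e n = WS U e 0 n 0" "WS U e 1 (Suc n) l = WS U e 0 n l"
  by (auto simp: wset_def WS_def)

lemma Th_deg: "x \<in> fsupp (wset S dg n) \<Longrightarrow> Th x \<in> fsupp (wset S dg (Suc n))"
  using Th_WS[of x "Suc n" 0] unfolding wset_WS .

lemma Tt_deg: "x \<in> fsupp (wset S dg (Suc n)) \<Longrightarrow> Tt x \<in> fsupp (wset S dg n)"
  using Tt_WS[of x "Suc n" 0] WS_mono[of 0 "Suc 0" "Tt x"] unfolding wset_WS by simp

lemma Tp_deg: "x \<in> fsupp (wset S dg n) \<Longrightarrow> Tp x \<in> fsupp (wset S' dg' n)"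
proof (erule lmap_mem[OF lmap_alg_ext _ subspace_fsupp])
  fix w assume "w \<in> wset S dg n"
  then show "Tp (gen w) \<in> fsupp (wset S' dg' n)"
    using subsetD[OF fsupp_mono word_WS(4)[of w], of "wset S' dg' n"] by (auto simp: WS_def wset_def)
qed

lemma Ti_deg: "x \<in> fsupp (wset S' dg' n) \<Longrightarrow> Ti x \<in> fsupp (wset S dg n)"
proof (erule lmap_mem[OF lmap_alg_ext _ subspace_fsupp])
  fix w assume "w \<in> wset S' dg' n"
  then show "Ti (gen w) \<in> fsupp (wset S dg n)"
    using subsetD[OF fsupp_mono word_WS(3)[of w], of "wset S dg n"] by (auto simp: WS_def wset_def)
qed

lemma T\<delta>_deg: "x \<in> fsupp (wset S' dg' (Suc n)) \<Longrightarrow> T\<delta> x \<in> fsupp (wset S' dg' n)"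
proof (erule lmap_mem[OF lmap_der' _ subspace_fsupp])
  fix w assume "w \<in> wset S' dg' (Suc n)"
  then show "T\<delta> (gen w) \<in> fsupp (wset S' dg' n)"
    using subsetD[OF fsupp_mono word_WS(2)[of w], of "wset S' dg' n"] by (auto simp: WS_def wset_def)
qed

lemma TN_deg: "x \<in> fsupp (wset S dg n) \<Longrightarrow> TN x \<in> fsupp (wset S dg n)"
  using TN_WS unfolding wset_WS .

lemma word_deg:
  "y \<in> fsupp (wset S' dg' n) \<Longrightarrow> word.I y \<in> fsupp (wset S dg n)"
  "x \<in> fsupp (wset S dg n) \<Longrightarrow> word.H x \<in> fsupp (wset S dg (Suc n))"
  "x \<in> fsupp (wset S dg n) \<Longrightarrow> word.P x \<in> fsupp (wset S' dg' n)"
  "y \<in> fsupp (wset S' dg' (Suc n)) \<Longrightarrow> word.D y \<in> fsupp (wset S' dg' n)"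
  unfolding word.I_def word.H_def word.P_def word.D_def
  by (intro add_in_fsupp TN_deg Ti_deg Th_deg Tp_deg Tt_deg T\<delta>_deg; assumption)+

lemma wset_0: "wset S dg 0 = {[]}" "wset S' dg' 0 = {[]}"
  using length_le_wdeg[of S dg] length_le_wdeg[of S' dg'] dg dg' by (fastforce simp: wset_def)+

lemma I_gen_Nil: "word.I (gen []) = gen []"
proof -
  have "word.I (gen []) = c" if "c = gen []" for c
    using that unfolding word.I_def by (simp add: TN_def)
  then show ?thesis by blast
qed

text \<open>The product \<open>cat a b\<close> solves the fixed-point equation that defines
  \<open>I\<close> on \<open>u @ v\<close>. The perturbation is a derivation, and in the expansion
  of the homotopy the unwanted terms contain \<open>Th a\<close> or \<open>Th b\<close>, which are
  0, while \<open>Tq b\<close> is the unperturbed image of \<open>v\<close>.\<close>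

lemma I_append:
  assumes "u \<in> lists S'" "v \<in> lists S'"
  shows "word.I (gen (u @ v)) = cat (word.I (gen u)) (word.I (gen v))"
proof -
  define m where "m = wdeg dg' u"
  define a b where "a = word.I (gen u)" and "b = word.I (gen v)"
  have uv: "gen u \<in> fsupp (lists S')" "gen v \<in> fsupp (lists S')" "gen (u @ v) \<in> fsupp (lists S')" using assms by auto
  have "gen u \<in> fsupp (wset S' dg' m)" using assms by (auto simp: wset_def m_def)
  then have a: "a \<in> fsupp (wset S dg m)" unfolding a_def by (rule word_deg)
  have ab: "a \<in> fsupp (lists S)" "b \<in> fsupp (lists S)" "Tt b \<in> fsupp (lists S)"
    unfolding a_def b_def using uv word.closed_IHPD(1) T_closed(6) by auto
  have Iab: "Th a = 0" "Th b = 0" "a = Ti (gen u) + Th (Tt a)" "b = Ti (gen v) + Th (Tt b)"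
    "Tq b = Ti (gen v)"
    using word.hI[OF uv(1)] word.hI[OF uv(2)] word.I_eq[OF uv(1)] word.I_eq[OF uv(2)]
      word.pI[OF uv(2)] Ti_Tp[OF ab(2)] unfolding a_def b_def by metis+
  \<comment> \<open>The product rule for \<open>Th\<close> needs the degree of \<open>Tt a\<close>,
    namely \<open>m - 1\<close>. In degree 0 only the empty word is left, and \<open>Tt a\<close>
    vanishes.\<close>
  have "Th (cat (Tt a) b) = cat (Th (Tt a)) (Ti (gen v))"
  proof (cases m)
    case 0
    then have "Tt a = 0" using a lmap_eq_onI[of a "{[]}" Tt "\<lambda>x. 0"] unfolding 0 wset_0
      by (auto intro: lmap_intros)
    then show ?thesis by simp
  next
    case (Suc k)
    then have "Tt a \<in> fsupp (wset S dg k)" using a Tt_deg by simp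
    then show ?thesis using Iab by (simp add: lin_whom_cat)
  qed
  moreover have "Th (cat a (Tt b)) = smul (sg m) (cat a (Th (Tt b)))"
    using lin_whom_cat[OF a] Iab(1) by simp
  ultimately have *: "Th (Tt (cat a b)) = cat (Th (Tt a)) (Ti (gen v)) + cat a (Th (Tt b))"
    by (simp add: der_cat[OF a])
  have "cat a b = Ti (gen (u @ v)) + Th (Tt (cat a b))"
  proof -
    have "cat a b = cat a (Ti (gen v)) + cat a (Th (Tt b))"
      by (subst Iab(4)) (simp only: cat_simps)
    also have "cat a (Ti (gen v)) = cat (Ti (gen u)) (Ti (gen v)) + cat (Th (Tt a)) (Ti (gen v))"
      by (subst Iab(3)) (simp only: cat_simps)
    finally show ?thesis using * by (simp add: aext_append add.assoc)
  qed
  moreover have "cat a b \<in> fsupp (lists S)"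
    by (rule cat_fsupp[OF ab(1,2)]) auto
  ultimately show ?thesis
    unfolding a_def[symmetric] b_def[symmetric] word.I_def[of "gen (u @ v)"]
    by (intro word.N_unique[symmetric] T_closed uv)
qed

end

section \<open>Unitriangular maps\<close>

text \<open>Take an index of largest weight in the support of \<open>p\<close>. Its leading word
  occurs in no other contribution to \<open>lin f p\<close>, so its coefficient there is that of
  \<open>p\<close> up to sign.\<close>

lemma triangular_inj:
  fixes f :: "'i \<Rightarrow> ('x \<Rightarrow>\<^sub>0 'r::comm_ring_1)" and wt :: "'x \<Rightarrow> nat"
  assumes inj: "inj_on enc I"
    and lead: "\<And>i. i \<in> I \<Longrightarrow> \<exists>s. (s = 1 \<or> s = - 1) \<and> f i - smul s (gen (enc i)) \<in> fsupp {y. wt y < wt (enc i)}"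
    and p: "p \<in> fsupp I" "lin f p = 0"
  shows "p = 0"
proof (rule ccontr)
  assume "p \<noteq> 0"
  then have ne: "finite (Poly_Mapping.keys p)" "Poly_Mapping.keys p \<noteq> {}" by simp_all
  have "Max ((\<lambda>j. wt (enc j)) ` Poly_Mapping.keys p) \<in> (\<lambda>j. wt (enc j)) ` Poly_Mapping.keys p"
    using ne by (intro Max_in) auto
  then obtain i where i: "i \<in> Poly_Mapping.keys p" "Max ((\<lambda>j. wt (enc j)) ` Poly_Mapping.keys p) = wt (enc i)"
    by blast
  have i': "wt (enc j) \<le> wt (enc i)" if "j \<in> Poly_Mapping.keys p" for j
    unfolding i(2)[symmetric] using that ne by (intro Max_ge) auto
  have I: "j \<in> Poly_Mapping.keys p \<Longrightarrow> j \<in> I" for j using p(1) by (rule fsuppD)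
  obtain s where s: "s = 1 \<or> s = - 1" "f i - smul s (gen (enc i)) \<in> fsupp {y. wt y < wt (enc i)}"
    using lead[OF I[OF i(1)]] by blast
  have coeff: "Poly_Mapping.lookup (f j) (enc i) = (if j = i then s else 0)" if j: "j \<in> Poly_Mapping.keys p" for j
  proof -
    obtain s' where s': "f j - smul s' (gen (enc j)) \<in> fsupp {y. wt y < wt (enc j)}" "j = i \<Longrightarrow> s' = s"
      using lead[OF I[OF j]] s by (cases "j = i") blast+
    have "enc i \<notin> Poly_Mapping.keys (f j - smul s' (gen (enc j)))"
      using fsuppD[OF s'(1)] i'[OF j] by fastforce
    then have "Poly_Mapping.lookup (f j) (enc i) = s' * (if enc j = enc i then 1 else 0)"
      by (simp add: in_keys_iff lookup_minus lookup_gen)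
    then show ?thesis using s'(2) inj_onD[OF inj _ I[OF j] I[OF i(1)]] by auto
  qed
  have "Poly_Mapping.lookup (lin f p) (enc i) = (\<Sum>j\<in>Poly_Mapping.keys p. Poly_Mapping.lookup p j * (if j = i then s else 0))"
    unfolding lin_def lookup_sum by (rule sum.cong) (simp_all add: coeff)
  also have "\<dots> = Poly_Mapping.lookup p i * s" using i(1) ne(1) by (simp add: if_distrib cong: if_cong)
  finally have "Poly_Mapping.lookup p i * s = 0" using p(2) by simp
  then show False using s(1) i(1) by (auto simp: in_keys_iff)
qed

lemma subspace_image:
  fixes f :: "('x \<Rightarrow>\<^sub>0 'r::comm_ring_1) \<Rightarrow> ('y \<Rightarrow>\<^sub>0 'r)"
  assumes f: "lmap f" and V: "pm.subspace V"
  shows "pm.subspace (f ` V)"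
proof (rule pm.subspaceI)
  show "0 \<in> f ` V" using pm.subspace_0[OF V] lmap_zero[OF f] by (metis imageI)
  show "a + b \<in> f ` V" if ab: "a \<in> f ` V" "b \<in> f ` V" for a b
  proof -
    obtain x y where "a = f x" "b = f y" "x \<in> V" "y \<in> V" using ab by blast
    then show ?thesis using pm.subspace_add[OF V] by (intro image_eqI[of _ _ "x + y"]) (simp_all add: lmap_add[OF f])
  qed
  show "smul c a \<in> f ` V" if a: "a \<in> f ` V" for a c
  proof -
    obtain x where "a = f x" "x \<in> V" using a by blast
    then show ?thesis using pm.subspace_scale[OF V] by (intro image_eqI[of _ _ "smul c x"]) (simp_all add: lmap_smul[OF f])
  qed
qed

text \<open>Induction on the weight removes leading words. Confining the remainders to
  \<open>X\<close> yields preimages supported on indices with leading word in \<open>X\<close>;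
  taking for \<open>X\<close> the words of one degree keeps control of degrees.\<close>

lemma triangular_surj:
  fixes f :: "'i \<Rightarrow> ('x \<Rightarrow>\<^sub>0 'r::comm_ring_1)" and wt :: "'x \<Rightarrow> nat"
  assumes surj: "X \<subseteq> enc ` I"
    and lead: "\<And>i. i \<in> I \<Longrightarrow> enc i \<in> X \<Longrightarrow>
      \<exists>s. (s = 1 \<or> s = - 1) \<and> f i - smul s (gen (enc i)) \<in> fsupp {y \<in> X. wt y < wt (enc i)}"
    and x: "q \<in> fsupp X"
  shows "\<exists>p \<in> fsupp {i \<in> I. enc i \<in> X}. q = lin f p"
proof -
  let ?V = "lin f ` fsupp {i \<in> I. enc i \<in> X}"
  have V: "pm.subspace ?V"
    by (rule subspace_image) auto
  have "gen x \<in> ?V" if "x \<in> X" for x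
    using that
  proof (induction "wt x" arbitrary: x rule: less_induct)
    case less
    then obtain i where i: "i \<in> I" "x = enc i" using surj by blast
    with less obtain s where s: "s = 1 \<or> s = - 1" "f i - smul s (gen x) \<in> fsupp {y \<in> X. wt y < wt x}"
      using lead by blast
    have "lin gen (f i - smul s (gen x)) \<in> ?V"
    proof (rule lin_mem_on[OF s(2) V])
      show "gen y \<in> ?V" if "y \<in> {y \<in> X. wt y < wt x}" for y using less(1)[of y] that by blast
    qed
    moreover have "lin f (gen i) \<in> ?V" using i less(2) by (intro imageI) simp
    then have "f i \<in> ?V" by (simp only: lin_gen)
    ultimately have "f i - lin gen (f i - smul s (gen x)) \<in> ?V" by (intro pm.subspace_diff[OF V])
    then have "smul s (gen x) \<in> ?V" unfolding lin_gen_id by (simp only: diff_diff_eq2 add_diff_cancel_left')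
    then have "smul s (smul s (gen x)) \<in> ?V" by (rule pm.subspace_scale[OF V])
    then show ?case using s(1) by auto
  qed
  then have "lin gen q \<in> ?V" by (intro lin_mem_on[OF x V])
  then show ?thesis by auto
qed

section \<open>Derivations of odd degree\<close>

text \<open>An odd derivation has a derivation as its square: the mixed terms cancel because
  \<open>f\<close> reverses the parity of a letter. It is therefore enough to look at
  letters.\<close>

lemma der_square:
  assumes deg: "\<And>x. x \<in> S \<Longrightarrow> f x \<in> fsupp (wset S dg (dg x - 1))" "\<And>x. x \<in> S \<Longrightarrow> 1 \<le> dg x"
    and sq: "\<And>x. x \<in> S \<Longrightarrow> der dg f (f x) = 0" and w: "w \<in> lists S"
  shows "der dg f (der dg f (gen w)) = 0"
  using w
proof (induction w)
  case (Cons x w)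
  have "sg (dg x - 1) = (- sg (dg x) :: 'b)" using deg(2)[of x] Cons by (cases "dg x") auto
  then show ?case using Cons sq by (simp add: der_cat[OF deg(1)] der_cat[of "gen [x]" S dg "dg x"] wset_def)
qed simp

lemma lin_tens': "lin G (tens p q) = lin (\<lambda>x. lin (\<lambda>y. G (x, y)) q) p"
  by (simp add: tens_def bilin_def lin_lin)

text \<open>Only the two inner factors are interchanged, so only these have to be
  homogeneous.\<close>

lemma tmul_tens_tens:
  assumes p: "p' \<in> fsupp (wset S b m)" and q: "q \<in> fsupp (wset T a n)"
  shows "tensor_mul a b (tens p p') (tens q q') = smul (sg (m * n)) (tens (cat p q) (cat p' q'))"
proof (rule lmap_eqI[of "\<lambda>p. tensor_mul a b (tens p p') (tens q q')"]; (intro lmap_intros)?)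
  fix u
  show "tensor_mul a b (tens (gen u) p') (tens q q') = smul (sg (m * n)) (tens (cat (gen u) q) (cat p' q'))"
  proof (rule lmap_eq_onI[OF p, of "\<lambda>p'. tensor_mul a b (tens (gen u) p') (tens q q')"]; (intro lmap_intros)?)
    fix v assume v: "v \<in> wset S b m"
    show "tensor_mul a b (tens (gen u) (gen v)) (tens q q') = smul (sg (m * n)) (tens (cat (gen u) q) (cat (gen v) q'))"
    proof (rule lmap_eq_onI[OF q, of "\<lambda>q. tensor_mul a b (tens (gen u) (gen v)) (tens q q')"]; (intro lmap_intros)?)
      fix x assume x: "x \<in> wset T a n"
      show "tensor_mul a b (tens (gen u) (gen v)) (tens (gen x) q') = smul (sg (m * n)) (tens (cat (gen u) (gen x)) (cat (gen v) q'))"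
        by (rule lmap_eqI[of "\<lambda>q'. tensor_mul a b (tens (gen u) (gen v)) (tens (gen x) q')"]; (intro lmap_intros)?)
          (use v x in \<open>simp add: wset_def\<close>)
    qed
  qed
qed

lemma tmul_tens:
  assumes q: "q \<in> fsupp (wset S a n)"
  shows "tensor_mul a b (tens p (gen v)) (tens q (gen v')) = smul (sg (wdeg b v * n)) (tens (cat p q) (gen (v @ v')))"
  using tmul_tens_tens[OF _ q, of "gen v" UNIV b "wdeg b v" p "gen v'"] by (simp add: wset_def)

lemma fsupp_WS_lists: "p \<in> fsupp (WS S dg c m l) \<Longrightarrow> p \<in> fsupp (lists S)"
  by (erule subsetD[OF fsupp_mono, rotated]) (auto simp: WS_def)

lemma fsupp_wset_lists: "x \<in> fsupp (wset S dg n) \<Longrightarrow> x \<in> fsupp (lists S)"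
  by (erule subsetD[OF fsupp_mono, rotated]) (auto simp: wset_def)

section \<open>Coinvariants of a tensor bialgebra\<close>

text \<open>What is needed of \<Omega>C and \<psi>, with the letters \<open>s^-1 c\<close> as
  alphabet. Degree at least 2 for letters leaves degree at least 1 both for the barred letters of
  the path algebra and for the desuspensions of nonempty words.\<close>

locale tensor_bialgebra =
  fixes S :: "'b set" and dg :: "'b \<Rightarrow> nat" and D :: "'b \<Rightarrow> ('b list \<Rightarrow>\<^sub>0 'r::comm_ring_1)"
    and \<psi> :: "'b list \<Rightarrow> ('b list \<times> 'b list \<Rightarrow>\<^sub>0 'r)"
  assumes dg: "c \<in> S \<Longrightarrow> 2 \<le> dg c"
    and D_mem: "c \<in> S \<Longrightarrow> D c \<in> fsupp (WS S dg 1 (dg c) 1)"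
    and DD: "w \<in> lists S \<Longrightarrow> der dg D (der dg D (gen w)) = 0"
    and \<psi>_Nil: "\<psi> [] = gen ([], [])"
    and \<psi>_append: "u \<in> lists S \<Longrightarrow> v \<in> lists S \<Longrightarrow> \<psi> (u @ v) = tensor_mul dg dg (\<psi> u) (\<psi> v)"
    and \<psi>_mem: "w \<in> lists S \<Longrightarrow>
      \<psi> w \<in> fsupp {(u, v). u \<in> lists S \<and> v \<in> lists S \<and> wdeg dg u + wdeg dg v = wdeg dg w}"
    and coassoc: "w \<in> lists S \<Longrightarrow> lin (\<lambda>(u, v). lin (\<lambda>(a, b). gen (a, b, v)) (\<psi> u)) (\<psi> w)
      = lin (\<lambda>(u, v). lin (\<lambda>(a, b). gen (u, a, b)) (\<psi> v)) (\<psi> w)"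
    and counitR: "w \<in> lists S \<Longrightarrow> lin (\<lambda>(u, v). if v = [] then gen u else 0) (\<psi> w) = gen w"
    and counitL: "w \<in> lists S \<Longrightarrow> lin (\<lambda>(u, v). if u = [] then gen v else 0) (\<psi> w) = gen w"
    and \<psi>_chain: "w \<in> lists S \<Longrightarrow> lin \<psi> (der dg D (gen w)) =
      lin (\<lambda>(u, v). tens (der dg D (gen u)) (gen v) + smul (sg (wdeg dg u)) (tens (gen u) (der dg D (gen v)))) (\<psi> w)"
begin

section \<open>The path algebra: letters \<open>Inl c\<close>, barred letters
  \<open>Inr c\<close>\<close>

abbreviation inl :: "'b list \<Rightarrow> (('b + 'b) list \<Rightarrow>\<^sub>0 'r)" where "inl w \<equiv> gen (map Inl w)"

definition lam :: "'b list \<Rightarrow> (('b + 'b) list \<Rightarrow>\<^sub>0 'r)" where "lam = wder dg Inl (\<lambda>c. gen [Inr c])"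

definition edg :: "'b + 'b \<Rightarrow> nat" where "edg = case_sum dg (\<lambda>c. dg c - 1)"

text \<open>The summand \<open>gen [Inr c]\<close> comes from the term \<open>- bar c\<close> in the
  differential of \<open>c\<close>, with the sign of desuspension. The value on \<open>Inr c\<close>
  is then forced by the rule that \<open>dE\<close> and \<open>lam\<close> anticommute up to
  \<open>dA\<close>.\<close>

definition ED :: "'b + 'b \<Rightarrow> (('b + 'b) list \<Rightarrow>\<^sub>0 'r)" where
  "ED = case_sum (\<lambda>c. lin inl (D c) + gen [Inr c]) (\<lambda>c. - lin lam (D c))"

abbreviation "dA \<equiv> der dg D"
abbreviation "dE \<equiv> der edg ED"
abbreviation "SE \<equiv> S <+> S"

lemma ED_simps [simp]: "ED (Inl c) = lin inl (D c) + gen [Inr c]" "ED (Inr c) = - lin lam (D c)"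
  by (simp_all add: ED_def)

lemma edg_simps [simp]: "edg (Inl c) = dg c" "edg (Inr c) = dg c - 1"
  by (simp_all add: edg_def)

lemma wdeg_edg [simp]: "wdeg edg (map Inl w) = wdeg dg w"
  by (induction w) auto

lemma lam_simps [simp]: "lam [] = 0" "lam (x # w) = cat (gen [Inr x]) (inl w) + smul (sg (dg x)) (cat (gen [Inl x]) (lam w))"
  by (simp_all add: lam_def)

lemma lam_append: "lam (u @ v) = cat (lam u) (inl v) + smul (sg (wdeg dg u)) (cat (inl u) (lam v))"
  unfolding lam_def by (rule wder_append)

lemma lin_inl_cat: "lin inl (cat p q) = cat (lin inl p) (lin inl q)"
  by (rule bilin_eqI; (intro lmap_intros)?; simp)

lemma lin_lam_cat:
  assumes a: "a \<in> fsupp (wset S dg m)"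
  shows "lin lam (cat a b) = cat (lin lam a) (lin inl b) + smul (sg m) (cat (lin inl a) (lin lam b))"
  unfolding lam_def by (rule lin_wder_cat[OF a])

lemma SE_mem [simp]: "Inl c \<in> SE \<longleftrightarrow> c \<in> S" "Inr c \<in> SE \<longleftrightarrow> c \<in> S"
  by auto

lemma set_inl [simp]: "Inl ` X \<subseteq> SE \<longleftrightarrow> X \<subseteq> S" by auto

lemma lam_WS: "set w \<subseteq> S \<Longrightarrow> lam w \<in> fsupp (WS SE edg 1 (wdeg dg w) (length w))"
proof (induction w)
  case (Cons x w)
  have "cat (gen [Inr x]) (inl w) \<in> fsupp (WS SE edg 1 (wdeg dg (x # w)) (length (x # w)))"
    using Cons(2) dg[of x] by (cases "dg x") (auto simp: WS_def)
  moreover have "cat (gen [Inl x]) (lam w) \<in> fsupp (WS SE edg 1 (wdeg dg (x # w)) (length (x # w)))"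
    by (rule cat_WS[OF gen_WS Cons.IH]) (use Cons in auto)
  ultimately show ?case by (simp only: lam_simps add_in_fsupp smul_in_fsupp)
qed simp

lemma sg_pred: "c \<in> S \<Longrightarrow> sg (dg c - Suc 0) = (- sg (dg c) :: 'r)"
  using dg[of c] by (cases "dg c") auto

lemma D_wset: "c \<in> S \<Longrightarrow> D c \<in> fsupp (wset S dg (dg c - 1))"
  by (rule subsetD[OF fsupp_mono D_mem]) (auto simp: WS_def wset_def)

lemma gen1_wset: "c \<in> S \<Longrightarrow> gen [c] \<in> fsupp (wset S dg (dg c))" by (simp add: wset_def)

lemma gen1_wsetE: "c \<in> SE \<Longrightarrow> gen [c] \<in> fsupp (wset SE edg (edg c))" by (simp add: wset_def)

lemma dA_WS: "set w \<subseteq> S \<Longrightarrow> dA (gen w) \<in> fsupp (WS S dg 1 (wdeg dg w) (length w + 0))"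
  by (rule der_WS) (use D_mem in auto)

lemma dA_lists: "x \<in> fsupp (lists S) \<Longrightarrow> dA x \<in> fsupp (lists S)"
  by (erule lmap_mem[OF lmap_der']) (auto intro: fsupp_WS_lists dA_WS)

lemma dE_inl: "dE (inl w) = lin inl (dA (gen w)) + lam w"
proof (induction w)
  case (Cons x w)
  then show ?case by (simp add: lin_inl_cat pm.scale_right_distrib algebra_simps)
qed simp

lemma dE_lin_inl: "dE (lin inl p) = lin inl (dA p) + lin lam p"
  by (rule lmap_eqI[of "\<lambda>p. dE (lin inl p)"]; (intro lmap_intros)?; simp add: dE_inl)

lemma inl_wset: "p \<in> fsupp (wset S dg n) \<Longrightarrow> lin inl p \<in> fsupp (wset SE edg n)"
  by (erule lin_mem_on) (auto simp: wset_def)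

lemma dE_lam: "w \<in> lists S \<Longrightarrow> dE (lam w) = - lin lam (dA (gen w))"
proof (induction w)
  case (Cons x w)
  have x: "x \<in> S" using Cons by auto
  have "dE (lam (x # w)) = cat (- lin lam (D x)) (inl w) - smul (sg (dg x)) (cat (gen [Inr x]) (lin inl (dA (gen w)) + lam w))
     + smul (sg (dg x)) (cat (lin inl (D x) + gen [Inr x]) (lam w)) + cat (gen [Inl x]) (dE (lam w))"
    using x sg_pred[OF x]
    by (simp add: der_cat[OF gen1_wsetE] dE_inl lam_simps del: cat_gen list.map)
       (simp add: der_cat[of "gen [Inr x]" SE edg "dg x - 1"] der_cat[of "gen [Inl x]" SE edg "dg x"]
         wset_def dE_inl algebra_simps pm.scale_right_distrib del: cat_gen list.map)
  also have "\<dots> = - lin lam (dA (gen (x # w)))"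
    using Cons sg_pred[OF x]
    by (simp add: lin_lam_cat[OF D_wset] lin_lam_cat[OF gen1_wset] algebra_simps pm.scale_right_distrib)
  finally show ?case .
qed simp

lemma dE_lin_lam: "p \<in> fsupp (lists S) \<Longrightarrow> dE (lin lam p) = - lin lam (dA p)"
  by (erule lmap_eq_onI[of _ _ "\<lambda>p. dE (lin lam p)"]; (intro lmap_intros)?; simp add: dE_lam)

lemma ED_wset: "c \<in> SE \<Longrightarrow> ED c \<in> fsupp (wset SE edg (edg c - 1))"
proof -
  have "lin lam (D c) \<in> fsupp (wset SE edg (dg c - 1 - 1))" if c: "c \<in> S" for c
  proof (rule lin_mem_on[OF D_mem[OF c]])
    fix w assume "w \<in> WS S dg 1 (dg c) 1"
    then show "lam w \<in> fsupp (wset SE edg (dg c - 1 - 1))"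
      using subsetD[OF fsupp_mono lam_WS[of w], of "wset SE edg (dg c - 1 - 1)"] by (fastforce simp: WS_def wset_def)
  qed simp
  moreover have "gen [Inr c] \<in> (fsupp (wset SE edg (dg c - 1)) :: (_ \<Rightarrow>\<^sub>0 'r) set)" if "c \<in> S" for c
    using that by (simp add: wset_def)
  ultimately show "c \<in> SE \<Longrightarrow> ED c \<in> fsupp (wset SE edg (edg c - 1))"
    using inl_wset[OF D_wset] by (cases c) auto
qed

lemma edg_pos: "c \<in> SE \<Longrightarrow> 1 \<le> edg c"
  using dg by (cases c) force+

lemma dE_square: "w \<in> lists SE \<Longrightarrow> dE (dE (gen w)) = 0"
proof (rule der_square[OF ED_wset edg_pos])
  fix c assume c: "c \<in> SE"
  have D: "dA (D e) = 0" "D e \<in> fsupp (lists S)" if "e \<in> S" for e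
    using DD[of "[e]"] that subsetD[OF fsupp_mono[OF wset_lists[THEN subsetI]] D_wset[OF that]] by auto
  show "dE (ED c) = 0"
  proof (cases c)
    case (Inl e)
    then show ?thesis using D[of e] c by (simp add: dE_lin_inl)
  next
    case (Inr e)
    then show ?thesis using D[of e] c by (simp add: dE_lin_lam)
  qed
qed

section \<open>Convolution and the twisting cochain \<tau>\<close>

lemma coassoc_eval:
  assumes "w \<in> lists S"
  shows "lin (\<lambda>(u, v). lin (\<lambda>(a, b). F a b v) (\<psi> u)) (\<psi> w) = lin (\<lambda>(u, v). lin (\<lambda>(a, b). F u a b) (\<psi> v)) (\<psi> w)"
  using arg_cong[OF coassoc[OF assms], of "lin (\<lambda>(a, b, c). F a b c)"]
  by (simp add: lin_lin case_prod_unfold)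

lemma \<psi>_keys: "w \<in> lists S \<Longrightarrow> (u, v) \<in> Poly_Mapping.keys (\<psi> w) \<Longrightarrow>
    u \<in> lists S \<and> v \<in> lists S \<and> wdeg dg u + wdeg dg v = wdeg dg w"
  using fsuppD[OF \<psi>_mem] by blast

lemma wdeg_pos: "w \<in> lists S \<Longrightarrow> w \<noteq> [] \<Longrightarrow> 2 \<le> wdeg dg w"
proof (induction w)
  case (Cons x w)
  then show ?case using dg[of x] by simp
qed simp

text \<open>Right convolution with \<open>g\<close> is the identity up to terms in which \<open>f\<close> is evaluated in lower degree.\<close>

lemma conv_cancel:
  assumes g: "g [] = e" "\<And>x. m x e = x"
    and eq: "\<And>w. w \<in> lists S \<Longrightarrow> lin (\<lambda>(u, v). m (f u) (g v)) (\<psi> w) = lin (\<lambda>(u, v). m (f' u) (g v)) (\<psi> w)"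
    and w: "w \<in> lists S"
  shows "f w = f' w"
  using w
proof (induction "wdeg dg w" arbitrary: w rule: less_induct)
  case less
  have counit: "f w = lin (\<lambda>(u, v). if v = [] then f u else 0) (\<psi> w)" for f :: "'b list \<Rightarrow> 'c \<Rightarrow>\<^sub>0 'r"
    using arg_cong[OF counitR[OF less(2)], of "lin f"] by (simp add: lin_lin case_prod_unfold if_distrib cong: if_cong)
  have "lin (\<lambda>(u, v). m (f u) (g v) - (if v = [] then f u else 0)) (\<psi> w)
    = lin (\<lambda>(u, v). m (f' u) (g v) - (if v = [] then f' u else 0)) (\<psi> w)"
  proof (rule lin_cong[OF refl], clarify)
    fix u v assume uv: "(u, v) \<in> Poly_Mapping.keys (\<psi> w)"
    note k = \<psi>_keys[OF less(2) uv]
    show "m (f u) (g v) - (if v = [] then f u else 0) = m (f' u) (g v) - (if v = [] then f' u else 0)"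
    proof (cases "v = []")
      case False
      then have "f u = f' u" using k wdeg_pos[of v] by (intro less(1)) auto
      then show ?thesis using False by simp
    qed (simp add: g)
  qed
  then have "lin (\<lambda>(u, v). m (f u) (g v)) (\<psi> w) - f w = lin (\<lambda>(u, v). m (f' u) (g v)) (\<psi> w) - f' w"
    unfolding counit[of f] counit[of f'] by (simp add: lin_diff_fun[symmetric] case_prod_unfold)
  then show ?case using eq[OF less(2)] by simp
qed

text \<open>The solution of \<open>\<tau> * \<iota> = \<lambda>\<close>; the guard selects the terms \<open>u \<otimes> v\<close> of \<open>\<psi>(w)\<close> with \<open>v \<noteq> 1\<close>.\<close>

function \<tau> :: "'b list \<Rightarrow> (('b + 'b) list \<Rightarrow>\<^sub>0 'r)" where
  "\<tau> w = lam w - lin (\<lambda>(u, v). if wdeg dg u < wdeg dg w then cat (\<tau> u) (inl v) else 0) (\<psi> w)"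
  by pat_completeness auto
termination by (relation "measure (wdeg dg)") auto

declare \<tau>.simps [simp del]

lemma \<tau>_Nil [simp]: "\<tau> [] = 0"
  by (simp add: \<tau>.simps[of "[]"] \<psi>_Nil)

lemma \<tau>_conv: "w \<in> lists S \<Longrightarrow> lin (\<lambda>(u, v). cat (\<tau> u) (inl v)) (\<psi> w) = lam w"
proof -
  assume w: "w \<in> lists S"
  have "\<tau> w = lin (\<lambda>(u, v). if v = [] then \<tau> u else 0) (\<psi> w)"
    using arg_cong[OF counitR[OF w], of "lin \<tau>"] by (simp add: lin_lin case_prod_unfold if_distrib cong: if_cong)
  \<comment> \<open>For degree reasons the guard in the recursion fails exactly when
    \<open>v\<close> is empty. Those terms add up to \<open>\<tau> w\<close> by the right counit
    identity.\<close>
  have "lin (\<lambda>(u, v). cat (\<tau> u) (inl v)) (\<psi> w) = lin (\<lambda>(u, v). (if v = [] then \<tau> u else 0) +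
    (if wdeg dg u < wdeg dg w then cat (\<tau> u) (inl v) else 0)) (\<psi> w)"
  proof (rule lin_cong[OF refl], clarify)
    fix u v assume uv: "(u, v) \<in> Poly_Mapping.keys (\<psi> w)"
    note k = \<psi>_keys[OF w uv]
    show "cat (\<tau> u) (inl v) = (if v = [] then \<tau> u else 0) + (if wdeg dg u < wdeg dg w then cat (\<tau> u) (inl v) else 0)"
      using k wdeg_pos[of v] by (cases "v = []") auto
  qed
  also have "\<dots> = lin (\<lambda>(u, v). if v = [] then \<tau> u else 0) (\<psi> w) +
      lin (\<lambda>(u, v). if wdeg dg u < wdeg dg w then cat (\<tau> u) (inl v) else 0) (\<psi> w)"
    by (simp add: lin_add_fun case_prod_unfold)
  also have "\<dots> = \<tau> w + lin (\<lambda>(u, v). if wdeg dg u < wdeg dg w then cat (\<tau> u) (inl v) else 0) (\<psi> w)"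
    by (simp only: \<open>\<tau> w = _\<close>)
  also have "\<dots> = lam w"
    by (subst \<tau>.simps[of w]) simp
  finally show ?thesis .
qed

text \<open>The map \<open>(1 \<otimes> \<Omega>\<pi>)\<close> after the comultiplication of the
  path algebra, prescribed on letters. On a barred letter only \<open>lam\<close> in the left factor
  is left, since \<Omega>\<pi> kills barred letters in the right one.\<close>

definition rho :: "(('b + 'b) list \<Rightarrow>\<^sub>0 'r) \<Rightarrow> (('b + 'b) list \<times> 'b list \<Rightarrow>\<^sub>0 'r)" where
  "rho = alg_ext (tensor_mul edg dg) (gen ([], [])) (case_sum
     (\<lambda>c. lin (\<lambda>(u, v). tens (inl u) (gen v)) (\<psi> [c])) (\<lambda>c. lin (\<lambda>(u, v). tens (lam u) (gen v)) (\<psi> [c])))"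

lemma lmap_rho [simp]: "lmap rho" "lmap f \<Longrightarrow> lmap (\<lambda>x. rho (f x))"
proof -
  show "lmap rho" unfolding rho_def by (rule lmap_alg_ext)
  show "lmap f \<Longrightarrow> lmap (\<lambda>x. rho (f x))" unfolding rho_def by (rule lmap_alg_ext')
qed

lemma rho_cat: "rho (cat p q) = tensor_mul edg dg (rho p) (rho q)"
  unfolding rho_def by (rule alg_ext_cat) (auto simp: tmul_assoc)

lemma rho_letters: "rho (gen [Inl c]) = lin (\<lambda>(u, v). tens (inl u) (gen v)) (\<psi> [c])"
  "rho (gen [Inr c]) = lin (\<lambda>(u, v). tens (lam u) (gen v)) (\<psi> [c])" "rho (gen []) = gen ([], [])"
  by (simp_all add: rho_def alg_ext_Cons)

abbreviation "J \<equiv> lin (\<lambda>(u, v). tens (inl u) (gen v))"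
abbreviation "L \<equiv> lin (\<lambda>(u, v). tens (lam u) (gen v))"

lemma J_mul: "J (tensor_mul dg dg p q) = tensor_mul edg dg (J p) (J q)"
  by (rule bilin_eqI; (intro lmap_intros)?; clarsimp)

lemma lam_wset: "u \<in> lists S \<Longrightarrow> lam u \<in> fsupp (wset SE edg (wdeg dg u - 1))"
  by (rule subsetD[OF fsupp_mono lam_WS[of u]]) (auto simp: WS_def wset_def)

lemma sg_mult_pred: "u \<in> lists S \<Longrightarrow> u \<noteq> [] \<Longrightarrow> sg (k * (wdeg dg u - 1)) = (sg (k * wdeg dg u) * sg k :: 'r)"
  using wdeg_pos[of u] by (cases "wdeg dg u") (auto simp: mult_ac)

text \<open>\<open>L\<close> is to \<open>J\<close> as \<open>lam\<close> is to \<open>inl\<close>: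
  a derivation along an algebra map. This is what carries the formula for \<open>rho\<close> from
  barred letters to all values of \<open>lam\<close>.\<close>

lemma L_mul:
  assumes p: "p \<in> fsupp {(u, v). wdeg dg u + wdeg dg v = m}" and q: "q \<in> fsupp {(u, v). u \<in> lists S}"
  shows "L (tensor_mul dg dg p q) = tensor_mul edg dg (L p) (J q) + smul (sg m) (tensor_mul edg dg (J p) (L q))"
proof (rule lmap_eq_onI[OF p, of "\<lambda>p. L (tensor_mul dg dg p q)"]; (intro lmap_intros)?)
  fix x assume "x \<in> {(u, v). wdeg dg u + wdeg dg v = m}"
  then obtain u v where x: "x = (u, v)" and m: "m = wdeg dg u + wdeg dg v" by blast
  show "L (tensor_mul dg dg (gen x) q) = tensor_mul edg dg (L (gen x)) (J q) + smul (sg m) (tensor_mul edg dg (J (gen x)) (L q))"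
    unfolding x m
  proof (rule lmap_eq_onI[OF q, of "\<lambda>q. L (tensor_mul dg dg (gen (u, v)) q)"]; (intro lmap_intros)?)
    fix y assume "y \<in> {(u, v :: 'b list). u \<in> lists S}"
    then obtain u' v' where y: "y = (u', v')" and u': "u' \<in> lists S" by blast
    have 1: "tensor_mul edg dg (tens (lam u) (gen v)) (tens (inl u') (gen v'))
      = smul (sg (wdeg dg v * wdeg dg u')) (tens (cat (lam u) (inl u')) (gen (v @ v')))"
      by (rule tmul_tens[of _ UNIV]) (simp add: wset_def)
    have 2: "tensor_mul edg dg (tens (inl u) (gen v)) (tens (lam u') (gen v'))
      = smul (sg (wdeg dg v * (wdeg dg u' - 1))) (tens (cat (inl u) (lam u')) (gen (v @ v')))"
      by (rule tmul_tens[OF lam_wset[OF u']])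
    show "L (tensor_mul dg dg (gen (u, v)) (gen y)) = tensor_mul edg dg (L (gen (u, v))) (J (gen y))
      + smul (sg (wdeg dg u + wdeg dg v)) (tensor_mul edg dg (J (gen (u, v))) (L (gen y)))"
    \<comment> \<open>For the empty word \<open>wdeg dg u' - 1\<close> is truncated and the sign
      formula fails, but there \<open>lam u'\<close> is 0.\<close>
    proof (cases "u' = []")
      case False
      then show ?thesis unfolding y tmul_gen lin_smul lin_gen prod.case 1 2 lam_append
        using sg_mult_pred[OF u', of "wdeg dg v"] by (simp add: pm.scale_right_distrib mult_ac)
    next
      case True
      then show ?thesis unfolding y tmul_gen lin_smul lin_gen prod.case 1 2 lam_append by simp
    qed
  qed
qed

lemma rho_inl: "w \<in> lists S \<Longrightarrow> rho (inl w) = J (\<psi> w)"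
proof (induction w)
  case (Cons x w)
  have "rho (inl (x # w)) = tensor_mul edg dg (rho (gen [Inl x])) (rho (inl w))"
    using rho_cat[of "gen [Inl x]" "inl w"] by simp
  also have "\<dots> = J (tensor_mul dg dg (\<psi> [x]) (\<psi> w))"
    using Cons by (simp add: J_mul rho_letters del: tens_gen)
  also have "\<dots> = J (\<psi> (x # w))" using \<psi>_append[of "[x]" w] Cons by simp
  finally show ?case .
qed (simp add: rho_letters \<psi>_Nil)

lemma rho_lam: "w \<in> lists S \<Longrightarrow> rho (lam w) = L (\<psi> w)"
proof (induction w)
  case (Cons x w)
  have m: "\<psi> [x] \<in> fsupp {(u, v). wdeg dg u + wdeg dg v = dg x}" "\<psi> w \<in> fsupp {(u, v). u \<in> lists S}"
    using Cons by (auto intro: subsetD[OF fsupp_mono \<psi>_mem[of "[x]"]] subsetD[OF fsupp_mono \<psi>_mem[of w]])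
  have "rho (lam (x # w)) = tensor_mul edg dg (rho (gen [Inr x])) (rho (inl w))
     + smul (sg (dg x)) (tensor_mul edg dg (rho (gen [Inl x])) (rho (lam w)))"
    by (simp only: lam_simps rho_cat lmap_add[OF lmap_rho(1)] lmap_smul[OF lmap_rho(1)])
  also have "\<dots> = L (tensor_mul dg dg (\<psi> [x]) (\<psi> w))"
    using Cons by (simp add: L_mul[OF m] rho_letters rho_inl)
  also have "\<dots> = L (\<psi> (x # w))" using \<psi>_append[of "[x]" w] Cons by simp
  finally show ?case .
qed (simp add: lmap_zero \<psi>_Nil)

text \<open>Both sides have the same convolution with \<open>J\<close> after \<psi>. On the left,
  multiplicativity of \<open>rho\<close> gives \<open>rho\<close> of \<tau> convolved with
  \<open>inl\<close>, that is \<open>rho\<close> of \<open>lam\<close>, which is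
  \<open>(lam \<otimes> 1)\<psi>\<close>; expanding \<open>lam\<close> again and reassociating gives
  the right side.\<close>

lemma rho_\<tau>: "w \<in> lists S \<Longrightarrow> rho (\<tau> w) = tens (\<tau> w) (gen [])"
proof (erule conv_cancel[of "\<lambda>w. J (\<psi> w)" "gen ([], [])" "tensor_mul edg dg" "\<lambda>w. rho (\<tau> w)" "\<lambda>w. tens (\<tau> w) (gen [])", rotated -1])
  fix w assume w: "w \<in> lists S"
  have "lin (\<lambda>(u, v). tensor_mul edg dg (rho (\<tau> u)) (J (\<psi> v))) (\<psi> w)
    = lin (\<lambda>(u, v). rho (cat (\<tau> u) (inl v))) (\<psi> w)"
    by (rule lin_cong[OF refl]) (use \<psi>_keys[OF w] in \<open>auto simp: rho_cat rho_inl\<close>)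
  also have "\<dots> = rho (lin (\<lambda>(u, v). cat (\<tau> u) (inl v)) (\<psi> w))"
    by (simp add: lmap_comp_lin[of rho] case_prod_unfold)
  also have "\<dots> = lin (\<lambda>(u, v). lin (\<lambda>(a, b). tens (cat (\<tau> a) (inl b)) (gen v)) (\<psi> u)) (\<psi> w)"
    unfolding \<tau>_conv[OF w] rho_lam[OF w]
  proof (rule lin_cong[OF refl], clarify)
    fix u v assume "(u, v) \<in> Poly_Mapping.keys (\<psi> w)"
    then have u: "u \<in> lists S" using \<psi>_keys[OF w] by blast
    show "tens (lam u) (gen v) = lin (\<lambda>(a, b). tens (cat (\<tau> a) (inl b)) (gen v)) (\<psi> u)"
      unfolding \<tau>_conv[OF u, symmetric]
      by (subst lmap_comp_lin[of "\<lambda>x. tens x (gen v)"]) (auto simp: case_prod_unfold)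
  qed
  also have "\<dots> = lin (\<lambda>(u, v). lin (\<lambda>(a, b). tens (cat (\<tau> u) (inl a)) (gen b)) (\<psi> v)) (\<psi> w)"
    by (rule coassoc_eval[OF w])
  also have "\<dots> = lin (\<lambda>(u, v). tensor_mul edg dg (tens (\<tau> u) (gen [])) (J (\<psi> v))) (\<psi> w)"
  proof (rule lin_cong[OF refl], clarify)
    fix u v
    have "tensor_mul edg dg (tens (\<tau> u) (gen [])) (tens (inl a) (gen b)) = tens (cat (\<tau> u) (inl a)) (gen b)" for a b
      using tmul_tens[of "inl a" UNIV edg "wdeg dg a" dg "\<tau> u" "[]" b] by (simp add: wset_def)
    then show "lin (\<lambda>(a, b). tens (cat (\<tau> u) (inl a)) (gen b)) (\<psi> v) = tensor_mul edg dg (tens (\<tau> u) (gen [])) (J (\<psi> v))"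
      by (subst lmap_comp_lin[of "tensor_mul edg dg (tens (\<tau> u) (gen []))"]) (auto simp: case_prod_unfold)
  qed
  finally show "lin (\<lambda>(u, v). tensor_mul edg dg (rho (\<tau> u)) (J (\<psi> v))) (\<psi> w)
    = lin (\<lambda>(u, v). tensor_mul edg dg (tens (\<tau> u) (gen [])) (J (\<psi> v))) (\<psi> w)" .
qed (simp_all add: \<psi>_Nil)

fun nI :: "('b + 'b) list \<Rightarrow> nat" where
  "nI [] = 0"
| "nI (Inl c # y) = nI y"
| "nI (Inr c # y) = Suc (nI y)"

lemma nI_append [simp]: "nI (x @ y) = nI x + nI y"
  by (induction x rule: nI.induct) auto

lemma nI_inl [simp]: "nI (map Inl w) = 0"
  by (induction w) auto

text \<open>The index is one more than the degree, so that the values of \<open>\<tau>\<close> on words of degree \<open>n\<close> lie in \<open>O1 n\<close>.\<close>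

definition O1 :: "nat \<Rightarrow> ('b + 'b) list set" where
  "O1 n = {y \<in> lists SE. wdeg edg y + 1 = n \<and> nI y = 1}"

lemma lam_O1: "w \<in> lists S \<Longrightarrow> lam w \<in> fsupp (O1 (wdeg dg w))"
proof (induction w)
  case (Cons x w)
  have "cat (gen [Inr x]) (inl w) \<in> fsupp (O1 (wdeg dg (x # w)))"
    using Cons(2) dg[of x] by (cases "dg x") (auto simp: O1_def)
  moreover have "cat (gen [Inl x]) (lam w) \<in> fsupp (O1 (wdeg dg (x # w)))"
    by (rule cat_fsupp[of _ "{[Inl x]}", OF _ Cons.IH]) (use Cons in \<open>auto simp: O1_def\<close>)
  ultimately show ?case by (simp only: lam_simps add_in_fsupp smul_in_fsupp)
qed simp

lemma \<tau>_O1: "w \<in> lists S \<Longrightarrow> \<tau> w \<in> fsupp (O1 (wdeg dg w))"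
proof (induction "wdeg dg w" arbitrary: w rule: less_induct)
  case less
  have "lin (\<lambda>(u, v). if wdeg dg u < wdeg dg w then cat (\<tau> u) (inl v) else 0) (\<psi> w) \<in> fsupp (O1 (wdeg dg w))"
  proof (rule lin_mem[OF subspace_fsupp], clarsimp)
    fix u v assume uv: "(u, v) \<in> Poly_Mapping.keys (\<psi> w)" "wdeg dg u < wdeg dg w"
    note k = \<psi>_keys[OF less(2) uv(1)]
    show "cat (\<tau> u) (inl v) \<in> fsupp (O1 (wdeg dg w))"
      by (rule cat_fsupp[OF less(1)[of u], where T = "{map Inl v}"]) (use uv k in \<open>auto simp: O1_def\<close>)
  qed
  then show ?case using lam_O1[OF less(2)] by (subst \<tau>.simps) (rule diff_in_fsupp)
qed

lemma O1_wset: "O1 n \<subseteq> wset SE edg (n - 1)"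
  by (auto simp: O1_def wset_def)

lemma \<tau>_wset: "w \<in> lists S \<Longrightarrow> \<tau> w \<in> fsupp (wset SE edg (wdeg dg w - 1))"
  using fsupp_mono[OF O1_wset] \<tau>_O1 by blast

lemma dE_\<tau>_cat:
  assumes w: "w \<in> lists S"
  shows "dE (cat (\<tau> w) y) = cat (dE (\<tau> w)) y - smul (sg (wdeg dg w)) (cat (\<tau> w) (dE y))"
proof (cases "w = []")
  case False
  then have "sg (wdeg dg w - 1) = (- sg (wdeg dg w) :: 'r)" using wdeg_pos[OF w] by (cases "wdeg dg w") auto
  then show ?thesis by (simp add: der_cat[OF \<tau>_wset[OF w]])
qed simp

text \<open>Differentiate the convolution equation for \<tau> and cancel \<open>inl\<close>. The
  quadratic term originates in the extra summand \<open>lam\<close> of \<open>dE\<close> on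
  \<open>inl\<close>, which is itself expanded as a convolution with \<tau>.\<close>

lemma dE_\<tau>:
  assumes "w \<in> lists S"
  shows "dE (\<tau> w) = - lin \<tau> (dA (gen w)) + lin (\<lambda>(u, v). smul (sg (wdeg dg u)) (cat (\<tau> u) (\<tau> v))) (\<psi> w)"
proof (rule conv_cancel[of inl "gen []" cat "\<lambda>w. dE (\<tau> w)" "\<lambda>w. - lin \<tau> (dA (gen w)) + lin (\<lambda>(u, v). smul (sg (wdeg dg u)) (cat (\<tau> u) (\<tau> v))) (\<psi> w)",
      OF _ _ _ assms])
  fix w assume w: "w \<in> lists S"
  have tau: "lin (\<lambda>(u, v). cat (\<tau> u) (inl v)) (lin \<psi> p) = lin lam p" if "p \<in> fsupp (lists S)" for p
    by (rule lmap_eq_onI[OF that, of "\<lambda>p. lin (\<lambda>(u, v). cat (\<tau> u) (inl v)) (lin \<psi> p)"]; (intro lmap_intros)?)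
      (simp add: \<tau>_conv)
  have "- lin lam (dA (gen w)) = dE (lin (\<lambda>(u, v). cat (\<tau> u) (inl v)) (\<psi> w))"
    by (simp add: \<tau>_conv[OF w] dE_lam[OF w])
  also have "\<dots> = lin (\<lambda>(u, v). cat (dE (\<tau> u)) (inl v) - smul (sg (wdeg dg u)) (cat (\<tau> u) (lin inl (dA (gen v)) + lam v))) (\<psi> w)"
    unfolding lmap_comp_lin[OF lmap_der']
    by (rule lin_cong[OF refl]) (use \<psi>_keys[OF w] in \<open>auto simp: dE_\<tau>_cat dE_inl\<close>)
  also have "\<dots> = lin (\<lambda>(u, v). cat (dE (\<tau> u)) (inl v)) (\<psi> w)
     - lin (\<lambda>(u, v). smul (sg (wdeg dg u)) (cat (\<tau> u) (lin inl (dA (gen v))))) (\<psi> w)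
     - lin (\<lambda>(u, v). smul (sg (wdeg dg u)) (cat (\<tau> u) (lam v))) (\<psi> w)"
    by (simp add: lin_diff_fun lin_add_fun case_prod_unfold pm.scale_right_distrib algebra_simps)
  finally have 1: "lin (\<lambda>(u, v). cat (dE (\<tau> u)) (inl v)) (\<psi> w) = - lin lam (dA (gen w))
     + lin (\<lambda>(u, v). smul (sg (wdeg dg u)) (cat (\<tau> u) (lin inl (dA (gen v))))) (\<psi> w)
     + lin (\<lambda>(u, v). smul (sg (wdeg dg u)) (cat (\<tau> u) (lam v))) (\<psi> w)"
    by (simp add: algebra_simps)
  \<comment> \<open>The convolution equation at \<open>dA w\<close>, with \<psi> of
    \<open>dA w\<close> expanded by the chain map property.\<close>
  have "dA (gen w) \<in> fsupp (lists S)" using w by (intro dA_lists) auto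
  from tau[OF this] have "lin lam (dA (gen w)) = lin (\<lambda>(u, v). cat (lin \<tau> (dA (gen u))) (inl v)
      + smul (sg (wdeg dg u)) (cat (\<tau> u) (lin inl (dA (gen v))))) (\<psi> w)"
    unfolding \<psi>_chain[OF w] lin_lin
    by (simp add: case_prod_unfold lin_tens' lmap_comp_lin[of "\<lambda>x. cat x _"] lmap_comp_lin[of "cat _"])
  then have 2: "lin lam (dA (gen w)) = lin (\<lambda>(u, v). cat (lin \<tau> (dA (gen u))) (inl v)) (\<psi> w)
      + lin (\<lambda>(u, v). smul (sg (wdeg dg u)) (cat (\<tau> u) (lin inl (dA (gen v))))) (\<psi> w)"
    by (simp add: lin_add_fun case_prod_unfold)
  \<comment> \<open>Here \<open>lam v\<close> is expanded through \<tau>, and coassociativity moves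
    both values of \<tau> to the left of a single \<open>inl\<close>.\<close>
  have "lin (\<lambda>(u, v). smul (sg (wdeg dg u)) (cat (\<tau> u) (lam v))) (\<psi> w)
    = lin (\<lambda>(u, v). lin (\<lambda>(a, b). smul (sg (wdeg dg u)) (cat (\<tau> u) (cat (\<tau> a) (inl b)))) (\<psi> v)) (\<psi> w)"
  proof (rule lin_cong[OF refl], clarify)
    fix u v assume "(u, v) \<in> Poly_Mapping.keys (\<psi> w)"
    then have v: "v \<in> lists S" using \<psi>_keys[OF w] by blast
    show "smul (sg (wdeg dg u)) (cat (\<tau> u) (lam v)) = lin (\<lambda>(a, b). smul (sg (wdeg dg u)) (cat (\<tau> u) (cat (\<tau> a) (inl b)))) (\<psi> v)"
      unfolding \<tau>_conv[OF v, symmetric]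
      by (subst lmap_comp_lin[of "cat (\<tau> u)"]) (auto simp: case_prod_unfold lin_smul_fun)
  qed
  also have "\<dots> = lin (\<lambda>(u, v). lin (\<lambda>(a, b). smul (sg (wdeg dg a)) (cat (\<tau> a) (cat (\<tau> b) (inl v)))) (\<psi> u)) (\<psi> w)"
    by (rule coassoc_eval[OF w, symmetric])
  also have "\<dots> = lin (\<lambda>(u, v). cat (lin (\<lambda>(a, b). smul (sg (wdeg dg a)) (cat (\<tau> a) (\<tau> b))) (\<psi> u)) (inl v)) (\<psi> w)"
    by (simp add: lmap_comp_lin[of "\<lambda>x. cat x _"] case_prod_unfold cat_assoc)
  finally have 3: "lin (\<lambda>(u, v). smul (sg (wdeg dg u)) (cat (\<tau> u) (lam v))) (\<psi> w)
    = lin (\<lambda>(u, v). cat (lin (\<lambda>(a, b). smul (sg (wdeg dg a)) (cat (\<tau> a) (\<tau> b))) (\<psi> u)) (inl v)) (\<psi> w)" .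
  show "lin (\<lambda>(u, v). cat (dE (\<tau> u)) (inl v)) (\<psi> w) =
    lin (\<lambda>(u, v). cat (- lin \<tau> (dA (gen u)) + lin (\<lambda>(u, v). smul (sg (wdeg dg u)) (cat (\<tau> u) (\<tau> v))) (\<psi> u)) (inl v)) (\<psi> w)"
    unfolding 1 2 3 by (simp add: lin_add_fun lin_diff_fun lin_uminus_fun case_prod_unfold)
qed simp_all

section \<open>The cobar construction of the bialgebra and its map to the path algebra\<close>

definition NE :: "'b list set" where "NE = lists S - {[]}"

definition adg :: "'b list \<Rightarrow> nat" where "adg w = wdeg dg w - 1"

definition des :: "'b list \<Rightarrow> ('b list list \<Rightarrow>\<^sub>0 'r)" where
  "des w = (if w = [] then 0 else gen [w])"

text \<open>The quadratic part of the cobar differential. The unreduced \<psi> may be used because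
  \<open>des\<close> sends the empty word, the unit, to 0.\<close>

definition QA :: "'b list \<Rightarrow> ('b list list \<Rightarrow>\<^sub>0 'r)" where
  "QA w = lin (\<lambda>(u, v). smul (sg (wdeg dg u)) (cat (des u) (des v))) (\<psi> w)"

definition DA :: "'b list \<Rightarrow> ('b list list \<Rightarrow>\<^sub>0 'r)" where
  "DA w = lt (- dA (gen w)) + QA w"

abbreviation "\<Phi> \<equiv> aext \<tau>"

lemma NE_lists: "w \<in> NE \<Longrightarrow> w \<in> lists S" "w \<in> NE \<Longrightarrow> w \<noteq> []"
  by (auto simp: NE_def)

lemma wdeg_NE: "w \<in> NE \<Longrightarrow> 2 \<le> wdeg dg w"
  using wdeg_pos NE_lists by blast

lemma adg_pos: "w \<in> NE \<Longrightarrow> 1 \<le> adg w"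
  using wdeg_NE by (fastforce simp: adg_def)

lemma \<Phi>_des: "\<Phi> (des w) = \<tau> w"
  by (simp add: des_def alg_ext_Cons)

lemma \<Phi>_DA: "w \<in> lists S \<Longrightarrow> \<Phi> (DA w) = dE (\<tau> w)"
proof -
  assume w: "w \<in> lists S"
  have "\<Phi> (QA w) = lin (\<lambda>(u, v). smul (sg (wdeg dg u)) (cat (\<tau> u) (\<tau> v))) (\<psi> w)"
    unfolding QA_def by (simp add: lmap_comp_lin[of \<Phi>] case_prod_unfold aext_cat \<Phi>_des)
  then show ?thesis by (simp add: DA_def dE_\<tau>[OF w])
qed

lemma \<Phi>_wset: "x \<in> fsupp (wset NE adg n) \<Longrightarrow> \<Phi> x \<in> fsupp (wset SE edg n)"
proof (erule lmap_mem[OF lmap_alg_ext _ subspace_fsupp])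
  fix ws assume "ws \<in> wset NE adg n"
  then have "set ws \<subseteq> NE" and n: "n = wdeg adg ws" by (auto simp: wset_def)
  then show "\<Phi> (gen ws) \<in> fsupp (wset SE edg n)" unfolding n
  proof (induction ws)
    case (Cons w ws)
    show ?case unfolding alg_ext_Cons
      by (rule cat_wset[OF \<tau>_wset]) (use Cons NE_lists in \<open>auto simp: adg_def\<close>)
  qed (simp add: wset_def)
qed

lemma dA_NE: "w \<in> NE \<Longrightarrow> - dA (gen w) \<in> fsupp {y \<in> NE. adg y + 1 = adg w}"
proof (rule uminus_in_fsupp)
  assume w: "w \<in> NE"
  then have "dA (gen w) \<in> fsupp (WS S dg 1 (wdeg dg w) (length w + 0))"
    using NE_lists by (intro dA_WS) auto
  moreover have "WS S dg 1 (wdeg dg w) (length w + 0) \<subseteq> {y \<in> NE. adg y + 1 = adg w}"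
  proof
    fix y assume "y \<in> WS S dg 1 (wdeg dg w) (length w + 0)"
    moreover from this have "y \<in> NE" using NE_lists(2)[OF w] by (auto simp: NE_def WS_def)
    ultimately show "y \<in> {y \<in> NE. adg y + 1 = adg w}"
      using wdeg_NE[of y] by (auto simp: WS_def adg_def)
  qed
  ultimately show "dA (gen w) \<in> fsupp {y \<in> NE. adg y + 1 = adg w}"
    using fsupp_mono by blast
qed

lemma QA_WS: "w \<in> NE \<Longrightarrow> QA w \<in> fsupp (WS NE adg 1 (adg w) 2)"
  unfolding QA_def
proof (rule lin_mem[OF subspace_fsupp], clarify)
  fix u v assume w: "w \<in> NE" and uv: "(u, v) \<in> Poly_Mapping.keys (\<psi> w)"
  note k = \<psi>_keys[OF NE_lists(1)[OF w] uv]
  have "cat (des u) (des v) \<in> fsupp (WS NE adg 1 (adg w) 2)"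
    using k wdeg_pos[of u] wdeg_pos[of v] by (auto simp: des_def WS_def NE_def adg_def)
  then show "smul (sg (wdeg dg u)) (cat (des u) (des v)) \<in> fsupp (WS NE adg 1 (adg w) 2)"
    by (rule smul_in_fsupp)
qed

lemma \<Phi>_chain: "x \<in> fsupp (lists NE) \<Longrightarrow> \<Phi> (der adg DA x) = dE (\<Phi> x)"
proof (erule lmap_eq_onI[of _ _ "\<lambda>x. \<Phi> (der adg DA x)"]; (intro lmap_intros)?)
  fix ws assume "ws \<in> lists NE"
  then show "\<Phi> (der adg DA (gen ws)) = dE (\<Phi> (gen ws))"
  proof (induction ws)
    case (Cons w ws)
    then have w: "w \<in> lists S" "w \<in> NE" using NE_lists by auto
    have "sg (adg w) = (- sg (wdeg dg w) :: 'r)"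
      using wdeg_NE[OF w(2)] by (cases "wdeg dg w") (auto simp: adg_def)
    then show ?case using Cons w by (simp add: aext_cat alg_ext_Cons \<Phi>_DA dE_\<tau>_cat)
  qed simp
qed

lemma rho_\<Phi>: "x \<in> fsupp (lists NE) \<Longrightarrow> rho (\<Phi> x) = tens (\<Phi> x) (gen [])"
proof (erule lmap_eq_onI[of _ _ "\<lambda>x. rho (\<Phi> x)"]; (intro lmap_intros lmap_rho)?)
  fix ws assume "ws \<in> lists NE"
  then show "rho (\<Phi> (gen ws)) = tens (\<Phi> (gen ws)) (gen [])"
  proof (induction ws)
    case (Cons w ws)
    have "gen ws \<in> fsupp (wset NE adg (wdeg adg ws))" using Cons by (auto simp: wset_def)
    from tmul_tens[OF \<Phi>_wset[OF this], of dg "\<tau> w" "[]" "[]"]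
    show ?case using Cons NE_lists by (simp add: alg_ext_Cons rho_cat rho_\<tau>)
  qed (simp add: rho_letters)
qed

text \<open>The weight adds up, over the letters \<open>Inr c\<close> of a word, the degrees of the prefixes ending there.
  The word of \<open>\<tau>(w)\<close> of largest weight is the one that ends in \<open>Inr\<close>.\<close>

fun wt :: "('b + 'b) list \<Rightarrow> nat" where
  "wt [] = 0"
| "wt (Inl c # y) = wt y + dg c * nI y"
| "wt (Inr c # y) = wt y + (dg c - 1) * Suc (nI y)"

lemma wt_append: "wt (x @ y) = wt x + wt y + wdeg edg x * nI y"
  by (induction x rule: wt.induct) (simp_all add: add_mult_distrib add_mult_distrib2)

lemma wt_inl [simp]: "wt (map Inl w) = 0"
  by (induction w) auto


lemma wt_nI: "nI y \<le> 1 \<Longrightarrow> wt y \<le> wdeg edg y * nI y"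
proof (induction y rule: wt.induct)
  case (3 c y)
  then show ?case by (cases "nI y") auto
qed (auto simp: algebra_simps)

section \<open>Leading words\<close>

definition low :: "('b + 'b) list \<Rightarrow> ('b + 'b) list set" where
  "low x = {y \<in> lists SE. wdeg edg y = wdeg edg x \<and> nI y = nI x \<and> wt y < wt x}"

definition lead :: "(('b + 'b) list \<Rightarrow>\<^sub>0 'r) \<Rightarrow> ('b + 'b) list \<Rightarrow> bool" where
  "lead p x \<longleftrightarrow> (\<exists>s. (s = 1 \<or> s = - 1) \<and> p - smul s (gen x) \<in> fsupp (low x))"

lemma lead_gen: "lead (gen x) x"
  unfolding lead_def by (intro exI[of _ 1]) simp

text \<open>The weight of \<open>x @ y\<close> exceeds the sum of the weights by
  \<open>wdeg edg x * nI y\<close>. This is constant on remainders because \<open>low\<close> fixes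
  the degree and the number of barred letters, so lower terms stay lower in a product.\<close>

lemma lead_cat:
  assumes "lead p x" "lead q y" "x \<in> lists SE" "y \<in> lists SE"
  shows "lead (cat p q) (x @ y)"
proof -
  obtain s s' where s: "s = 1 \<or> s = - 1" "p - smul s (gen x) \<in> fsupp (low x)"
    and s': "s' = 1 \<or> s' = - 1" "q - smul s' (gen y) \<in> fsupp (low y)"
    using assms by (auto simp: lead_def)
  have q: "q \<in> fsupp (insert y (low y))"
  proof -
    have "q - smul s' (gen y) \<in> fsupp (insert y (low y))" using s'(2) fsupp_mono[of "low y" "insert y (low y)"] by blast
    moreover have "smul s' (gen y) \<in> fsupp (insert y (low y))" by (rule smul_in_fsupp) simp
    ultimately have "(q - smul s' (gen y)) + smul s' (gen y) \<in> fsupp (insert y (low y))" by (rule add_in_fsupp)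
    then show ?thesis by simp
  qed
  have "cat p q - smul (s * s') (gen (x @ y))
    = cat (p - smul s (gen x)) q + smul s (cat (gen x) (q - smul s' (gen y)))"
    by (simp add: algebra_simps pm.scale_right_diff_distrib)
  moreover have "cat (p - smul s (gen x)) q \<in> fsupp (low (x @ y))"
    by (rule cat_fsupp[OF s(2) q]) (use assms in \<open>auto simp: low_def wt_append mult_right_mono\<close>)
  moreover have "cat (gen x) (q - smul s' (gen y)) \<in> fsupp (low (x @ y))"
    by (rule cat_fsupp[OF _ s'(2), of _ "{x}"]) (use assms in \<open>auto simp: low_def wt_append\<close>)
  ultimately have "cat p q - smul (s * s') (gen (x @ y)) \<in> fsupp (low (x @ y))"
    by (simp only: add_in_fsupp smul_in_fsupp)
  then show ?thesis unfolding lead_def using s(1) s'(1) by (intro exI[of _ "s * s'"]) auto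
qed

definition enc1 :: "'b list \<Rightarrow> ('b + 'b) list" where
  "enc1 w = map Inl (butlast w) @ [Inr (last w)]"

lemma enc1_simps: "enc1 [c] = [Inr c]" "w \<noteq> [] \<Longrightarrow> enc1 (c # w) = Inl c # enc1 w"
  by (simp_all add: enc1_def)

lemma enc1_O1: "w \<in> NE \<Longrightarrow> enc1 w \<in> O1 (wdeg dg w)"
proof -
  assume "w \<in> NE"
  then have "w \<noteq> []" "w \<in> lists S" by (simp_all add: NE_lists)
  then show ?thesis
  proof (induction w)
    case (Cons c w)
    then show ?case using dg[of c] by (cases "w = []") (auto simp: enc1_simps O1_def)
  qed simp
qed

definition O1l :: "nat \<Rightarrow> ('b + 'b) list set" where
  "O1l n = {y \<in> O1 n. \<exists>z c. y = z @ [Inl c]}"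

text \<open>The prefix ending in the only barred letter omits the last letter, which has positive
  degree. Its degree bounds the weight, so the weight is below the total degree
  \<open>n - 1\<close>.\<close>

lemma O1l_wt: "y \<in> O1l n \<Longrightarrow> wt y + 1 < n"
proof -
  assume "y \<in> O1l n"
  then obtain z c where y: "y = z @ [Inl c]" "y \<in> O1 n" by (auto simp: O1l_def)
  then have "nI z = 1" "c \<in> S" "wdeg edg z + dg c + 1 = n" by (auto simp: O1_def)
  then show ?thesis using wt_nI[of z] dg[of c] y by (simp add: wt_append)
qed

lemma enc1_wt: "w \<in> NE \<Longrightarrow> wt (enc1 w) + 1 = wdeg dg w"
proof -
  assume "w \<in> NE"
  then have "w \<noteq> []" "w \<in> lists S" by (simp_all add: NE_lists)
  then show ?thesis
  proof (induction w)
    case (Cons c w)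
    have "w \<noteq> [] \<Longrightarrow> nI (enc1 w) = 1" using Cons enc1_O1[of w] by (auto simp: O1_def NE_def)
    then show ?case using Cons dg[of c] by (cases "w = []") (auto simp: enc1_simps)
  qed simp
qed

lemma O1l_low: "w \<in> NE \<Longrightarrow> O1l (wdeg dg w) \<subseteq> low (enc1 w)"
proof
  fix y assume w: "w \<in> NE" and y: "y \<in> O1l (wdeg dg w)"
  then have "y \<in> O1 (wdeg dg w)" by (simp add: O1l_def)
  then show "y \<in> low (enc1 w)"
    using enc1_wt[OF w] enc1_O1[OF w] O1l_wt[OF y] by (auto simp: low_def O1_def)
qed

text \<open>Each term bars one letter, and only the term barring the last one ends in
  \<open>Inr\<close>. Its sign comes from passing the letters before it.\<close>

lemma lam_lead:
  assumes "w \<in> NE"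
  shows "lam w - smul (sg (wdeg dg (butlast w))) (gen (enc1 w)) \<in> fsupp (O1l (wdeg dg w))"
proof -
  have "w \<noteq> []" "w \<in> lists S" using assms by (simp_all add: NE_lists)
  then show ?thesis
  proof (induction w)
    case (Cons c w)
    show ?case
    proof (cases "w = []")
      case False
      have c: "c \<in> S" "w \<in> lists S" using Cons by auto
      have 1: "gen (Inr c # map Inl w) \<in> fsupp (O1l (wdeg dg (c # w)))"
        using c dg[of c] False by (cases w rule: rev_cases) (auto simp: O1l_def O1_def)
      have 2: "cat (gen [Inl c]) (lam w - smul (sg (wdeg dg (butlast w))) (gen (enc1 w))) \<in> fsupp (O1l (wdeg dg (c # w)))"
        by (rule cat_fsupp[OF _ Cons.IH, of _ "{[Inl c]}"]) (use False c in \<open>auto simp: O1l_def O1_def\<close>)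
      have eq: "lam (c # w) - smul (sg (wdeg dg (butlast (c # w)))) (gen (enc1 (c # w)))
        = gen (Inr c # map Inl w) + smul (sg (dg c)) (cat (gen [Inl c]) (lam w - smul (sg (wdeg dg (butlast w))) (gen (enc1 w))))"
        using False by (simp add: enc1_simps pm.scale_right_diff_distrib)
      show ?thesis unfolding eq by (rule add_in_fsupp[OF 1 smul_in_fsupp[OF 2]])
    qed (simp add: enc1_simps)
  qed simp
qed

text \<open>The terms subtracted in the recursion have nonempty \<open>v\<close> and hence end in an
  unbarred letter, so \<tau> has the same leading word as \<open>lam\<close>.\<close>

lemma \<tau>_lead: "w \<in> NE \<Longrightarrow> lead (\<tau> w) (enc1 w)"
proof -
  assume w: "w \<in> NE"
  have rest: "lin (\<lambda>(u, v). if wdeg dg u < wdeg dg w then cat (\<tau> u) (inl v) else 0) (\<psi> w) \<in> fsupp (O1l (wdeg dg w))"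
  proof (rule lin_mem[OF subspace_fsupp], clarsimp)
    fix u v assume uv: "(u, v) \<in> Poly_Mapping.keys (\<psi> w)" "wdeg dg u < wdeg dg w"
    note k = \<psi>_keys[OF NE_lists(1)[OF w] uv(1)]
    then have "v \<noteq> []" using uv by auto
    then obtain v' c where v: "v = v' @ [c]" by (cases v rule: rev_cases) auto
    show "cat (\<tau> u) (inl v) \<in> fsupp (O1l (wdeg dg w))"
      by (rule cat_fsupp[OF \<tau>_O1[of u], where T = "{map Inl v}"]) (use uv k v in \<open>auto simp: O1l_def O1_def\<close>)
  qed
  have "\<tau> w - smul (sg (wdeg dg (butlast w))) (gen (enc1 w)) = (lam w - smul (sg (wdeg dg (butlast w))) (gen (enc1 w)))
    - lin (\<lambda>(u, v). if wdeg dg u < wdeg dg w then cat (\<tau> u) (inl v) else 0) (\<psi> w)"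
    by (subst \<tau>.simps) simp
  also have "\<dots> \<in> fsupp (O1l (wdeg dg w))" by (intro diff_in_fsupp lam_lead w rest)
  finally have "\<tau> w - smul (sg (wdeg dg (butlast w))) (gen (enc1 w)) \<in> fsupp (low (enc1 w))"
    using fsupp_mono[OF O1l_low[OF w]] by blast
  then show ?thesis unfolding lead_def using sg_cases by blast
qed

text \<open>A word in \<open>S <+> S\<close> is cut after each letter \<open>Inr c\<close>.\<close>

definition enc :: "'b list list \<times> 'b list \<Rightarrow> ('b + 'b) list" where
  "enc = (\<lambda>(ws, u). concat (map enc1 ws) @ map Inl u)"

fun dec :: "('b + 'b) list \<Rightarrow> 'b list list \<times> 'b list" where
  "dec [] = ([], [])"
| "dec (Inl c # y) = (case dec y of ([], u) \<Rightarrow> ([], c # u) | (w # ws, u) \<Rightarrow> ((c # w) # ws, u))"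
| "dec (Inr c # y) = (case dec y of (ws, u) \<Rightarrow> ([c] # ws, u))"

lemma dec_inl: "dec (map Inl u) = ([], u)"
  by (induction u) auto

lemma dec_enc1: "w \<noteq> [] \<Longrightarrow> dec (enc1 w @ y) = (w # fst (dec y), snd (dec y))"
proof (induction w)
  case (Cons c w)
  then show ?case by (cases "w = []") (auto simp: enc1_simps split: prod.splits)
qed simp

lemma dec_enc: "[] \<notin> set ws \<Longrightarrow> dec (enc (ws, u)) = (ws, u)"
  by (induction ws) (auto simp: enc_def dec_inl dec_enc1)

definition II :: "('b list list \<times> 'b list) set" where "II = lists NE \<times> lists S"

text \<open>The multiplication map from the tensor product of the cobar construction and the
  bialgebra to the path algebra, on basis elements. It turns \<open>rho\<close> into \<psi> on the
  second factor, so its bijectivity makes the path algebra a cofree right comodule.\<close>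

definition F :: "'b list list \<times> 'b list \<Rightarrow> (('b + 'b) list \<Rightarrow>\<^sub>0 'r)" where
  "F = (\<lambda>(ws, u). cat (\<Phi> (gen ws)) (inl u))"

lemma enc_dec: "y \<in> lists SE \<Longrightarrow> enc (dec y) = y \<and> dec y \<in> II"
  by (induction y rule: dec.induct) (auto simp: enc_def enc1_simps II_def NE_def split: prod.splits list.splits)

lemma enc_inj: "inj_on enc II"
  by (rule inj_on_inverseI[of _ dec]) (auto simp: II_def NE_def dec_enc)

lemma enc_surj: "lists SE \<subseteq> enc ` II"
  using enc_dec by (metis image_eqI subsetI)

lemma enc_lists: "i \<in> II \<Longrightarrow> enc i \<in> lists SE"
proof -
  have "set ws \<subseteq> NE \<Longrightarrow> concat (map enc1 ws) \<in> lists SE" for ws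
    using enc1_O1 by (induction ws) (auto simp: O1_def)
  then show "i \<in> II \<Longrightarrow> enc i \<in> lists SE" by (auto simp: II_def enc_def lists_eq_set)
qed

lemma F_lead: "i \<in> II \<Longrightarrow> lead (F i) (enc i)"
proof -
  have "lead (\<Phi> (gen ws)) (concat (map enc1 ws))" if "set ws \<subseteq> NE" for ws
    using that
  proof (induction ws)
    case (Cons w ws)
    have "enc1 w \<in> lists SE" "concat (map enc1 ws) \<in> lists SE"
      using Cons enc_lists[of "(ws, [])"] enc1_O1[of w] by (auto simp: O1_def enc_def II_def lists_eq_set)
    then show ?case using Cons \<tau>_lead[of w] by (simp add: alg_ext_Cons lead_cat)
  qed (simp add: lead_gen)
  moreover have "concat (map enc1 ws) \<in> lists SE" if "set ws \<subseteq> NE" for ws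
    using enc_lists[of "(ws, [])"] that by (auto simp: II_def enc_def lists_eq_set)
  ultimately have *: "lead (F (ws, u)) (enc (ws, u))" if "set ws \<subseteq> NE" "set u \<subseteq> S" for ws u
    unfolding F_def enc_def prod.case using that by (intro lead_cat lead_gen) (auto simp: lists_eq_set)
  show "i \<in> II \<Longrightarrow> lead (F i) (enc i)"
    by (cases i) (auto simp: II_def lists_eq_set intro!: * )
qed

lemma low_wt: "low x \<subseteq> {y. wt y < wt x}" by (auto simp: low_def)

lemma F_inj: "p \<in> fsupp II \<Longrightarrow> lin F p = 0 \<Longrightarrow> p = 0"
proof (rule triangular_inj[of enc II F wt, OF enc_inj])
  fix i assume "i \<in> II"
  then show "\<exists>s. (s = 1 \<or> s = - 1) \<and> F i - smul s (gen (enc i)) \<in> fsupp {y. wt y < wt (enc i)}"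
    using F_lead fsupp_mono[OF low_wt] unfolding lead_def by blast
qed

text \<open>The version for all words serves to invert \<open>F\<close>; the version in one degree
  keeps the degrees of the coordinates.\<close>

lemma F_surj:
  assumes "X = lists SE \<or> X = wset SE edg n" "x \<in> fsupp X"
  shows "\<exists>p \<in> fsupp {i \<in> II. enc i \<in> X}. x = lin F p"
proof (rule triangular_surj[of X enc II F wt, OF _ _ assms(2)])
  show "X \<subseteq> enc ` II" using assms(1) enc_surj wset_lists[of _ SE edg n] by blast
  fix i assume i: "i \<in> II" "enc i \<in> X"
  have "low (enc i) \<subseteq> {y \<in> X. wt y < wt (enc i)}"
    using assms(1) i(2) by (auto simp: low_def wset_def)
  then show "\<exists>s. (s = 1 \<or> s = - 1) \<and> F i - smul s (gen (enc i)) \<in> fsupp {y \<in> X. wt y < wt (enc i)}"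
    using F_lead[OF i(1)] fsupp_mono unfolding lead_def by blast
qed

lemma \<Phi>_inj:
  assumes "x \<in> fsupp (lists NE)" "\<Phi> x = 0"
  shows "x = 0"
proof -
  define y where "y = lin (\<lambda>ws. gen (ws, [] :: 'b list)) x"
  have "lin F y = \<Phi> x"
    unfolding y_def lmap_eq_lin[OF lmap_alg_ext, of cat "gen []" \<tau> x] by (simp add: lin_lin F_def)
  moreover have "y \<in> fsupp II"
    unfolding y_def by (rule lin_mem_on[OF assms(1)]) (auto simp: II_def)
  ultimately have "y = 0" using F_inj assms(2) by simp
  then have "lin (\<lambda>(ws, u). gen ws) y = 0" by simp
  then show ?thesis by (simp add: y_def lin_lin)
qed

lemma F_lists: "i \<in> II \<Longrightarrow> F i \<in> fsupp (lists SE)"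
proof -
  have "\<Phi> (gen ws) \<in> fsupp (lists SE)" if "set ws \<subseteq> NE" for ws
    by (rule fsupp_wset_lists[OF \<Phi>_wset[of "gen ws" "wdeg adg ws"]]) (use that in \<open>simp add: wset_def\<close>)
  then show "i \<in> II \<Longrightarrow> F i \<in> fsupp (lists SE)"
    by (cases i) (auto simp: II_def F_def lists_eq_set intro!: cat_fsupp[where S = "lists SE" and T = "{map Inl (snd i)}"])
qed

text \<open>Preimages of the basis words extend to a linear right inverse, which injectivity turns
  into a left inverse. A linear map is needed because it will be applied inside a tensor
  factor.\<close>

lemma F_left_inverse: "\<exists>g. \<forall>p \<in> fsupp II. lin g (lin F p) = p"
proof -
  have "\<forall>y\<in>lists SE. \<exists>p. p \<in> fsupp II \<and> gen y = lin F p"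
  proof
    fix y assume "y \<in> lists SE"
    then have "\<exists>p \<in> fsupp {i \<in> II. enc i \<in> lists SE}. gen y = lin F p" by (intro F_surj) auto
    then show "\<exists>p. p \<in> fsupp II \<and> gen y = lin F p"
      using fsupp_mono[of "{i \<in> II. enc i \<in> lists SE}" II] by blast
  qed
  from bchoice[OF this] obtain g where g: "\<And>y. y \<in> lists SE \<Longrightarrow> g y \<in> fsupp II \<and> gen y = lin F (g y)"
    by blast
  have "lin g (lin F p) = p" if p: "p \<in> fsupp II" for p
  proof -
    have E: "lin F p \<in> fsupp (lists SE)" by (rule lin_mem_on[OF p]) (auto intro: F_lists)
    then have "lin F (lin g (lin F p)) = lin F p"
      by (intro lmap_eq_onI[OF E, of "\<lambda>y. lin F (lin g y)" "\<lambda>y. y"]; (intro lmap_intros)?; simp add: g[THEN conjunct2, symmetric])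
    moreover have "lin g (lin F p) \<in> fsupp II" by (rule lin_mem_on[OF E]) (use g in auto)
    ultimately show ?thesis using F_inj[of "lin g (lin F p) - p"] p by auto
  qed
  then show ?thesis by blast
qed

lemma rho_F: "ws \<in> lists NE \<Longrightarrow> u \<in> lists S \<Longrightarrow> rho (F (ws, u)) = lin (\<lambda>(a, b). tens (F (ws, a)) (gen b)) (\<psi> u)"
proof -
  assume ws: "ws \<in> lists NE" and u: "u \<in> lists S"
  have "tensor_mul edg dg (tens (\<Phi> (gen ws)) (gen [])) (tens (inl a) (gen b)) = tens (cat (\<Phi> (gen ws)) (inl a)) (gen b)" for a b
    using tmul_tens[of "inl a" UNIV edg "wdeg dg a" dg "\<Phi> (gen ws)" "[]" b] by (simp add: wset_def)
  then show ?thesis using ws u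
    by (simp add: F_def rho_cat rho_\<Phi> rho_inl lmap_comp_lin[of "tensor_mul edg dg _"] case_prod_unfold del: tens_gen)
qed

definition K :: "nat \<Rightarrow> (('b + 'b) list \<Rightarrow>\<^sub>0 'r) set" where
  "K n = {x \<in> fsupp (wset SE edg n). rho x = tens x (gen [])}"

lemma wdeg_enc: "set ws \<subseteq> NE \<Longrightarrow> wdeg edg (concat (map enc1 ws)) = wdeg adg ws"
proof (induction ws)
  case (Cons w ws)
  then show ?case using enc1_O1[of w] by (auto simp: O1_def adg_def)
qed simp

text \<open>In the coordinates given by \<open>F\<close>, coinvariants of a cofree comodule are the
  elements whose second coordinate is the unit.\<close>

lemma K_eq: "K n = \<Phi> ` fsupp (wset NE adg n)"
proof (intro equalityI subsetI)
  fix x assume "x \<in> \<Phi> ` fsupp (wset NE adg n)"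
  then obtain z where z: "z \<in> fsupp (wset NE adg n)" "x = \<Phi> z" by blast
  then have "z \<in> fsupp (lists NE)" by (intro fsupp_wset_lists)
  then show "x \<in> K n" using z \<Phi>_wset rho_\<Phi> by (simp add: K_def)
next
  fix x assume "x \<in> K n"
  then have x: "x \<in> fsupp (wset SE edg n)" "rho x = tens x (gen [])" by (auto simp: K_def)
  obtain p where p: "p \<in> fsupp {i \<in> II. enc i \<in> wset SE edg n}" "x = lin F p"
    using F_surj[of "wset SE edg n" n x] x by blast
  then have pI: "p \<in> fsupp II" using fsupp_mono[of "{i \<in> II. enc i \<in> wset SE edg n}" II] by blast
  obtain g where g: "\<And>q. q \<in> fsupp II \<Longrightarrow> lin g (lin F q) = q" using F_left_inverse by blast
  \<comment> \<open>\<open>T\<close> takes coordinates in the left factor and applies the counit to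
    their second component. After \<open>rho\<close> it returns all coordinates, by the left counit
    identity; on \<open>tens x (gen [])\<close> it returns only those with empty second
    word.\<close>
  define T :: "(('b + 'b) list \<times> 'b list \<Rightarrow>\<^sub>0 'r) \<Rightarrow> _" where "T = lin (\<lambda>(e, v). lin (\<lambda>(ws, a). if a = [] then gen (ws, v) else 0) (g e))"
  have T_tens: "T (tens y (gen v)) = lin (\<lambda>(ws, a). if a = [] then gen (ws, v) else 0) (lin g y)" for y and v :: "'b list"
    unfolding T_def lin_tens' by (simp add: lin_lin)
  have "T (rho x) = lin (\<lambda>(ws, u). T (rho (F (ws, u)))) p"
    unfolding p(2) T_def by (simp add: lmap_comp_lin[of rho] lin_lin case_prod_unfold)
  also have "\<dots> = lin gen p"
  proof (rule lin_cong[OF refl], clarify)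
    fix ws u assume "(ws, u) \<in> Poly_Mapping.keys p"
    then have wu: "ws \<in> lists NE" "u \<in> lists S" using fsuppD[OF pI] by (auto simp: II_def)
    have "T (rho (F (ws, u))) = lin (\<lambda>(a, b). T (tens (F (ws, a)) (gen b))) (\<psi> u)"
      unfolding rho_F[OF wu] by (simp add: T_def lin_lin case_prod_unfold)
    also have "\<dots> = lin (\<lambda>(a, b). if a = [] then gen (ws, b) else 0) (\<psi> u)"
    proof (rule lin_cong[OF refl], clarify)
      fix a b assume "(a, b) \<in> Poly_Mapping.keys (\<psi> u)"
      then have "gen (ws, a) \<in> (fsupp II :: (_ \<Rightarrow>\<^sub>0 'r) set)" using \<psi>_keys[OF wu(2)] wu by (auto simp: II_def)
      from g[OF this] show "T (tens (F (ws, a)) (gen b)) = (if a = [] then gen (ws, b) else 0)"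
        unfolding T_tens by simp
    qed
    also have "\<dots> = gen (ws, u)"
      using arg_cong[OF counitL[OF wu(2)], of "lin (\<lambda>b. gen (ws, b))"]
      by (simp add: lin_lin case_prod_unfold if_distrib cong: if_cong)
    finally show "T (rho (F (ws, u))) = gen (ws, u)" .
  qed
  finally have "p = T (rho x)" by simp
  also have "\<dots> = lin (\<lambda>(ws, a). if a = [] then gen (ws, []) else 0) p"
    unfolding x(2) T_tens unfolding p(2) g[OF pI] ..
  finally have pp: "p = lin (\<lambda>(ws, a). if a = [] then gen (ws, []) else 0) p" .
  define z where "z = lin (\<lambda>(ws, a). if a = [] then gen ws else 0) p"
  have "x = lin F (lin (\<lambda>(ws, a). if a = [] then gen (ws, []) else 0) p)" using p(2) pp by simp
  also have "\<dots> = \<Phi> z"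
    unfolding z_def lmap_comp_lin[OF lmap_alg_ext] lin_lin
    by (rule lin_cong[OF refl]) (auto simp: F_def)
  finally have "x = \<Phi> z" .
  moreover have "z \<in> fsupp (wset NE adg n)"
    unfolding z_def
  proof (rule lin_mem_on[OF p(1) subspace_fsupp])
    fix i assume "i \<in> {i \<in> II. enc i \<in> wset SE edg n}"
    then show "(case i of (ws, a) \<Rightarrow> if a = [] then gen ws else 0) \<in> (fsupp (wset NE adg n) :: (_ \<Rightarrow>\<^sub>0 'r) set)"
      using wdeg_enc[of "fst i"] by (cases i) (auto simp: II_def enc_def wset_def lists_eq_set)
  qed
  ultimately show "x \<in> \<Phi> ` fsupp (wset NE adg n)" by blast
qed

lemma der_DA_lists: "x \<in> fsupp (lists NE) \<Longrightarrow> der adg DA x \<in> fsupp (lists NE)"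
proof (erule lmap_mem[OF lmap_der' _ subspace_fsupp])
  fix ws assume "ws \<in> lists NE"
  then have "set ws \<subseteq> NE" by auto
  then have "der adg DA (gen ws) \<in> fsupp (WS NE adg 1 (wdeg adg ws) (length ws + 0))"
  proof (rule der_WS[rotated])
    fix w assume w: "w \<in> NE"
    have "lt (- dA (gen w)) \<in> fsupp (WS NE adg 1 (adg w) (Suc 0))"
      by (rule lt_mem[OF dA_NE[OF w]]) (auto simp: WS_def)
    moreover have "QA w \<in> fsupp (WS NE adg 1 (adg w) (Suc 0))"
      by (rule subsetD[OF fsupp_mono QA_WS[OF w]]) (auto simp: WS_def)
    ultimately show "DA w \<in> fsupp (WS NE adg 1 (adg w) (Suc 0))" unfolding DA_def by (rule add_in_fsupp)
  qed
  then show "der adg DA (gen ws) \<in> fsupp (lists NE)" by (rule fsupp_WS_lists)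
qed

lemma dE_square': "x \<in> fsupp (lists SE) \<Longrightarrow> dE (dE x) = 0"
  by (erule lmap_eq_onI[of _ _ "\<lambda>x. dE (dE x)"]; (intro lmap_intros)?; simp add: dE_square)

lemma \<Phi>_lists: "x \<in> fsupp (lists NE) \<Longrightarrow> \<Phi> x \<in> fsupp (lists SE)"
proof (erule lmap_mem[OF lmap_alg_ext _ subspace_fsupp])
  fix ws assume "ws \<in> lists NE"
  then show "\<Phi> (gen ws) \<in> fsupp (lists SE)" using F_lists[of "(ws, [])"] by (auto simp: F_def II_def)
qed

text \<open>Injectivity of \<Phi> transports this from the path algebra, where the square is already
  known to vanish, so no second computation of signs is required.\<close>

lemma DA_square: "set ws \<subseteq> NE \<Longrightarrow> der adg DA (der adg DA (gen ws)) = 0"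
proof -
  assume "set ws \<subseteq> NE"
  then have g: "gen ws \<in> (fsupp (lists NE) :: (_ \<Rightarrow>\<^sub>0 'r) set)" by auto
  have "\<Phi> (der adg DA (der adg DA (gen ws))) = 0"
    using g der_DA_lists[OF g] dE_square'[OF \<Phi>_lists[OF g]] by (simp add: \<Phi>_chain)
  then show ?thesis by (intro \<Phi>_inj der_DA_lists g)
qed

end

section \<open>The cobar construction as a tensor bialgebra\<close>

lemma cobar_sel [simp]:
  "grade (cobar C) = grade (tensor_algebra (basis_pos C) (sdeg C))" "mul (cobar C) = cat" "one (cobar C) = gen []"
  "dif (cobar C) = der (sdeg C) (cobar_dgen C)"
  by (simp_all add: cobar_def galg.defs tensor_algebra_def der_def)

lemma desusp_unit [simp]: "desusp C (cunit C) = 0"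
  by (simp add: desusp_def)

definition cobar_quad :: "('b, 'r) coalg \<Rightarrow> 'b \<Rightarrow> ('b list \<Rightarrow>\<^sub>0 'r::comm_ring_1)" where
  "cobar_quad C c = lin (\<lambda>(x, y). smul (sg (deg C x)) (cat (desusp C x) (desusp C y))) (comul C c)"

text \<open>Desuspension kills the unit, so the two terms that distinguish the reduced from the full
  comultiplication contribute nothing.\<close>

lemma cobar_dgen_eq: "cobar_dgen C c = - lin (desusp C) (cdif C c) + cobar_quad C c"
  by (simp add: cobar_dgen_def cobar_quad_def reduced_comul_def)

lemma tmap_0: "tmap 0 d f g = lin (\<lambda>(x, y). tens (f x) (g y))"
  by (simp add: tmap_def)

lemma assoc_eval:
  assumes "assoc (tmap 0 d f gen z) = tmap 0 d gen f z"
  shows "lin (\<lambda>(x, y). lin (\<lambda>(a, b). G a b y) (f x)) z = lin (\<lambda>(x, y). lin (\<lambda>(a, b). G x a b) (f y)) z"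
  using arg_cong[OF assms, of "lin (\<lambda>(a, b, c). G a b c)"]
  by (simp add: assoc_def tmap_0 lin_lin lin_tens' case_prod_unfold)

lemma lmap_comp_lt: "lmap f \<Longrightarrow> f (lt p) = lin (\<lambda>x. f (gen [x])) p"
  unfolding lt_def by (rule lmap_comp_lin)

locale aw_setup =
  fixes C :: "('b, 'r::comm_ring_1) coalg" and \<Psi> :: "('b list \<Rightarrow>\<^sub>0 'r) \<Rightarrow> (('b \<times> 'b) list \<Rightarrow>\<^sub>0 'r)"
  assumes aw: "aw_coalgebra (C, \<Psi>)"
    and conn: "\<forall>c\<in>basis C. deg C c \<noteq> 1 \<and> deg C c \<noteq> 2"
begin

abbreviation "S \<equiv> basis_pos C"
abbreviation "dg \<equiv> sdeg C"
abbreviation "e \<equiv> cunit C"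
abbreviation "\<Delta> \<equiv> comul C"
abbreviation "D \<equiv> cobar_dgen C"
abbreviation "ds \<equiv> desusp C"

lemma coalg: "chain_coalgebra C"
  using aw by (simp add: aw_coalgebra_def simply_connected_def)

lemma unit: "e \<in> basis C" "deg C e = 0" "b \<in> basis C \<Longrightarrow> deg C b = 0 \<longleftrightarrow> b = e"
proof -
  have eq: "{b \<in> basis C. deg C b = 0} = {e}" using coalg by (simp add: chain_coalgebra_def)
  have "b \<in> {b \<in> basis C. deg C b = 0} \<longleftrightarrow> b \<in> {e}" for b by (simp only: eq)
  then have "b \<in> basis C \<and> deg C b = 0 \<longleftrightarrow> b = e" for b by simp
  then show "e \<in> basis C" "deg C e = 0" "b \<in> basis C \<Longrightarrow> deg C b = 0 \<longleftrightarrow> b = e" by metis+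
qed

lemma S_iff: "c \<in> S \<longleftrightarrow> c \<in> basis C \<and> c \<noteq> e"
  using unit(2) unit(3)[of c] by (auto simp: basis_pos_def)

lemma deg_S: "c \<in> S \<Longrightarrow> 3 \<le> deg C c"
  using conn by (fastforce simp: basis_pos_def)

lemma deg_sdeg: "c \<in> S \<Longrightarrow> deg C c = Suc (dg c)"
  using deg_S[of c] by (simp add: sdeg_def)

lemma dg2: "c \<in> S \<Longrightarrow> 2 \<le> dg c"
  using deg_S[of c] by (simp add: sdeg_def)

lemma C_props:
  assumes "b \<in> basis C"
  shows "x \<in> Poly_Mapping.keys (cdif C b) \<Longrightarrow> x \<in> S \<and> deg C x + 1 = deg C b"
    and "lin (cdif C) (cdif C b) = 0"
    and "(x, y) \<in> Poly_Mapping.keys (\<Delta> b) \<Longrightarrow> x \<in> basis C \<and> y \<in> basis C \<and> deg C x + deg C y = deg C b"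
    and "lin \<Delta> (cdif C b) = lin (cdif (C \<otimes>\<^sub>c C)) (\<Delta> b)"
    and "lin (\<lambda>(x, y). if x = e then gen y else 0) (\<Delta> b) = gen b"
    and "lin (\<lambda>(x, y). if y = e then gen x else 0) (\<Delta> b) = gen b"
    and "lin (\<lambda>(x, y). lin (\<lambda>(a, b). G a b y) (\<Delta> x)) (\<Delta> b) = lin (\<lambda>(x, y). lin (\<lambda>(a, b). G x a b) (\<Delta> y)) (\<Delta> b)"
proof -
  note c = coalg[unfolded chain_coalgebra_def, THEN conjunct2, THEN conjunct1, THEN bspec, OF assms]
  show "x \<in> Poly_Mapping.keys (cdif C b) \<Longrightarrow> x \<in> S \<and> deg C x + 1 = deg C b"
    using c by (auto simp: S_iff)
  show "lin (cdif C) (cdif C b) = 0" "lin \<Delta> (cdif C b) = lin (cdif (C \<otimes>\<^sub>c C)) (\<Delta> b)"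
    "lin (\<lambda>(x, y). if x = e then gen y else 0) (\<Delta> b) = gen b"
    "lin (\<lambda>(x, y). if y = e then gen x else 0) (\<Delta> b) = gen b"
    using c by simp_all
  show "(x, y) \<in> Poly_Mapping.keys (\<Delta> b) \<Longrightarrow> x \<in> basis C \<and> y \<in> basis C \<and> deg C x + deg C y = deg C b"
    using c by blast
  show "lin (\<lambda>(x, y). lin (\<lambda>(a, b). G a b y) (\<Delta> x)) (\<Delta> b) = lin (\<lambda>(x, y). lin (\<lambda>(a, b). G x a b) (\<Delta> y)) (\<Delta> b)"
    by (rule assoc_eval) (use c in blast)
qed

lemma cdif_unit: "cdif C e = 0" and comul_unit: "\<Delta> e = gen (e, e)"
proof -
  have "x \<notin> Poly_Mapping.keys (cdif C e)" for x using C_props(1)[OF unit(1), of x] unit(2) by auto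
  then have "Poly_Mapping.keys (cdif C e) = {}" by blast
  then show "cdif C e = 0" by simp
  show "\<Delta> e = gen (e, e)" using coalg by (simp add: chain_coalgebra_def)
qed

lemma D_unit: "D e = 0"
  by (simp add: cobar_dgen_eq cobar_quad_def cdif_unit comul_unit)

lemma sg_dg: "c \<in> S \<Longrightarrow> sg (deg C c) = (- sg (dg c) :: 'r)"
  by (simp add: deg_sdeg)

lemma quad_WS: "c \<in> S \<Longrightarrow> cobar_quad C c \<in> fsupp (WS S dg 1 (dg c) 2)"
  unfolding cobar_quad_def
proof (rule lin_mem[OF subspace_fsupp], clarify)
  fix x y assume c: "c \<in> S" and xy: "(x, y) \<in> Poly_Mapping.keys (\<Delta> c)"
  have cb: "c \<in> basis C" using c by (simp add: S_iff)
  have "cat (ds x) (ds y) \<in> fsupp (WS S dg 1 (dg c) 2)"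
  proof (cases "x = e \<or> y = e")
    case False
    then have "x \<in> S" "y \<in> S" using C_props(3)[OF cb xy] by (auto simp: S_iff)
    then show ?thesis
      using False C_props(3)[OF cb xy] deg_sdeg[of x] deg_sdeg[of y] deg_sdeg[OF c]
      by (simp add: desusp_def WS_def)
  qed auto
  then show "smul (sg (deg C x)) (cat (ds x) (ds y)) \<in> fsupp (WS S dg 1 (dg c) 2)" by (rule smul_in_fsupp)
qed

lemma cdif_mem: "c \<in> S \<Longrightarrow> cdif C c \<in> fsupp {y \<in> S. dg y + 1 = dg c}"
proof -
  assume c: "c \<in> S"
  then have cb: "c \<in> basis C" by (simp add: S_iff)
  show ?thesis
    using C_props(1)[OF cb] deg_sdeg[OF c] deg_sdeg by (fastforce simp: fsupp_def)
qed

lemma lin_ds: "p \<in> fsupp S \<Longrightarrow> lin ds p = lt p"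
  unfolding lt_def by (rule lin_cong[OF refl]) (auto simp: desusp_def S_iff dest: fsuppD)

lemma D_letters: "c \<in> S \<Longrightarrow> D c = lt (- cdif C c) + cobar_quad C c"
proof -
  assume c: "c \<in> S"
  have "cdif C c \<in> fsupp S" by (rule subsetD[OF fsupp_mono cdif_mem[OF c]]) auto
  then show ?thesis by (simp add: cobar_dgen_eq lin_ds)
qed

lemma D_WS: "c \<in> S \<Longrightarrow> D c \<in> fsupp (WS S dg 1 (dg c) 1)"
proof -
  assume c: "c \<in> S"
  have "lt (- cdif C c) \<in> fsupp (WS S dg 1 (dg c) 1)"
    by (rule lt_mem[OF uminus_in_fsupp[OF cdif_mem[OF c]]]) (auto simp: WS_def)
  moreover have "cobar_quad C c \<in> fsupp (WS S dg 1 (dg c) 1)"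
    by (rule subsetD[OF fsupp_mono quad_WS[OF c]]) (auto simp: WS_def)
  ultimately show ?thesis unfolding D_letters[OF c] by (rule add_in_fsupp)
qed

lemma der_ds: "x \<in> basis C \<Longrightarrow> der dg D (ds x) = D x"
  by (simp add: desusp_def D_unit)

lemma ds_wset: "x \<in> basis C \<Longrightarrow> ds x \<in> fsupp (wset S dg (dg x))"
  by (auto simp: desusp_def wset_def S_iff)

text \<open>By word length: the terms of length 1 vanish because the differential of
  \<open>C\<close> squares to 0, those of length 2 because the comultiplication is a chain map,
  those of length 3 by coassociativity.\<close>

lemma der_D: assumes "c \<in> basis C" shows "der dg D (D c) = 0"
proof -
  note k = C_props(3)[OF assms]
  let ?Q = "\<lambda>(x, y). smul (sg (deg C x)) (cat (ds x) (ds y))"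
  have 1: "der dg D (cobar_quad C c) = lin (\<lambda>(x, y). smul (sg (deg C x)) (cat (D x) (ds y)) - cat (ds x) (D y)) (\<Delta> c)"
    unfolding cobar_quad_def lmap_comp_lin[OF lmap_der']
  proof (rule lin_cong[OF refl], clarify)
    fix x y assume "(x, y) \<in> Poly_Mapping.keys (\<Delta> c)"
    note xy = k[OF this]
    have d: "der dg D (cat (ds x) (ds y)) = cat (D x) (ds y) + smul (sg (dg x)) (cat (ds x) (D y))"
      using xy by (simp add: der_cat[OF ds_wset] der_ds)
    show "der dg D (smul (sg (deg C x)) (cat (ds x) (ds y))) = smul (sg (deg C x)) (cat (D x) (ds y)) - cat (ds x) (D y)"
    \<comment> \<open>The degree of the unit is truncated when desuspended, so the sign rule for
      desuspension fails for it; all terms in question vanish instead.\<close>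
    proof (cases "x = e")
      case False
      then have "sg (deg C x) = (- sg (dg x) :: 'r)" using xy by (intro sg_dg) (simp add: S_iff)
      then show ?thesis by (simp add: d pm.scale_right_distrib)
    qed (simp add: D_unit)
  qed
  have "lin (cobar_quad C) (cdif C c) = lin ?Q (lin (cdif (C \<otimes>\<^sub>c C)) (\<Delta> c))"
    unfolding C_props(4)[OF assms, symmetric] by (simp add: lin_lin cobar_quad_def[abs_def])
  also have "\<dots> = lin (\<lambda>(x, y). - smul (sg (deg C x)) (cat (lin ds (cdif C x)) (ds y)) + cat (ds x) (lin ds (cdif C y))) (\<Delta> c)"
    unfolding lin_lin
  proof (rule lin_cong[OF refl], clarify)
    fix x y assume "(x, y) \<in> Poly_Mapping.keys (\<Delta> c)"
    note xy = k[OF this]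
    have "lin (\<lambda>x'. smul (sg (deg C x')) (cat (ds x') (ds y))) (cdif C x) = lin (\<lambda>x'. - smul (sg (deg C x)) (cat (ds x') (ds y))) (cdif C x)"
    proof (rule lin_cong[OF refl])
      fix x' assume "x' \<in> Poly_Mapping.keys (cdif C x)"
      then have "deg C x = Suc (deg C x')" using C_props(1)[of x x'] xy by simp
      then show "smul (sg (deg C x')) (cat (ds x') (ds y)) = - smul (sg (deg C x)) (cat (ds x') (ds y))" by simp
    qed
    also have "\<dots> = - smul (sg (deg C x)) (cat (lin ds (cdif C x)) (ds y))"
      by (simp add: lin_smul_fun lin_uminus_fun lmap_comp_lin[of "\<lambda>p. cat p _"])
    finally show "lin ?Q (cdif (C \<otimes>\<^sub>c C) (x, y)) = - smul (sg (deg C x)) (cat (lin ds (cdif C x)) (ds y)) + cat (ds x) (lin ds (cdif C y))"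
      by (simp add: tcoalg_def lin_tens' lin_smul_fun lmap_comp_lin[of "cat _"])
  qed
  finally have 2: "lin (cobar_quad C) (cdif C c) = lin (\<lambda>(x, y). - smul (sg (deg C x)) (cat (lin ds (cdif C x)) (ds y))
      + cat (ds x) (lin ds (cdif C y))) (\<Delta> c)" .
  have 3: "lin (\<lambda>(x, y). smul (sg (deg C x)) (cat (cobar_quad C x) (ds y))) (\<Delta> c)
    = lin (\<lambda>(x, y). cat (ds x) (cobar_quad C y)) (\<Delta> c)"
  proof -
    have "lin (\<lambda>(x, y). smul (sg (deg C x)) (cat (cobar_quad C x) (ds y))) (\<Delta> c)
      = lin (\<lambda>(x, y). lin (\<lambda>(a, b). smul (sg (deg C b)) (cat (cat (ds a) (ds b)) (ds y))) (\<Delta> x)) (\<Delta> c)"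
    proof (rule lin_cong[OF refl], clarify)
      fix x y assume "(x, y) \<in> Poly_Mapping.keys (\<Delta> c)"
      note xy = k[OF this]
      have "smul (sg (deg C x)) (cat (cobar_quad C x) (ds y))
        = lin (\<lambda>(a, b). smul (sg (deg C x)) (smul (sg (deg C a)) (cat (cat (ds a) (ds b)) (ds y)))) (\<Delta> x)"
        unfolding cobar_quad_def lmap_comp_lin[OF lmap_cat(2)] by (simp add: case_prod_unfold lin_smul_fun del: pm.scale_scale)
      \<comment> \<open>The signs of \<open>x\<close> and \<open>a\<close> combine to that of
        \<open>b\<close>, the middle factor. Reassociation renames it and yields the sign in the
        quadratic part.\<close>
      also have "\<dots> = lin (\<lambda>(a, b). smul (sg (deg C b)) (cat (cat (ds a) (ds b)) (ds y))) (\<Delta> x)"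
      proof (rule lin_cong[OF refl], clarify)
        fix a b assume "(a, b) \<in> Poly_Mapping.keys (\<Delta> x)"
        then have "deg C x = deg C a + deg C b" using C_props(3)[of x a b] xy by simp
        then show "smul (sg (deg C x)) (smul (sg (deg C a)) (cat (cat (ds a) (ds b)) (ds y))) = smul (sg (deg C b)) (cat (cat (ds a) (ds b)) (ds y))"
          by (simp add: mult_ac)
      qed
      finally show "smul (sg (deg C x)) (cat (cobar_quad C x) (ds y))
        = lin (\<lambda>(a, b). smul (sg (deg C b)) (cat (cat (ds a) (ds b)) (ds y))) (\<Delta> x)" .
    qed
    also have "\<dots> = lin (\<lambda>(x, y). lin (\<lambda>(a, b). smul (sg (deg C a)) (cat (cat (ds x) (ds a)) (ds b))) (\<Delta> y)) (\<Delta> c)"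
      by (rule C_props(7)[OF assms])
    also have "\<dots> = lin (\<lambda>(x, y). cat (ds x) (cobar_quad C y)) (\<Delta> c)"
      unfolding cobar_quad_def lmap_comp_lin[OF lmap_cat(1)] by (simp add: case_prod_unfold cat_assoc)
    finally show ?thesis .
  qed
  have "der dg D (lin ds (cdif C c)) = lin D (cdif C c)"
    unfolding lmap_comp_lin[OF lmap_der']
    by (rule lin_cong[OF refl]) (use C_props(1)[OF assms] in \<open>auto simp: der_ds S_iff\<close>)
  also have "\<dots> = lin (cobar_quad C) (cdif C c) - lin ds (lin (cdif C) (cdif C c))"
  proof -
    have "lin D (cdif C c) = lin (\<lambda>x. - lin ds (cdif C x) + cobar_quad C x) (cdif C c)"
      by (rule lin_cong[OF refl]) (rule cobar_dgen_eq)
    then show ?thesis by (simp add: lin_add_fun lin_uminus_fun lin_diff_fun lin_lin)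
  qed
  finally have "der dg D (D c) = - lin (cobar_quad C) (cdif C c) + der dg D (cobar_quad C c)"
    by (simp add: cobar_dgen_eq[of C c] C_props(2)[OF assms])
  also have "\<dots> = lin (\<lambda>(x, y). smul (sg (deg C x)) (cat (cobar_quad C x) (ds y))) (\<Delta> c)
      - lin (\<lambda>(x, y). cat (ds x) (cobar_quad C y)) (\<Delta> c)"
    unfolding 1 2 lin_uminus_fun[symmetric] lin_add_fun[symmetric] lin_diff_fun[symmetric]
    by (rule lin_cong[OF refl]) (auto simp: cobar_dgen_eq pm.scale_right_diff_distrib pm.scale_right_distrib)
  finally show ?thesis using 3 by simp
qed

lemma dg1: "c \<in> S \<Longrightarrow> 1 \<le> dg c" using dg2[of c] by simp

lemma der_der: "w \<in> lists S \<Longrightarrow> der dg D (der dg D (gen w)) = 0"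
proof (rule der_square[OF _ dg1 der_D])
  show "c \<in> S \<Longrightarrow> D c \<in> fsupp (wset S dg (dg c - 1))" for c
    by (rule subsetD[OF fsupp_mono D_WS]) (auto simp: WS_def wset_def)
qed (auto simp: S_iff)

section \<open>The comultiplication through Milgram's map\<close>

definition \<psi> :: "'b list \<Rightarrow> ('b list \<times> 'b list \<Rightarrow>\<^sub>0 'r)" where "\<psi> w = aw_psi C \<Psi> (gen w)"

abbreviation "CC \<equiv> C \<otimes>\<^sub>c C"
abbreviation "mil \<equiv> milgram C C"

lemma \<Psi>_props:
  "linear_on (fsupp (lists S)) \<Psi>"
  "x \<in> fsupp (wset S dg n) \<Longrightarrow> \<Psi> x \<in> fsupp (wset (basis_pos CC) (sdeg CC) n)"
  "x \<in> fsupp (lists S) \<Longrightarrow> y \<in> fsupp (lists S) \<Longrightarrow> \<Psi> (cat x y) = cat (\<Psi> x) (\<Psi> y)"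
  "\<Psi> (gen []) = gen []"
  "x \<in> fsupp (lists S) \<Longrightarrow> \<Psi> (der dg D x) = der (sdeg CC) (cobar_dgen CC) (\<Psi> x)"
  "c \<in> basis C \<Longrightarrow> linear_part C CC \<Psi> c = \<Delta> c"
  using aw unfolding aw_coalgebra_def chain_alg_hom_def alg_hom_def by (auto simp del: mem_Collect_eq)

lemma \<psi>_mil: "\<psi> w = mil (\<Psi> (gen w))"
  by (simp add: \<psi>_def aw_psi_def)

lemma lmap_mil [simp]: "lmap mil"
  by (simp add: milgram_def)

lemma mil_cat: "mil (cat p q) = tensor_mul dg dg (mil p) (mil q)"
  unfolding milgram_def by (rule alg_ext_cat) (auto simp: tmul_assoc)

lemma mil_Nil: "mil (gen []) = gen ([], [])"
  by (simp add: milgram_def)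

lemma mil_letter: "mil (gen [(c, d)]) = (if d = e then gen ([c], []) else if c = e then gen ([], [d]) else 0)"
  by (simp add: milgram_def alg_ext_Cons)

lemma basis_CC: "(c, d) \<in> basis_pos CC \<longleftrightarrow> c \<in> basis C \<and> d \<in> basis C \<and> (c \<noteq> e \<or> d \<noteq> e)"
  using unit(1,2) unit(3)[of c] unit(3)[of d] by (auto simp: basis_pos_def tcoalg_def)

lemma sdeg_CC: "sdeg CC (c, d) = deg C c + deg C d - 1"
  by (simp add: sdeg_def tcoalg_def)

lemma sdeg_CC_unit: "sdeg CC (x, e) = dg x" "sdeg CC (e, x) = dg x"
  unfolding sdeg_CC unit(2) by (simp_all add: sdeg_def)

definition tset :: "nat \<Rightarrow> ('b list \<times> 'b list) set" where
  "tset n = {(u, v). u \<in> lists S \<and> v \<in> lists S \<and> wdeg dg u + wdeg dg v = n}"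

lemma tmul_tset: "p \<in> fsupp (tset m) \<Longrightarrow> q \<in> fsupp (tset n) \<Longrightarrow> tensor_mul dg dg p q \<in> fsupp (tset (m + n))"
  unfolding tensor_mul_def by (erule bilin_mem, assumption, rule subspace_fsupp) (auto simp: tset_def)

lemma mil_letter_tset: "l \<in> basis_pos CC \<Longrightarrow> mil (gen [l]) \<in> fsupp (tset (sdeg CC l))"
  by (cases l) (auto simp: mil_letter basis_CC sdeg_CC_unit tset_def S_iff)

lemma mil_tset: "z \<in> fsupp (wset (basis_pos CC) (sdeg CC) n) \<Longrightarrow> mil z \<in> fsupp (tset n)"
proof (erule lmap_mem[OF lmap_mil _ subspace_fsupp])
  fix w assume "w \<in> wset (basis_pos CC) (sdeg CC) n"
  then have "set w \<subseteq> basis_pos CC" and n: "n = wdeg (sdeg CC) w" by (auto simp: wset_def)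
  then show "mil (gen w) \<in> fsupp (tset n)"
    unfolding n
  proof (induction w)
    case (Cons l w)
    have "mil (gen (l # w)) = tensor_mul dg dg (mil (gen [l])) (mil (gen w))"
      using mil_cat[of "gen [l]" "gen w"] by simp
    then show ?case using Cons tmul_tset[OF mil_letter_tset[of l]] by simp
  qed (simp add: mil_Nil tset_def)
qed

lemma gen_wset: "w \<in> lists S \<Longrightarrow> gen w \<in> fsupp (wset S dg (wdeg dg w))" by (auto simp: wset_def)

lemma \<psi>_tset: "w \<in> lists S \<Longrightarrow> \<psi> w \<in> fsupp (tset (wdeg dg w))"
  unfolding \<psi>_mil by (intro mil_tset \<Psi>_props gen_wset)

lemma \<psi>_Nil: "\<psi> [] = gen ([], [])"
  by (simp add: \<psi>_mil \<Psi>_props mil_Nil)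

lemma \<psi>_append: "u \<in> lists S \<Longrightarrow> v \<in> lists S \<Longrightarrow> \<psi> (u @ v) = tensor_mul dg dg (\<psi> u) (\<psi> v)"
  using \<Psi>_props(3)[of "gen u" "gen v"] by (simp add: \<psi>_mil mil_cat)

lemma \<psi>_coassoc: "w \<in> lists S \<Longrightarrow> lin (\<lambda>(u, v). lin (\<lambda>(a, b). G a b v) (\<psi> u)) (\<psi> w)
      = lin (\<lambda>(u, v). lin (\<lambda>(a, b). G u a b) (\<psi> v)) (\<psi> w)"
proof (rule assoc_eval)
  assume w: "w \<in> lists S"
  have "\<forall>x\<in>carr (grade (cobar C)).
        assoc (tmap 0 (wdeg (sdeg C)) (\<lambda>w. aw_psi C \<Psi> (gen w)) gen (aw_psi C \<Psi> x))
          = tmap 0 (wdeg (sdeg C)) gen (\<lambda>w. aw_psi C \<Psi> (gen w)) (aw_psi C \<Psi> x)"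
    using aw by (simp add: aw_coalgebra_def)
  then show "assoc (tmap 0 (wdeg dg) \<psi> gen (\<psi> w)) = tmap 0 (wdeg dg) gen \<psi> (\<psi> w)"
    using w unfolding \<psi>_def[abs_def] by simp
qed

subsection \<open>Counitality\<close>

text \<open>Coassociativity makes \<open>(1 \<otimes> \<epsilon>)\<psi>\<close> an idempotent algebra map, and since \<open>\<Psi>\<close> has linear part \<open>\<Delta>\<close> it is the
  identity modulo decomposables; hence it is the identity.\<close>

definition "eR = lin (\<lambda>(u, v :: 'b list). if v = [] then gen u else (0 :: 'b list \<Rightarrow>\<^sub>0 'r))"
definition "eL = lin (\<lambda>(u :: 'b list, v). if u = [] then gen v else (0 :: 'b list \<Rightarrow>\<^sub>0 'r))"

lemma lmap_eRL [simp]: "lmap eR" "lmap eL"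
  by (simp_all add: eR_def eL_def)

lemma lmap_eRL' [lmap_intros]: "lmap f \<Longrightarrow> lmap (\<lambda>x. eR (f x))" "lmap f \<Longrightarrow> lmap (\<lambda>x. eL (f x))"
  unfolding eR_def eL_def by (intro lmap_intros; assumption)+

lemma eRL_mul: "eR (tensor_mul dg dg p q) = cat (eR p) (eR q)" "eL (tensor_mul dg dg p q) = cat (eL p) (eL q)"
proof -
  show "eR (tensor_mul dg dg p q) = cat (eR p) (eR q)"
    by (rule bilin_eqI; (intro lmap_intros)?; clarsimp simp: eR_def)
  show "eL (tensor_mul dg dg p q) = cat (eL p) (eL q)"
    by (rule bilin_eqI; (intro lmap_intros)?; clarsimp simp: eL_def)
qed

text \<open>Such an algebra map is the identity up to longer words, hence injective by
  triangularity. Idempotence puts \<open>f w - gen w\<close> into its kernel.\<close>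

lemma idempotent_unipotent:
  assumes app: "\<And>u v. u \<in> lists S \<Longrightarrow> v \<in> lists S \<Longrightarrow> f (u @ v) = cat (f u) (f v)" and Nil: "f [] = gen []"
    and letter: "\<And>c. c \<in> S \<Longrightarrow> f [c] - gen [c] \<in> fsupp (WS S dg 0 (dg c) 2)"
    and idem: "\<And>w. w \<in> lists S \<Longrightarrow> lin f (f w) = f w"
    and w: "w \<in> lists S"
  shows "f w = (gen w :: 'b list \<Rightarrow>\<^sub>0 'r)"
proof -
  have up: "f w - gen w \<in> fsupp (WS S dg 0 (wdeg dg w) (Suc (length w)))" if "w \<in> lists S" for w
    using that
  proof (induction w)
    case (Cons c w)
    then have c: "c \<in> S" "w \<in> lists S" by auto
    have fw: "f w \<in> fsupp (WS S dg 0 (wdeg dg w) (length w))"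
    proof -
      have "f w - gen w \<in> fsupp (WS S dg 0 (wdeg dg w) (length w))"
        by (rule subsetD[OF fsupp_mono Cons.IH]) (auto simp: WS_def)
      moreover have "gen w \<in> fsupp (WS S dg 0 (wdeg dg w) (length w))" using c by (intro gen_WS) auto
      ultimately have "(f w - gen w) + gen w \<in> fsupp (WS S dg 0 (wdeg dg w) (length w))" by (rule add_in_fsupp)
      then show ?thesis by simp
    qed
    have "f (c # w) = cat (f [c]) (f w)" using app[of "[c]" w] c by simp
    then have "f (c # w) - gen (c # w) = cat (f [c] - gen [c]) (f w) + cat (gen [c]) (f w - gen w)" by simp
    moreover have "cat (f [c] - gen [c]) (f w) \<in> fsupp (WS S dg 0 (wdeg dg (c # w)) (Suc (length (c # w))))"
      by (rule cat_WS[OF letter[OF c(1)] fw]) auto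
    moreover have "cat (gen [c]) (f w - gen w) \<in> fsupp (WS S dg 0 (wdeg dg (c # w)) (Suc (length (c # w))))"
      by (rule cat_WS[OF gen_WS Cons.IH]) (use c in auto)
    ultimately show ?case by (simp only: add_in_fsupp)
  qed (simp add: Nil)
  let ?y = "f w - gen w"
  have "lin f ?y = 0" using idem[OF w] by simp
  moreover have "?y \<in> fsupp (lists S)" by (rule fsupp_WS_lists[OF up[OF w]])
  ultimately have "?y = 0"
  \<comment> \<open>The weight is degree minus length, so that longer words of the same degree are
    lower. There is no truncation, as the length never exceeds the degree.\<close>
  proof (intro triangular_inj[of id "lists S" f "\<lambda>w. wdeg dg w - length w" ?y])
    fix v assume v: "v \<in> lists S"
    have "WS S dg 0 (wdeg dg v) (Suc (length v)) \<subseteq> {y. wdeg dg y - length y < wdeg dg (id v) - length (id v)}"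
      using length_le_wdeg[of S dg] dg1 by (fastforce simp: WS_def)
    then have "f v - smul 1 (gen (id v)) \<in> fsupp {y. wdeg dg y - length y < wdeg dg (id v) - length (id v)}"
      using up[OF v] fsupp_mono by auto
    then show "\<exists>s. (s = 1 \<or> s = - 1) \<and> f v - smul s (gen (id v)) \<in> fsupp {y. wdeg dg y - length y < wdeg dg (id v) - length (id v)}"
      by blast
  qed auto
  then show ?thesis by simp
qed

lemma length_one_part:
  assumes z: "z \<in> fsupp (wset (basis_pos CC) (sdeg CC) n)" and n: "0 < n"
  shows "z - lt (lin (\<lambda>w. if length w = 1 then gen (hd w) else 0) z) \<in> fsupp {w \<in> wset (basis_pos CC) (sdeg CC) n. 2 \<le> length w}"
proof -
  have "z - lt (lin (\<lambda>w. if length w = 1 then gen (hd w) else 0) z)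
    = lin (\<lambda>w. gen w - lt (if length w = 1 then gen (hd w) else 0)) z"
    by (simp add: lin_diff_fun lin_lt)
  also have "\<dots> \<in> fsupp {w \<in> wset (basis_pos CC) (sdeg CC) n. 2 \<le> length w}"
  proof (rule lin_mem_on[OF z subspace_fsupp])
    fix w assume w: "w \<in> wset (basis_pos CC) (sdeg CC) n"
    then have "w \<noteq> []" using n by (auto simp: wset_def)
    then consider "length w = 1" | "2 \<le> length w" by (cases w; cases "tl w") auto
    then show "gen w - lt (if length w = 1 then gen (hd w) else 0) \<in> fsupp {w \<in> wset (basis_pos CC) (sdeg CC) n. 2 \<le> length w}"
    proof cases
      case 1
      then obtain l where "w = [l]" by (cases w) auto
      then show ?thesis by simp
    qed (use w in auto)
  qed
  finally show ?thesis .
qed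

lemma \<Psi>_letter: "c \<in> S \<Longrightarrow> \<Psi> (gen [c]) - lt (\<Delta> c) \<in> fsupp {w \<in> wset (basis_pos CC) (sdeg CC) (dg c). 2 \<le> length w}"
proof -
  assume c: "c \<in> S"
  have "\<Psi> (gen [c]) \<in> fsupp (wset (basis_pos CC) (sdeg CC) (dg c))"
    using c gen_wset[of "[c]"] by (intro \<Psi>_props) simp
  moreover have "lin (\<lambda>w. if length w = 1 then gen (hd w) else 0) (\<Psi> (gen [c])) = \<Delta> c"
    using \<Psi>_props(6)[of c] c by (simp add: linear_part_def S_iff)
  ultimately show ?thesis using length_one_part[of "\<Psi> (gen [c])" "dg c"] dg2[OF c] by simp
qed

text \<open>\<open>m\<close> stands for one of \<open>(1 \<otimes> \<epsilon>)q\<close>, \<open>(\<epsilon> \<otimes> 1)q\<close>.\<close>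

lemma counit_letter:
  assumes m: "lmap m" "\<And>p q. m (cat p q) = cat (m p) (m q)" "m (gen []) = gen []"
    and ml: "\<And>l. l \<in> basis_pos CC \<Longrightarrow> m (gen [l]) \<in> fsupp (WS S dg 0 (sdeg CC l) 1)"
    and m\<Delta>: "m (lt (\<Delta> c)) = gen [c]" and c: "c \<in> S"
  shows "m (\<Psi> (gen [c])) - gen [c] \<in> fsupp (WS S dg 0 (dg c) 2)"
proof -
  have mw: "m (gen w) \<in> fsupp (WS S dg 0 (wdeg (sdeg CC) w) (length w))" if "set w \<subseteq> basis_pos CC" for w
    using that
  proof (induction w)
    case (Cons l w)
    have "m (gen (l # w)) = cat (m (gen [l])) (m (gen w))" using m(2)[of "gen [l]" "gen w"] by simp
    also have "\<dots> \<in> fsupp (WS S dg 0 (wdeg (sdeg CC) (l # w)) (length (l # w)))"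
      by (rule cat_WS[OF ml Cons.IH]) (use Cons in auto)
    finally show ?case .
  qed (simp add: m(3) WS_def)
  have "m (\<Psi> (gen [c]) - lt (\<Delta> c)) \<in> fsupp (WS S dg 0 (dg c) 2)"
  proof (rule lmap_mem[OF m(1) \<Psi>_letter[OF c] subspace_fsupp])
    fix w assume "w \<in> {w \<in> wset (basis_pos CC) (sdeg CC) (dg c). 2 \<le> length w}"
    then show "m (gen w) \<in> fsupp (WS S dg 0 (dg c) 2)"
      by (intro subsetD[OF fsupp_mono mw[of w]]) (auto simp: wset_def WS_def)
  qed
  then show ?thesis by (simp add: lmap_diff[OF m(1)] m\<Delta>)
qed

lemma \<psi>_keys: "w \<in> lists S \<Longrightarrow> (u, v) \<in> Poly_Mapping.keys (\<psi> w) \<Longrightarrow>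
    u \<in> lists S \<and> v \<in> lists S \<and> wdeg dg u + wdeg dg v = wdeg dg w"
  using fsuppD[OF \<psi>_tset, of w "(u, v)"] by (simp add: tset_def)

lemma wdeg_0: "w \<in> lists S \<Longrightarrow> wdeg dg w = 0 \<longleftrightarrow> w = []"
  using dg1[of "hd w"] by (cases w) auto

text \<open>The product of the two augmentations after \<psi> is the augmentation, because a pair of
  empty words has degree 0.\<close>

lemma eps_eps: "w \<in> lists S \<Longrightarrow> lin (\<lambda>(a, b). if a = [] \<and> b = [] then x else 0) (\<psi> w) = (if w = [] then x else 0)"
proof (cases "w = []")
  case False
  assume w: "w \<in> lists S"
  have "lin (\<lambda>(a, b). if a = [] \<and> b = [] then x else 0) (\<psi> w) = lin (\<lambda>_. 0) (\<psi> w)"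
  proof (rule lin_cong[OF refl], clarify)
    fix a b assume "(a, b) \<in> Poly_Mapping.keys (\<psi> w)"
    from \<psi>_keys[OF w this] show "(if a = [] \<and> b = [] then x else 0) = 0"
      using wdeg_0[OF w] False by auto
  qed
  then show ?thesis using False by simp
qed (simp add: \<psi>_Nil)

lemma counits: assumes w: "w \<in> lists S" shows "eR (\<psi> w) = gen w" "eL (\<psi> w) = gen w"
proof -
  show "eR (\<psi> w) = gen w"
  proof (rule idempotent_unipotent[OF _ _ _ _ w])
    show "eR (\<psi> (u @ v)) = cat (eR (\<psi> u)) (eR (\<psi> v))" if "u \<in> lists S" "v \<in> lists S" for u v
      using that by (simp add: \<psi>_append eRL_mul)
    show "eR (\<psi> []) = gen []" by (simp add: \<psi>_Nil eR_def)
    show "eR (\<psi> [c]) - gen [c] \<in> fsupp (WS S dg 0 (dg c) 2)" if c: "c \<in> S" for c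
      unfolding \<psi>_mil
    proof (rule counit_letter[of "\<lambda>x. eR (mil x)"])
      show lm: "lmap (\<lambda>x. eR (mil x))" unfolding milgram_def by (intro lmap_intros)
      have l: "eR (mil (gen [(x, y)])) = (if y = e then gen [x] else 0)" for x y
        by (simp add: mil_letter eR_def)
      show "eR (mil (gen [l])) \<in> fsupp (WS S dg 0 (sdeg CC l) 1)" if "l \<in> basis_pos CC" for l
        using that unit(2) by (cases l) (auto simp: l basis_CC sdeg_CC_unit WS_def S_iff)
      have "eR (mil (lt (\<Delta> c))) = lt (lin (\<lambda>(x, y). if y = e then gen x else 0) (\<Delta> c))"
        unfolding lmap_comp_lt[OF lm] lin_lt[symmetric]
        by (rule lin_cong[OF refl]) (auto simp: l)
      then show "eR (mil (lt (\<Delta> c))) = gen [c]" using C_props(6) c by (simp add: S_iff)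
    qed (use c in \<open>simp_all add: mil_cat eRL_mul mil_Nil, simp add: eR_def\<close>)
    show "lin (\<lambda>w. eR (\<psi> w)) (eR (\<psi> w)) = eR (\<psi> w)" if w: "w \<in> lists S" for w
    proof -
      have "lin (\<lambda>w. eR (\<psi> w)) (eR (\<psi> w)) = lin (\<lambda>(u, v). lin (\<lambda>(a, b). if b = [] \<and> v = [] then gen a else 0) (\<psi> u)) (\<psi> w)"
        unfolding eR_def lin_lin by (rule lin_cong[OF refl]) (auto simp: case_prod_unfold)
      also have "\<dots> = lin (\<lambda>(u, v). lin (\<lambda>(a, b). if a = [] \<and> b = [] then gen u else 0) (\<psi> v)) (\<psi> w)"
        by (rule \<psi>_coassoc[OF w])
      also have "\<dots> = eR (\<psi> w)"
        unfolding eR_def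
      proof (rule lin_cong[OF refl], clarify)
        fix u v assume "(u, v) \<in> Poly_Mapping.keys (\<psi> w)"
        then show "lin (\<lambda>(a, b). if a = [] \<and> b = [] then gen u else 0) (\<psi> v) = (if v = [] then gen u else 0)"
          using \<psi>_keys[OF w] by (intro eps_eps) blast
      qed
      finally show ?thesis .
    qed
  qed
  show "eL (\<psi> w) = gen w"
  proof (rule idempotent_unipotent[OF _ _ _ _ w])
    show "eL (\<psi> (u @ v)) = cat (eL (\<psi> u)) (eL (\<psi> v))" if "u \<in> lists S" "v \<in> lists S" for u v
      using that by (simp add: \<psi>_append eRL_mul)
    show "eL (\<psi> []) = gen []" by (simp add: \<psi>_Nil eL_def)
    show "eL (\<psi> [c]) - gen [c] \<in> fsupp (WS S dg 0 (dg c) 2)" if c: "c \<in> S" for c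
      unfolding \<psi>_mil
    proof (rule counit_letter[of "\<lambda>x. eL (mil x)"])
      show lm: "lmap (\<lambda>x. eL (mil x))" unfolding milgram_def by (intro lmap_intros)
      have l: "eL (mil (gen [(x, y)])) = (if x = e \<and> y \<noteq> e then gen [y] else 0)" for x y
        by (simp add: mil_letter eL_def)
      show "eL (mil (gen [l])) \<in> fsupp (WS S dg 0 (sdeg CC l) 1)" if "l \<in> basis_pos CC" for l
        using that unit(2) by (cases l) (auto simp: l basis_CC sdeg_CC_unit WS_def S_iff)
      \<comment> \<open>Milgram's map tests the second component first, so on the letter
        \<open>(e, e)\<close> the expected formula fails. That letter is excluded from the
        comultiplication of \<open>c\<close> by degree.\<close>
      have cb: "c \<in> basis C" "deg C c \<noteq> 0" using c deg_S[OF c] by (auto simp: S_iff)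
      have "eL (mil (lt (\<Delta> c))) = lt (lin (\<lambda>(x, y). if x = e then gen y else 0) (\<Delta> c))"
        unfolding lmap_comp_lt[OF lm] lin_lt[symmetric]
      proof (rule lin_cong[OF refl], clarify)
        fix x y assume "(x, y) \<in> Poly_Mapping.keys (\<Delta> c)"
        from C_props(3)[OF cb(1) this] show "eL (mil (gen [(x, y)])) = lt (if x = e then gen y else 0)"
          using cb(2) unit(2) by (auto simp: l)
      qed
      then show "eL (mil (lt (\<Delta> c))) = gen [c]" using C_props(5) c by (simp add: S_iff)
    qed (use c in \<open>simp_all add: mil_cat eRL_mul mil_Nil, simp add: eL_def\<close>)
    show "lin (\<lambda>w. eL (\<psi> w)) (eL (\<psi> w)) = eL (\<psi> w)" if w: "w \<in> lists S" for w
    proof -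
      have "lin (\<lambda>w. eL (\<psi> w)) (eL (\<psi> w)) = lin (\<lambda>(u, v). lin (\<lambda>(a, b). if u = [] \<and> a = [] then gen b else 0) (\<psi> v)) (\<psi> w)"
        unfolding eL_def lin_lin by (rule lin_cong[OF refl]) (auto simp: case_prod_unfold)
      also have "\<dots> = lin (\<lambda>(u, v). lin (\<lambda>(a, b). if a = [] \<and> b = [] then gen v else 0) (\<psi> u)) (\<psi> w)"
        by (rule \<psi>_coassoc[OF w, symmetric])
      also have "\<dots> = eL (\<psi> w)"
        unfolding eL_def
      proof (rule lin_cong[OF refl], clarify)
        fix u v assume "(u, v) \<in> Poly_Mapping.keys (\<psi> w)"
        then show "lin (\<lambda>(a, b). if a = [] \<and> b = [] then gen v else 0) (\<psi> u) = (if u = [] then gen v else 0)"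
          using \<psi>_keys[OF w] by (intro eps_eps) blast
      qed
      finally show ?thesis .
    qed
  qed
qed

abbreviation "dA \<equiv> der dg D"

definition dT :: "('b list \<times> 'b list \<Rightarrow>\<^sub>0 'r) \<Rightarrow> ('b list \<times> 'b list \<Rightarrow>\<^sub>0 'r)" where
  "dT = lin (\<lambda>(u, v). tens (dA (gen u)) (gen v) + smul (sg (wdeg dg u)) (tens (gen u) (dA (gen v))))"

lemma lmap_dT [simp]: "lmap dT" by (simp add: dT_def)

lemma lmap_dT' [lmap_intros]: "lmap f \<Longrightarrow> lmap (\<lambda>x. dT (f x))" unfolding dT_def by (intro lmap_intros)

lemma dT_gen: "dT (gen (u, v)) = tens (dA (gen u)) (gen v) + smul (sg (wdeg dg u)) (tens (gen u) (dA (gen v)))"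
  by (simp add: dT_def)

lemma dA_wset: "w \<in> lists S \<Longrightarrow> dA (gen w) \<in> fsupp (wset S dg (wdeg dg w - 1))"
proof -
  assume "w \<in> lists S"
  then have "dA (gen w) \<in> fsupp (WS S dg 1 (wdeg dg w) (length w + 0))"
    by (intro der_WS) (use D_WS in auto)
  then show ?thesis by (rule subsetD[OF fsupp_mono, rotated]) (auto simp: WS_def wset_def)
qed

lemma sg_mult_pred: "u \<in> lists S \<Longrightarrow> u \<noteq> [] \<Longrightarrow> sg (k * (wdeg dg u - 1)) = (sg (k * wdeg dg u) * sg k :: 'r)"
  using wdeg_0[of u] by (cases "wdeg dg u") (auto simp: mult_ac)

lemma dA_append: "dA (gen (u @ v)) = cat (dA (gen u)) (gen v) + smul (sg (wdeg dg u)) (cat (gen u) (dA (gen v)))"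
  using der_cat[of "gen u" UNIV dg "wdeg dg u" D "gen v"] by (simp add: wset_def)

lemma dT_mul:
  assumes p: "p \<in> fsupp (tset m)" and q: "q \<in> fsupp (tset n)"
  shows "dT (tensor_mul dg dg p q) = tensor_mul dg dg (dT p) q + smul (sg m) (tensor_mul dg dg p (dT q))"
proof (rule lmap_eq_onI[OF p, of "\<lambda>p. dT (tensor_mul dg dg p q)"]; (intro lmap_intros)?)
  fix x assume "x \<in> tset m"
  then obtain u v where x: "x = (u, v)" "u \<in> lists S" "v \<in> lists S" and m: "m = wdeg dg u + wdeg dg v"
    by (auto simp: tset_def)
  show "dT (tensor_mul dg dg (gen x) q) = tensor_mul dg dg (dT (gen x)) q + smul (sg m) (tensor_mul dg dg (gen x) (dT q))"
  proof (rule lmap_eq_onI[OF q, of "\<lambda>q. dT (tensor_mul dg dg (gen x) q)"]; (intro lmap_intros)?)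
    fix y assume "y \<in> tset n"
    then obtain u' v' where y: "y = (u', v')" "u' \<in> lists S" "v' \<in> lists S"
      by (auto simp: tset_def)
    let ?k = "wdeg dg v * wdeg dg u'"
    have 1: "tensor_mul dg dg (tens (dA (gen u)) (gen v)) (tens (gen u') (gen v')) = smul (sg ?k) (tens (cat (dA (gen u)) (gen u')) (gen (v @ v')))"
      using tmul_tens_tens[OF gen_wset[OF x(3)] gen_wset[OF y(2)], of "dA (gen u)" "gen v'"] by simp
    have 2: "tensor_mul dg dg (tens (gen u) (dA (gen v))) (tens (gen u') (gen v'))
      = smul (sg ?k * sg (wdeg dg u')) (tens (gen (u @ u')) (cat (dA (gen v)) (gen v')))"
    \<comment> \<open>The degree \<open>wdeg dg v - 1\<close> of the differential is truncated for
      the empty word, whose differential is 0.\<close>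
    proof (cases "v = []")
      case False
      have "sg ((wdeg dg v - 1) * wdeg dg u') = (sg ?k * sg (wdeg dg u') :: 'r)"
        using sg_mult_pred[OF x(3) False, of "wdeg dg u'"] by (simp add: mult.commute)
      then show ?thesis using tmul_tens_tens[OF dA_wset[OF x(3)] gen_wset[OF y(2)], of "gen u" "gen v'"] by simp
    qed simp
    have 3: "tensor_mul dg dg (tens (gen u) (gen v)) (tens (dA (gen u')) (gen v'))
      = smul (sg ?k * sg (wdeg dg v)) (tens (cat (gen u) (dA (gen u'))) (gen (v @ v')))"
    proof (cases "u' = []")
      case False
      show ?thesis using tmul_tens_tens[OF gen_wset[OF x(3)] dA_wset[OF y(2)], of "gen u" "gen v'"] sg_mult_pred[OF y(2) False, of "wdeg dg v"] by simp
    qed simp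
    have 4: "tensor_mul dg dg (tens (gen u) (gen v)) (tens (gen u') (dA (gen v')))
      = smul (sg ?k) (tens (gen (u @ u')) (cat (gen v) (dA (gen v'))))"
      using tmul_tens_tens[OF gen_wset[OF x(3)] gen_wset[OF y(2)], of "gen u" "dA (gen v')"] by simp
    show "dT (tensor_mul dg dg (gen x) (gen y)) = tensor_mul dg dg (dT (gen x)) (gen y) + smul (sg m) (tensor_mul dg dg (gen x) (dT (gen y)))"
      unfolding x(1) y(1) m tens_gen[symmetric]
      unfolding tens_gen tmul_gen lmap_smul[OF lmap_dT] dT_gen
      using 1 2 3 4
      by (simp add: dA_append pm.scale_right_distrib mult_ac algebra_simps)
  qed
qed

subsection \<open>Milgram's map is a chain map\<close>

lemma CC_sel: "deg CC (c, d) = deg C c + deg C d"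
  "cdif CC (c, d) = tens (cdif C c) (gen d) + smul (sg (deg C c)) (tens (gen c) (cdif C d))"
  "comul CC (c, d) = lin (\<lambda>(c1, c2). lin (\<lambda>(d1, d2). smul (sg (deg C c2 * deg C d1)) (gen ((c1, d1), (c2, d2)))) (\<Delta> d)) (\<Delta> c)"
  by (simp_all add: tcoalg_def bilin_def case_prod_unfold)

definition eps :: "'b \<Rightarrow> 'r" where "eps x = (if x = e then 1 else 0)"

definition "la x = lin (\<lambda>w. gen (w, [] :: 'b list)) (ds x)"
definition "lb x = lin (\<lambda>w. gen ([] :: 'b list, w)) (ds x)"

lemma lab_unit [simp]: "la e = 0" "lb e = 0" by (simp_all add: la_def lb_def)

lemma mil_ds: "mil (desusp CC (c, d)) = smul (eps d) (la c) + smul (eps c) (lb d)"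
  by (simp add: desusp_def tcoalg_def mil_letter la_def lb_def eps_def lmap_zero[OF lmap_mil])

lemma counit_eval:
  assumes "b \<in> basis C"
  shows "lin (\<lambda>(x, y). smul (eps x) (G y)) (\<Delta> b) = G b" "lin (\<lambda>(x, y). smul (eps y) (G x)) (\<Delta> b) = G b"
  using arg_cong[OF C_props(5)[OF assms], of "lin G"] arg_cong[OF C_props(6)[OF assms], of "lin G"]
  by (simp_all add: lin_lin case_prod_unfold eps_def if_distrib if_distribR cong: if_cong)

lemma lin_eps_cdif: "b \<in> basis C \<Longrightarrow> lin (\<lambda>x. smul (eps x) (G x)) (cdif C b) = 0"
proof -
  assume b: "b \<in> basis C"
  have "lin (\<lambda>x. smul (eps x) (G x)) (cdif C b) = lin (\<lambda>x. 0) (cdif C b)"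
    by (rule lin_cong[OF refl]) (use C_props(1)[OF b] in \<open>auto simp: S_iff eps_def\<close>)
  then show ?thesis by simp
qed

text \<open>The quadratic part of the differential on \<open>(c, d)\<close> maps to four families of
  terms. Two give the quadratic parts for \<open>c\<close> and for \<open>d\<close>; the other two
  are the products of the desuspensions of \<open>c\<close> and \<open>d\<close> in both orders, and
  they cancel since the two tensor factors commute up to sign.\<close>

lemma mil_D:
  assumes c: "c \<in> basis C" and d: "d \<in> basis C"
  shows "mil (cobar_dgen CC (c, d)) = smul (eps d) (lin (\<lambda>w. gen (w, [])) (D c)) + smul (eps c) (lin (\<lambda>w. gen ([], w)) (D d))"
proof -
  let ?m = "tensor_mul dg dg"
  have mil_lin: "mil (lin (desusp CC) p) = lin (\<lambda>(x, y). smul (eps y) (la x) + smul (eps x) (lb y)) p" for p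
    unfolding lmap_comp_lin[OF lmap_mil] by (rule lin_cong[OF refl]) (auto simp: mil_ds)
  have linear: "mil (lin (desusp CC) (cdif CC (c, d))) = smul (eps d) (lin la (cdif C c)) + smul (sg (deg C c) * eps c) (lin lb (cdif C d))"
    unfolding mil_lin
    \<comment> \<open>The differential of \<open>C\<close> has no component along the unit, so no
      component of it can become a unit in either factor.\<close>
    using lin_eps_cdif[OF c, of "\<lambda>x. lb d"] lin_eps_cdif[OF d, of "\<lambda>y. la c"]
    by (simp add: CC_sel lin_tens' lin_add_fun lin_smul_fun)
  define s where "s c1 c2 d1 = (sg (deg C c2 * deg C d1) * sg (deg C c1 + deg C d1) :: 'r)" for c1 c2 d1
  have "mil (cobar_quad CC (c, d)) = lin (\<lambda>(x, y). smul (sg (deg CC x)) (?m (mil (desusp CC x)) (mil (desusp CC y)))) (comul CC (c, d))"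
    unfolding cobar_quad_def lmap_comp_lin[OF lmap_mil] by (simp add: case_prod_unfold lmap_smul[OF lmap_mil] mil_cat)
  also have "\<dots> = lin (\<lambda>(c1, c2). lin (\<lambda>(d1, d2). smul (s c1 c2 d1)
      (?m (smul (eps d1) (la c1) + smul (eps c1) (lb d1)) (smul (eps d2) (la c2) + smul (eps c2) (lb d2)))) (\<Delta> d)) (\<Delta> c)"
    by (simp add: CC_sel lin_lin case_prod_unfold mil_ds s_def del: tmul_simps sg_simps)
  also have "\<dots> = lin (\<lambda>(c1, c2). lin (\<lambda>(d1, d2). smul (eps d1) (smul (eps d2) (smul (sg (deg C c1)) (?m (la c1) (la c2))))) (\<Delta> d)) (\<Delta> c)
    + lin (\<lambda>(c1, c2). smul (eps c1) (smul (eps c2) (lin (\<lambda>(d1, d2). smul (sg (deg C d1)) (?m (lb d1) (lb d2))) (\<Delta> d)))) (\<Delta> c)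
    + lin (\<lambda>(c1, c2). smul (eps c2) (lin (\<lambda>(d1, d2). smul (eps d1) (smul (sg (deg C c1)) (?m (la c1) (lb d2)))) (\<Delta> d))) (\<Delta> c)
    + lin (\<lambda>(c1, c2). smul (eps c1) (lin (\<lambda>(d1, d2). smul (eps d2) (smul (sg (deg C c2 * deg C d1) * sg (deg C d1)) (?m (lb d1) (la c2)))) (\<Delta> d))) (\<Delta> c)"
  proof -
    have 1: "smul (s c1 c2 d1) (?m (smul (eps d1) (la c1) + smul (eps c1) (lb d1)) (smul (eps d2) (la c2) + smul (eps c2) (lb d2)))
      = smul (eps d1) (smul (eps d2) (smul (sg (deg C c1)) (?m (la c1) (la c2))))
      + smul (eps c1) (smul (eps c2) (smul (sg (deg C d1)) (?m (lb d1) (lb d2))))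
      + smul (eps c2) (smul (eps d1) (smul (sg (deg C c1)) (?m (la c1) (lb d2))))
      + smul (eps c1) (smul (eps d2) (smul (sg (deg C c2 * deg C d1) * sg (deg C d1)) (?m (lb d1) (la c2))))" for c1 c2 d1 d2
      unfolding eps_def s_def using unit(2)
      \<comment> \<open>The maps \<open>la\<close> and \<open>lb\<close> vanish on the unit, which
        removes all terms not listed. In the others the unit has degree 0, and this simplifies the
        Koszul sign.\<close>
      by (cases "c1 = e"; cases "c2 = e"; cases "d1 = e"; cases "d2 = e") (simp_all add: pm.scale_right_distrib)
    show ?thesis unfolding 1 by (simp add: lin_add_fun lin_smul_fun case_prod_unfold del: pm.scale_scale)
  qed
  also have "lin (\<lambda>(c1, c2). smul (eps c2) (lin (\<lambda>(d1, d2). smul (eps d1) (smul (sg (deg C c1)) (?m (la c1) (lb d2)))) (\<Delta> d))) (\<Delta> c)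
    = smul (sg (deg C c)) (?m (la c) (lb d))"
    by (simp add: counit_eval[OF d] counit_eval(2)[OF c] del: pm.scale_scale)
  also have "lin (\<lambda>(c1, c2). smul (eps c1) (lin (\<lambda>(d1, d2). smul (eps d2) (smul (sg (deg C c2 * deg C d1) * sg (deg C d1)) (?m (lb d1) (la c2)))) (\<Delta> d))) (\<Delta> c)
    = smul (sg (deg C c * deg C d) * sg (deg C d)) (?m (lb d) (la c))"
    using counit_eval(2)[OF d, of "\<lambda>d1. smul (sg (deg C _ * deg C d1) * sg (deg C d1)) (?m (lb d1) (la _))"]
      counit_eval(1)[OF c, of "\<lambda>c2. smul (sg (deg C c2 * deg C d) * sg (deg C d)) (?m (lb d) (la c2))"] by simp
  also have "\<dots> = - smul (sg (deg C c)) (?m (la c) (lb d))"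
  \<comment> \<open>For nonunits the desuspended degrees differ by one from the original ones. The
    sign from exchanging the two factors therefore becomes the opposite of the sign of the other
    order.\<close>
  proof (cases "c = e \<or> d = e")
    case False
    then have cd: "c \<in> S" "d \<in> S" using c d by (auto simp: S_iff)
    then show ?thesis using False by (simp add: la_def lb_def desusp_def deg_sdeg mult_ac)
  qed auto
  also have "lin (\<lambda>(c1, c2). lin (\<lambda>(d1, d2). smul (eps d1) (smul (eps d2) (smul (sg (deg C c1)) (?m (la c1) (la c2))))) (\<Delta> d)) (\<Delta> c)
    = smul (eps d) (lin (\<lambda>w. gen (w, [])) (cobar_quad C c))"
  proof -
    have "?m (la x) (la y) = lin (\<lambda>w. gen (w, [])) (cat (ds x) (ds y))" for x y
      by (simp add: la_def desusp_def)
    then show ?thesis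
      unfolding counit_eval(1)[OF d] cobar_quad_def by (simp add: lin_lin lin_smul_fun case_prod_unfold del: pm.scale_scale)
  qed
  also have "lin (\<lambda>(c1, c2). smul (eps c1) (smul (eps c2) (lin (\<lambda>(d1, d2). smul (sg (deg C d1)) (?m (lb d1) (lb d2))) (\<Delta> d)))) (\<Delta> c)
    = smul (eps c) (lin (\<lambda>w. gen ([], w)) (cobar_quad C d))"
  proof -
    have "?m (lb x) (lb y) = lin (\<lambda>w. gen ([], w)) (cat (ds x) (ds y))" for x y
      by (simp add: lb_def desusp_def)
    then show ?thesis
      unfolding counit_eval(1)[OF c] cobar_quad_def by (simp add: lin_lin case_prod_unfold)
  qed
  finally have quad: "mil (cobar_quad CC (c, d)) = smul (eps d) (lin (\<lambda>w. gen (w, [])) (cobar_quad C c))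
     + smul (eps c) (lin (\<lambda>w. gen ([], w)) (cobar_quad C d))" by simp
  have "smul (sg (deg C c) * eps c) x = smul (eps c) x" for x :: "'b list \<times> 'b list \<Rightarrow>\<^sub>0 'r"
    using unit(2) by (simp add: eps_def)
  then show ?thesis
    unfolding cobar_dgen_eq lmap_add[OF lmap_mil] lmap_uminus[OF lmap_mil] linear quad
    by (simp add: la_def[abs_def] lb_def[abs_def] lin_lin pm.scale_right_distrib pm.scale_right_diff_distrib)
qed

lemma mil_chain: "z \<in> fsupp (lists (basis_pos CC)) \<Longrightarrow> mil (der (sdeg CC) (cobar_dgen CC) z) = dT (mil z)"
proof (erule lmap_eq_onI[of _ _ "\<lambda>z. mil (der (sdeg CC) (cobar_dgen CC) z)"])
  show "lmap (\<lambda>z. mil (der (sdeg CC) (cobar_dgen CC) z))" "lmap (\<lambda>z. dT (mil z))"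
    unfolding milgram_def by (intro lmap_intros)+
  fix w assume "w \<in> lists (basis_pos CC)"
  then have "set w \<subseteq> basis_pos CC" by auto
  then show "mil (der (sdeg CC) (cobar_dgen CC) (gen w)) = dT (mil (gen w))"
  proof (induction w)
    case (Cons l w)
    obtain c d where l: "l = (c, d)" by (cases l)
    have lb: "(c, d) \<in> basis_pos CC" "c \<in> basis C" "d \<in> basis C" "c \<noteq> e \<or> d \<noteq> e"
      using Cons l by (auto simp: basis_CC)
    have "mil (cobar_dgen CC (c, d)) = dT (mil (gen [(c, d)]))"
      unfolding mil_D[OF lb(2,3)] mil_letter using lb(4) D_unit
      by (auto simp: eps_def dT_gen tens_def bilin_def lmap_zero[OF lmap_dT])
    moreover have "mil (gen w) \<in> fsupp (tset (wdeg (sdeg CC) w))"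
      using Cons by (intro mil_tset) (simp add: wset_def)
    moreover have "mil (gen (l # w)) = tensor_mul dg dg (mil (gen [l])) (mil (gen w))"
      using mil_cat[of "gen [l]" "gen w"] by simp
    ultimately show ?case
      using Cons l dT_mul[OF mil_letter_tset[OF lb(1)]]
      by (simp add: lmap_add[OF lmap_mil] lmap_smul[OF lmap_mil] mil_cat)
  qed (simp add: mil_Nil dT_gen lmap_zero)
qed

lemma \<psi>_lin: "x \<in> fsupp (lists S) \<Longrightarrow> lin \<psi> x = mil (\<Psi> x)"
  using linear_on_eq_lin[OF \<Psi>_props(1), of x] by (simp add: lmap_comp_lin[OF lmap_mil] \<psi>_mil[abs_def])

lemma dA_lists: "x \<in> fsupp (lists S) \<Longrightarrow> dA x \<in> fsupp (lists S)"
  by (erule lmap_mem[OF lmap_der' _ subspace_fsupp]) (rule fsupp_wset_lists[OF dA_wset])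

lemma \<psi>_chain: "w \<in> lists S \<Longrightarrow> lin \<psi> (dA (gen w)) = dT (\<psi> w)"
proof -
  assume w: "w \<in> lists S"
  then have g: "gen w \<in> (fsupp (lists S) :: (_ \<Rightarrow>\<^sub>0 'r) set)" by simp
  have "\<Psi> (gen w) \<in> fsupp (lists (basis_pos CC))"
    by (rule fsupp_wset_lists[OF \<Psi>_props(2)[OF gen_wset[OF w]]])
  then show ?thesis
    by (simp add: \<psi>_lin[OF dA_lists[OF g]] \<Psi>_props(5)[OF g] mil_chain \<psi>_mil)
qed

sublocale bi?: tensor_bialgebra S dg D \<psi>
proof
  show "w \<in> lists S \<Longrightarrow> \<psi> w \<in> fsupp {(u, v). u \<in> lists S \<and> v \<in> lists S \<and> wdeg dg u + wdeg dg v = wdeg dg w}" for w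
    using \<psi>_tset by (simp add: tset_def)
  show "w \<in> lists S \<Longrightarrow> lin (\<lambda>(u, v). lin (\<lambda>(a, b). gen (a, b, v)) (\<psi> u)) (\<psi> w)
      = lin (\<lambda>(u, v). lin (\<lambda>(a, b). gen (u, a, b)) (\<psi> v)) (\<psi> w)" for w
    by (rule \<psi>_coassoc)
  show "w \<in> lists S \<Longrightarrow> lin \<psi> (dA (gen w)) = lin (\<lambda>(u, v). tens (dA (gen u)) (gen v) + smul (sg (wdeg dg u)) (tens (gen u) (dA (gen v)))) (\<psi> w)" for w
    using \<psi>_chain by (simp add: dT_def)
qed (use counits D_WS in \<open>auto simp: dg2 der_der \<psi>_Nil \<psi>_append eR_def eL_def\<close>)

subsection \<open>The double-loop construction\<close>

abbreviation "PC \<equiv> path_coalg C"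

lemma basis_PC: "basis_pos PC = SE"
proof (rule set_eqI)
  fix x show "x \<in> basis_pos PC \<longleftrightarrow> x \<in> SE"
    using deg_S by (cases x) (fastforce simp: basis_pos_def path_coalg_def)+
qed

lemma sdeg_PC: "sdeg PC = edg"
  by (rule ext) (simp add: sdeg_def path_coalg_def edg_def split: sum.splits)

lemma ds_PC: "desusp PC (Inl x) = lin inl (ds x)" "desusp PC (Inr x) = gen [Inr x]"
  by (auto simp: desusp_def path_coalg_def)

lemma lam_ds: "lam [x] = gen [Inr x]" "lin lam (ds x) = (if x = e then 0 else gen [Inr x])"
  by (simp_all add: desusp_def)

lemma ds_pbar: "lin (desusp PC) (pbar C x) = lin lam (ds x)"
  by (simp add: pbar_def ds_PC lam_ds)

lemma lin_dsum: "lin (desusp PC) (lin pinc p) = lin inl (lin ds p)" "lin (desusp PC) (lin (pbar C) p) = lin lam (lin ds p)"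
  by (simp_all add: lin_lin pinc_def ds_PC ds_pbar)

lemma deg_PC: "deg PC (Inl x) = deg C x" "deg PC (Inr x) = deg C x - 1"
  by (simp_all add: path_coalg_def)

lemma comul_PC: "comul PC (Inl x) = lin (\<lambda>(a, b). gen (Inl a, Inl b)) (\<Delta> x)"
  by (simp add: path_coalg_def tmap_0 pinc_def)

text \<open>The comultiplication of a barred element bars one tensor factor at a time. After
  desuspension this is the derivation \<open>lam\<close> applied to the quadratic part, and the sign
  comes from the degree shift in the left factor.\<close>

lemma cobar_dgen_PC: "c \<in> SE \<Longrightarrow> cobar_dgen PC c = ED c"
proof (cases c)
  case (Inl x)
  have "cobar_quad PC (Inl x) = lin inl (cobar_quad C x)"
    by (simp add: cobar_quad_def comul_PC deg_PC lin_lin case_prod_unfold ds_PC lin_inl_cat)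
  moreover have "x \<noteq> e" if "c \<in> SE" using that Inl by (auto simp: S_iff)
  moreover have "cdif PC (Inl x) = lin pinc (cdif C x) - pbar C x" by (simp add: path_coalg_def)
  ultimately show "c \<in> SE \<Longrightarrow> cobar_dgen PC c = ED c"
    using Inl by (simp add: cobar_dgen_eq lin_dsum ds_pbar lam_ds ED_def)
next
  case (Inr x)
  show "c \<in> SE \<Longrightarrow> cobar_dgen PC c = ED c"
  proof -
    assume "c \<in> SE"
    then have x: "x \<in> basis C" using Inr by (auto simp: S_iff)
    let ?Q = "\<lambda>(a, b). smul (sg (deg PC a)) (cat (desusp PC a) (desusp PC b))"
    have comul: "comul PC (Inr x) = lin (\<lambda>(a, b). tens (pbar C a) (gen (Inl b)) + smul (sg (deg C a)) (tens (gen (Inl a)) (pbar C b))) (\<Delta> x)"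
      by (simp add: path_coalg_def tmap_def pinc_def[abs_def] lin_add_fun case_prod_unfold)
    have "cobar_quad PC (Inr x) = lin (\<lambda>(a, b). lin ?Q (tens (pbar C a) (gen (Inl b))) + smul (sg (deg C a)) (lin ?Q (tens (gen (Inl a)) (pbar C b)))) (\<Delta> x)"
      unfolding cobar_quad_def comul lin_lin by (simp add: case_prod_unfold)
    also have "\<dots> = lin (\<lambda>(a, b). - smul (sg (deg C a)) (lin lam (cat (ds a) (ds b)))) (\<Delta> x)"
    proof (rule lin_cong[OF refl], clarify)
      fix a b assume "(a, b) \<in> Poly_Mapping.keys (\<Delta> x)"
      then have ab: "a \<in> basis C" "b \<in> basis C" using C_props(3)[OF x] by auto
      have q2: "lin ?Q (tens (gen (Inl a)) (pbar C b)) = smul (sg (deg C a)) (cat (lin inl (ds a)) (lin lam (ds b)))"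
        by (simp add: lin_tens' lin_smul_fun lmap_comp_lin[OF lmap_cat(1), symmetric] deg_PC ds_PC ds_pbar del: desusp_unit)
      show "lin ?Q (tens (pbar C a) (gen (Inl b))) + smul (sg (deg C a)) (lin ?Q (tens (gen (Inl a)) (pbar C b)))
        = - smul (sg (deg C a)) (lin lam (cat (ds a) (ds b)))"
      proof (cases "a = e")
        case True
        have "lin ?Q (tens (pbar C a) (gen (Inl b))) = 0" by (simp add: True pbar_def)
        then show ?thesis unfolding q2 using True by simp
      next
        case False
        then have a: "a \<in> S" using ab by (simp add: S_iff)
        have q1: "lin ?Q (tens (pbar C a) (gen (Inl b))) = smul (sg (dg a)) (cat (lin lam (ds a)) (lin inl (ds b)))"
          using False by (simp add: pbar_def lin_tens' deg_PC ds_PC lam_ds sdeg_def)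
        have "lin lam (cat (ds a) (ds b)) = cat (lin lam (ds a)) (lin inl (ds b)) + smul (sg (dg a)) (cat (lin inl (ds a)) (lin lam (ds b)))"
          by (rule lin_lam_cat[OF ds_wset[OF ab(1)]])
        then show ?thesis unfolding q1 q2 by (simp add: sg_dg[OF a] pm.scale_right_distrib)
      qed
    qed
    also have "\<dots> = - lin lam (cobar_quad C x)"
      by (simp add: cobar_quad_def lin_lin case_prod_unfold lin_uminus_fun)
    finally have "cobar_quad PC (Inr x) = - lin lam (cobar_quad C x)" .
    moreover have "cdif PC (Inr x) = - lin (pbar C) (cdif C x)" by (simp add: path_coalg_def)
    ultimately show ?thesis using Inr by (simp add: cobar_dgen_eq lin_dsum ED_def)
  qed
qed

lemma dE_PC: "x \<in> fsupp (lists SE) \<Longrightarrow> der edg (cobar_dgen PC) x = dE x"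
  by (erule der_cong) (rule cobar_dgen_PC)

abbreviation "p2 \<equiv> cobar_map PC C path_proj"

lemma p2_aext: "p2 = aext (case_sum ds (\<lambda>_. 0))"
proof -
  have "(\<lambda>c. lin ds (path_proj c)) = case_sum ds (\<lambda>_. 0)"
    by (rule ext) (simp add: path_proj_def split: sum.splits)
  then show ?thesis by (simp add: cobar_map_def)
qed

lemma p2_wset: "p2 (gen y) \<in> fsupp (wset UNIV dg (wdeg edg y))"
proof (induction y)
  case (Cons c y)
  show ?case
  proof (cases c)
    case (Inl x)
    have "ds x \<in> fsupp (wset UNIV dg (dg x))" by (simp add: desusp_def wset_def)
    then show ?thesis using Inl Cons by (auto simp: p2_aext alg_ext_Cons intro!: cat_wset)
  qed (simp add: p2_aext alg_ext_Cons)
qed (simp add: p2_aext wset_def)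

lemma p2_inl: "w \<in> lists S \<Longrightarrow> p2 (inl w) = gen w"
  by (induction w) (auto simp: p2_aext alg_ext_Cons desusp_def S_iff)

lemma p2_lam: "p2 (lam w) = 0"
  by (induction w) (simp_all add: p2_aext alg_ext_Cons aext_cat)

lemma kappa_lam: "kappa C w = - lam w"
  by (induction w) (simp_all add: kappa_def lam_def)

abbreviation "RR \<equiv> tmap 0 (wdeg (sdeg PC)) gen (\<lambda>w. p2 (gen w))"

lemma RR_eq: "RR = lin (\<lambda>(x, y). tens (gen x) (p2 (gen y)))"
  by (simp add: tmap_0)

lemma RR_tens: "RR (tens p q) = tens p (p2 q)"
proof -
  have l: "lmap p2" by (simp add: p2_aext)
  show ?thesis unfolding RR_eq
    by (rule bilin_eqI[where m = "\<lambda>p q. lin (\<lambda>(x, y). tens (gen x) (p2 (gen y))) (tens p q)"]; (intro lmap_intros)?)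
     (use l in \<open>simp_all add: lmap_tens linear_on_def\<close>)
qed

lemma RR_mul: "RR (tensor_mul edg edg p q) = tensor_mul edg dg (RR p) (RR q)"
  unfolding RR_eq
proof (rule bilin_eqI[where m = "\<lambda>p q. lin (\<lambda>(x, y). tens (gen x) (p2 (gen y))) (tensor_mul edg edg p q)"
      and m' = "\<lambda>p q. tensor_mul edg dg (lin (\<lambda>(x, y). tens (gen x) (p2 (gen y))) p) (lin (\<lambda>(x, y). tens (gen x) (p2 (gen y))) q)"];
    (intro lmap_intros)?)
  fix x y :: "('b + 'b) list \<times> ('b + 'b) list"
  obtain a b a' b' where xy: "x = (a, b)" "y = (a', b')" by (cases x, cases y)
  have "tensor_mul edg dg (tens (gen a) (p2 (gen b))) (tens (gen a') (p2 (gen b')))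
    = smul (sg (wdeg edg b * wdeg edg a')) (tens (cat (gen a) (gen a')) (cat (p2 (gen b)) (p2 (gen b'))))"
    using tmul_tens_tens[OF p2_wset[of b], where q = "gen a'" and T = UNIV and n = "wdeg edg a'" and a = edg and p = "gen a" and q' = "p2 (gen b')"]
    by (simp add: wset_def)
  moreover have "cat (p2 (gen b)) (p2 (gen b')) = p2 (gen (b @ b'))" by (simp add: p2_aext aext_append)
  ultimately show "lin (\<lambda>(x, y). tens (gen x) (p2 (gen y))) (tensor_mul edg edg (gen x) (gen y))
    = tensor_mul edg dg (lin (\<lambda>(x, y). tens (gen x) (p2 (gen y))) (gen x)) (lin (\<lambda>(x, y). tens (gen x) (p2 (gen y))) (gen y))"
    by (simp add: xy)
qed

text \<open>Both maps are multiplicative, so letters suffice. On a barred letter the summand with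
  \<kappa> in the right factor dies under \<Omega>\<pi>, and the remaining one is \<open>lam\<close>
  in the left factor.\<close>

lemma RR_path_psi: "x \<in> fsupp (lists SE) \<Longrightarrow> RR (path_psi (C, \<Psi>) x) = rho x"
proof (erule lmap_eq_onI[of _ _ "\<lambda>x. RR (path_psi (C, \<Psi>) x)"])
  show "lmap (\<lambda>x. RR (path_psi (C, \<Psi>) x))" unfolding RR_eq path_psi_def prod.case by (intro lmap_intros)
  fix w assume "w \<in> lists SE"
  then show "RR (path_psi (C, \<Psi>) (gen w)) = rho (gen w)"
  proof (induction w)
    case Nil
    have "p2 (gen []) = gen []" by (simp add: p2_aext)
    then have "RR (gen ([], [])) = gen ([], [])" using RR_tens[of "gen []" "gen []"] by (simp only: tens_gen)
    then show ?case by (simp add: path_psi_def rho_letters)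
  next
    case (Cons l w)
    have cc: "path_psi (C, \<Psi>) (gen (l # w)) = tensor_mul edg edg (path_psi (C, \<Psi>) (gen [l])) (path_psi (C, \<Psi>) (gen w))"
      by (simp add: path_psi_def sdeg_PC alg_ext_Cons)
    have "RR (path_psi (C, \<Psi>) (gen [l])) = rho (gen [l])"
    proof (cases l)
      case (Inl x)
      then have x: "[x] \<in> lists S" using Cons by auto
      have "path_psi (C, \<Psi>) (gen [l]) = lin (\<lambda>(u, v). tens (inl u) (inl v)) (\<psi> [x])"
        using Inl by (simp add: path_psi_def alg_ext_Cons tmap_0 cobar_inc_def \<psi>_def)
      then have "RR (path_psi (C, \<Psi>) (gen [l])) = lin (\<lambda>(u, v). RR (tens (inl u) (inl v))) (\<psi> [x])"
        by (simp add: RR_eq lin_lin case_prod_unfold)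
      also have "\<dots> = rho (gen [l])"
        unfolding Inl rho_letters
      proof (rule lin_cong[OF refl], clarify)
        fix u v assume "(u, v) \<in> Poly_Mapping.keys (\<psi> [x])"
        then have "v \<in> lists S" using \<psi>_keys[OF x] by blast
        then show "RR (tens (inl u) (inl v)) = tens (inl u) (gen v)" unfolding RR_tens by (simp only: p2_inl)
      qed
      finally show ?thesis .
    next
      case (Inr x)
      then have x: "[x] \<in> lists S" using Cons by auto
      have "path_psi (C, \<Psi>) (gen [l]) = lin (\<lambda>(u, v). tens (lam u) (inl v) + smul (sg (wdeg dg u)) (tens (inl u) (lam v))) (\<psi> [x])"
        using Inr by (simp add: path_psi_def alg_ext_Cons tmap_def cobar_inc_def \<psi>_def kappa_lam lin_add_fun lin_uminus_fun case_prod_unfold)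
      then have "RR (path_psi (C, \<Psi>) (gen [l])) = lin (\<lambda>(u, v). RR (tens (lam u) (inl v)) + smul (sg (wdeg dg u)) (RR (tens (inl u) (lam v)))) (\<psi> [x])"
        by (simp add: RR_eq lin_lin case_prod_unfold)
      also have "\<dots> = rho (gen [l])"
        unfolding Inr rho_letters
      proof (rule lin_cong[OF refl], clarify)
        fix u v assume "(u, v) \<in> Poly_Mapping.keys (\<psi> [x])"
        then have "v \<in> lists S" using \<psi>_keys[OF x] by blast
        then show "RR (tens (lam u) (inl v)) + smul (sg (wdeg dg u)) (RR (tens (inl u) (lam v))) = tens (lam u) (gen v)"
          unfolding RR_tens by (simp add: p2_inl p2_lam)
      qed
      finally show ?thesis .
    qed
    then show ?case using Cons cc rho_cat[of "gen [l]" "gen w"] by (simp add: RR_mul)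
  qed
qed simp

lemma double_loop_sel: "mul (double_loop (C, \<Psi>)) = cat" "one (double_loop (C, \<Psi>)) = gen []"
  "dif (double_loop (C, \<Psi>)) = der edg (cobar_dgen PC)"
  using cobar_sel[of PC] by (simp_all add: double_loop_def sdeg_PC)

lemma double_loop_grade: "grade (double_loop (C, \<Psi>)) n = K n"
proof -
  have "RR (path_psi (C, \<Psi>) x) = rho x" if "x \<in> fsupp (wset SE edg n)" for x
    using RR_path_psi[OF fsupp_wset_lists[OF that]] .
  then show ?thesis
    by (auto simp: double_loop_def K_def basis_PC sdeg_PC)
qed

end

section \<open>A contraction of a coalgebra onto its homology\<close>

lemma lin_lmap: "lmap f \<Longrightarrow> lin (\<lambda>x. f (gen x)) p = f p"
  using lmap_eq_lin by metis

locale hom_model = aw_setup C \<Psi>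
  for C :: "('b, 'r::comm_ring_1) coalg" and \<Psi> :: "('b list \<Rightarrow>\<^sub>0 'r) \<Rightarrow> (('b \<times> 'b) list \<Rightarrow>\<^sub>0 'r)" +
  fixes H :: "('h, 'r) coalg" and \<zeta> :: "'h \<Rightarrow> ('b \<Rightarrow>\<^sub>0 'r)"
  assumes \<zeta>_cycles: "h \<in> basis H \<Longrightarrow> \<zeta> h \<in> cycles (cgrade C) (lin (cdif C)) (deg H h)"
    and \<zeta>_bij: "bij_betw (\<lambda>x. hrel (cgrade C) (lin (cdif C)) n `` {lin \<zeta> x}) (cgrade H n) (homology (cgrade C) (lin (cdif C)) n)"
begin

abbreviation "G \<equiv> cgrade C"
abbreviation "d \<equiv> lin (cdif C)"
abbreviation "bd n \<equiv> d ` G (Suc n)"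

lemma G_fsupp: "G n = fsupp {b \<in> basis C. deg C b = n}" "cgrade H n = fsupp {h \<in> basis H. deg H h = n}"
  by (auto simp: cgrade_def fsupp_def)

lemma subspace_bd: "pm.subspace (bd n)"
  by (rule subspace_image) (simp_all add: G_fsupp)

lemma cdif_G: "b \<in> basis C \<Longrightarrow> deg C b = Suc n \<Longrightarrow> cdif C b \<in> G n"
  using C_props(1) by (fastforce simp: G_fsupp fsupp_def S_iff)

lemma d_G: "x \<in> G (Suc n) \<Longrightarrow> d x \<in> G n"
  unfolding G_fsupp by (erule lin_mem_on) (use cdif_G in \<open>auto simp: G_fsupp\<close>)

lemma dd: "x \<in> G n \<Longrightarrow> d (d x) = 0"
  unfolding G_fsupp by (erule lmap_eq_onI[of _ _ "\<lambda>x. d (d x)"]; (intro lmap_intros)?) (simp add: C_props(2))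

lemma \<zeta>_G: "x \<in> cgrade H n \<Longrightarrow> lin \<zeta> x \<in> G n"
  unfolding G_fsupp by (erule lin_mem_on) (use \<zeta>_cycles in \<open>auto simp: cycles_def G_fsupp\<close>)

lemma d\<zeta>: "x \<in> cgrade H n \<Longrightarrow> d (lin \<zeta> x) = 0"
  unfolding G_fsupp by (erule lmap_eq_onI[of _ _ "\<lambda>x. d (lin \<zeta> x)"]; (intro lmap_intros)?) (use \<zeta>_cycles in \<open>simp add: cycles_def\<close>)

lemma representative: "z \<in> G n \<Longrightarrow> d z = 0 \<Longrightarrow> \<exists>x \<in> cgrade H n. z - lin \<zeta> x \<in> bd n"
proof -
  assume z: "z \<in> G n" "d z = 0"
  have 0: "0 \<in> bd n" by (rule pm.subspace_0[OF subspace_bd])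
  have "hrel G d n `` {z} \<in> homology G d n" using z by (auto simp: homology_def cycles_def quotient_def)
  then have "hrel G d n `` {z} \<in> (\<lambda>x. hrel G d n `` {lin \<zeta> x}) ` cgrade H n"
    by (simp only: bij_betw_imp_surj_on[OF \<zeta>_bij])
  then obtain x where x: "hrel G d n `` {z} = hrel G d n `` {lin \<zeta> x}" "x \<in> cgrade H n"
    by (rule imageE)
  have "z \<in> hrel G d n `` {z}" using z 0 by (auto simp: hrel_def cycles_def)
  then have "z \<in> hrel G d n `` {lin \<zeta> x}" by (simp only: x(1))
  then have "lin \<zeta> x - z \<in> bd n" by (simp add: hrel_def)
  then have "- (lin \<zeta> x - z) \<in> bd n" by (rule pm.subspace_neg[OF subspace_bd])
  then show ?thesis using x(2) by auto
qed

lemma \<zeta>_boundary: "x \<in> cgrade H n \<Longrightarrow> lin \<zeta> x \<in> bd n \<Longrightarrow> x = 0"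
proof -
  assume x: "x \<in> cgrade H n" "lin \<zeta> x \<in> bd n"
  have 0: "0 \<in> cgrade H n" by (simp add: G_fsupp)
  have "lin \<zeta> x - y \<in> bd n \<longleftrightarrow> lin \<zeta> 0 - y \<in> bd n" for y
    using pm.subspace_diff[OF subspace_bd _ x(2), of "lin \<zeta> x - y"] pm.subspace_add[OF subspace_bd x(2), of "- y"]
    by auto
  then have "hrel G d n `` {lin \<zeta> x} = hrel G d n `` {lin \<zeta> 0}"
    using \<zeta>_G[OF x(1)] d\<zeta>[OF x(1)] \<zeta>_G[OF 0] by (auto simp: hrel_def cycles_def)
  then show "x = 0" by (rule inj_onD[OF bij_betw_imp_inj_on[OF \<zeta>_bij[of n]] _ x(1) 0])
qed

definition \<eta> :: "nat \<Rightarrow> ('b \<Rightarrow>\<^sub>0 'r) \<Rightarrow> ('h \<Rightarrow>\<^sub>0 'r)" where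
  "\<eta> n z = (SOME x. x \<in> cgrade H n \<and> z - lin \<zeta> x \<in> bd n)"

lemma \<eta>: "z \<in> G n \<Longrightarrow> d z = 0 \<Longrightarrow> \<eta> n z \<in> cgrade H n \<and> z - lin \<zeta> (\<eta> n z) \<in> bd n"
  unfolding \<eta>_def by (rule someI_ex) (use representative in blast)

text \<open>\<open>hs m\<close> is a homotopy on degree \<open>m\<close>. As it is chosen on basis elements, no splitting of the boundaries is needed.\<close>

primrec hs :: "nat \<Rightarrow> 'b \<Rightarrow> ('b \<Rightarrow>\<^sub>0 'r)" where
  "hs 0 = (\<lambda>b. 0)"
| "hs (Suc m) = (\<lambda>b. - (SOME y. y \<in> G (Suc (Suc m)) \<and>
     d y = gen b + lin (hs m) (cdif C b) - lin \<zeta> (\<eta> (Suc m) (gen b + lin (hs m) (cdif C b)))))"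

definition pr :: "nat \<Rightarrow> 'b \<Rightarrow> ('h \<Rightarrow>\<^sub>0 'r)" where
  "pr m b = \<eta> (Suc m) (gen b + lin (hs m) (cdif C b))"

lemma G1: "G (Suc 0) = {0}" "G 2 = {0}"
proof -
  have "{b \<in> basis C. deg C b = Suc 0} = {}" "{b \<in> basis C. deg C b = 2} = {}" using conn by auto
  then show "G (Suc 0) = {0}" "G 2 = {0}" unfolding G_fsupp by (simp_all only: fsupp_empty)
qed

lemma hs_mem_lin:
  assumes "\<And>b. b \<in> basis C \<Longrightarrow> deg C b = m \<Longrightarrow> hs m b \<in> G (Suc m)" "x \<in> G m"
  shows "lin (hs m) x \<in> G (Suc m)"
  using assms(2) unfolding G_fsupp by (rule lin_mem_on) (use assms(1) in \<open>auto simp: G_fsupp\<close>)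

text \<open>The invariant \<open>d h d = - d\<close> one degree below makes
  \<open>b + h (d b)\<close> a cycle. It differs from a combination of the representing cycles by a
  boundary, and minus a filling of that boundary is the value of the homotopy.\<close>

lemma hs_step:
  assumes m: "\<And>b. b \<in> basis C \<Longrightarrow> deg C b = m \<Longrightarrow> hs m b \<in> G (Suc m)"
    "\<And>g. g \<in> G (Suc m) \<Longrightarrow> d (lin (hs m) (d g)) = - d g"
    and b: "b \<in> basis C" "deg C b = Suc m"
  shows "hs (Suc m) b \<in> G (Suc (Suc m))" "pr m b \<in> cgrade H (Suc m)"
    "d (hs (Suc m) b) = - (gen b + lin (hs m) (cdif C b) - lin \<zeta> (pr m b))"
proof -
  let ?z = "gen b + lin (hs m) (cdif C b)"
  have g: "gen b \<in> G (Suc m)" using b by (simp add: G_fsupp)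
  have "lin (hs m) (cdif C b) \<in> G (Suc m)" by (rule hs_mem_lin[OF m(1) cdif_G[OF b]])
  then have "?z \<in> G (Suc m)" using g unfolding G_fsupp by (intro add_in_fsupp)
  moreover have "d ?z = 0" using m(2)[OF g] by simp
  ultimately have e: "\<eta> (Suc m) ?z \<in> cgrade H (Suc m) \<and> ?z - lin \<zeta> (\<eta> (Suc m) ?z) \<in> bd (Suc m)" by (rule \<eta>)
  then show "pr m b \<in> cgrade H (Suc m)" by (simp add: pr_def)
  from e[THEN conjunct2] obtain y where "?z - lin \<zeta> (\<eta> (Suc m) ?z) = d y" "y \<in> G (Suc (Suc m))" by (rule imageE)
  then have "y \<in> G (Suc (Suc m)) \<and> d y = ?z - lin \<zeta> (\<eta> (Suc m) ?z)" by simp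
  then have "(SOME y. y \<in> G (Suc (Suc m)) \<and> d y = ?z - lin \<zeta> (\<eta> (Suc m) ?z)) \<in> G (Suc (Suc m)) \<and>
    d (SOME y. y \<in> G (Suc (Suc m)) \<and> d y = ?z - lin \<zeta> (\<eta> (Suc m) ?z)) = ?z - lin \<zeta> (\<eta> (Suc m) ?z)" by (rule someI)
  then show "hs (Suc m) b \<in> G (Suc (Suc m))" "d (hs (Suc m) b) = - (?z - lin \<zeta> (pr m b))"
    by (auto simp: pr_def G_fsupp)
qed

text \<open>The induction starts because \<open>C_1 = 0\<close>. In the step, the homotopy formula
  at \<open>d g\<close> exhibits the representing cycle of its projection as a boundary. As \<zeta>
  is injective on homology, the projection is 0, and the invariant passes to the next
  degree.\<close>

lemma hs_props:
  "(\<forall>b. b \<in> basis C \<longrightarrow> deg C b = m \<longrightarrow> hs m b \<in> G (Suc m)) \<and> (\<forall>g \<in> G (Suc m). d (lin (hs m) (d g)) = - d g)"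
proof (induction m)
  case 0
  show ?case by (simp add: G1)
next
  case (Suc m)
  note step = hs_step[of m, OF Suc[THEN conjunct1, rule_format] Suc[THEN conjunct2, rule_format]]
  have "d (lin (hs (Suc m)) (d g)) = - d g" if g: "g \<in> G (Suc (Suc m))" for g
  proof -
    have dg: "d g \<in> G (Suc m)" "d (d g) = 0" using d_G[OF g] dd[OF g] by auto
    have eq: "d (lin (hs (Suc m)) x) = - (x + lin (hs m) (d x) - lin \<zeta> (lin (pr m) x))" if "x \<in> G (Suc m)" for x
      using that unfolding G_fsupp
      by (rule lmap_eq_onI[of _ _ "\<lambda>x. d (lin (hs (Suc m)) x)"]; (intro lmap_intros)?) (use step(3) in simp)
    have p: "lin (pr m) (d g) \<in> cgrade H (Suc m)"
      using dg(1) unfolding G_fsupp by (rule lin_mem_on) (use step(2) in \<open>auto simp: G_fsupp\<close>)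
    have h: "lin (hs (Suc m)) (d g) \<in> G (Suc (Suc m))" by (rule hs_mem_lin[OF step(1) dg(1)])
    have "lin \<zeta> (lin (pr m) (d g)) = d (g + lin (hs (Suc m)) (d g))"
      using eq[OF dg(1)] dg(2) by simp
    moreover have "g + lin (hs (Suc m)) (d g) \<in> G (Suc (Suc m))" using g h unfolding G_fsupp by (rule add_in_fsupp)
    ultimately have "lin (pr m) (d g) = 0" using \<zeta>_boundary[OF p] by (metis imageI)
    then show ?thesis using eq[OF dg(1)] dg(2) by simp
  qed
  then show ?case using step(1) by blast
qed

lemmas hs_final = hs_step[OF hs_props[THEN conjunct1, rule_format] hs_props[THEN conjunct2, rule_format]]

section \<open>The homotopy and the projection in all degrees\<close>

definition "h0 b = hs (deg C b) b"
text \<open>The index is shifted because \<open>pr m\<close> belongs to degree \<open>m + 1\<close>: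
  it is built from the homotopy one degree below.\<close>

definition "p0 b = pr (deg C b - 1) b"

abbreviation "SH \<equiv> basis_pos H"
abbreviation "gH \<equiv> sdeg H"

lemma lin_h0: "x \<in> G n \<Longrightarrow> lin h0 x = lin (hs n) x" and lin_p0: "x \<in> G (Suc n) \<Longrightarrow> lin p0 x = lin (pr n) x"
  unfolding G_fsupp by (rule lin_cong[OF refl]; use fsuppD in \<open>fastforce simp: h0_def p0_def\<close>)+

lemma SG: "b \<in> S \<Longrightarrow> b \<in> basis C \<and> deg C b = Suc (dg b)"
  using deg_sdeg by (simp add: S_iff)

lemma h0_G: "x \<in> G (Suc n) \<Longrightarrow> lin h0 x \<in> G (Suc (Suc n))"
  unfolding lin_h0 by (rule hs_mem_lin[OF hs_props[THEN conjunct1, rule_format]])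

lemma p0_G: "x \<in> G (Suc n) \<Longrightarrow> lin p0 x \<in> cgrade H (Suc n)"
  unfolding lin_p0 unfolding G_fsupp by (erule lin_mem_on) (use hs_final(2) in \<open>auto simp: G_fsupp\<close>)

lemma dh0: "x \<in> G (Suc n) \<Longrightarrow> d (lin h0 x) + lin h0 (d x) = lin \<zeta> (lin p0 x) - x"
proof -
  assume x: "x \<in> G (Suc n)"
  have "d (lin (hs (Suc n)) x) = - (x + lin (hs n) (d x) - lin \<zeta> (lin (pr n) x))"
    using x unfolding G_fsupp
    by (rule lmap_eq_onI[of _ _ "\<lambda>x. d (lin (hs (Suc n)) x)"]; (intro lmap_intros)?) (use hs_final(3) in simp)
  then show ?thesis by (simp add: lin_h0[OF x] lin_h0[OF d_G[OF x]] lin_p0[OF x])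
qed

text \<open>Under the second premise the homotopy identity presents the representing cycle of
  \<open>p0 x\<close> as a boundary.\<close>

lemma p0_zero: "x \<in> G (Suc n) \<Longrightarrow> x + lin h0 (d x) = 0 \<Longrightarrow> lin p0 x = 0"
proof -
  assume x: "x \<in> G (Suc n)" "x + lin h0 (d x) = 0"
  have "lin \<zeta> (lin p0 x) = d (lin h0 x) + (x + lin h0 (d x))" using dh0[OF x(1)] by (simp add: algebra_simps)
  then have "lin \<zeta> (lin p0 x) \<in> bd (Suc n)" using x(2) h0_G[OF x(1)] by simp
  then show ?thesis using \<zeta>_boundary[OF p0_G[OF x(1)]] by blast
qed

lemma dh0_boundary: "x \<in> G (Suc (Suc n)) \<Longrightarrow> d (lin h0 (d x)) = - d x"
  using hs_props[of "Suc n"] lin_h0[OF d_G] by simp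

lemma pd0: "x \<in> G (Suc (Suc n)) \<Longrightarrow> lin p0 (d x) = 0"
proof -
  assume x: "x \<in> G (Suc (Suc n))"
  have "lin \<zeta> (lin p0 (d x)) = d (lin h0 (d x)) + d x" using dh0[OF d_G[OF x]] dd[OF x] by simp
  then have "lin \<zeta> (lin p0 (d x)) = 0" using dh0_boundary[OF x] by simp
  then show ?thesis using \<zeta>_boundary[OF p0_G[OF d_G[OF x]]] pm.subspace_0[OF subspace_bd] by simp
qed

lemma p\<zeta>0: "x \<in> cgrade H (Suc n) \<Longrightarrow> lin p0 (lin \<zeta> x) = x"
proof -
  assume x: "x \<in> cgrade H (Suc n)"
  note z = \<zeta>_G[OF x]
  have "lin \<zeta> (lin p0 (lin \<zeta> x) - x) = d (lin h0 (lin \<zeta> x))" using dh0[OF z] d\<zeta>[OF x] by simp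
  moreover have "lin p0 (lin \<zeta> x) - x \<in> cgrade H (Suc n)" using p0_G[OF z] x unfolding G_fsupp by (rule diff_in_fsupp)
  ultimately show ?thesis using \<zeta>_boundary[of "lin p0 (lin \<zeta> x) - x" "Suc n"] h0_G[OF z] by auto
qed

text \<open>Replacing \<open>h\<^sub>0\<close> by \<open>-h\<^sub>0dh\<^sub>0\<close> enforces the side conditions; the sign is that of the differential \<open>-d\<close> on
  desuspensions.\<close>

definition "h1 b = lin h0 (d (h0 b))"

lemma lin_h1: "lin h1 x = lin h0 (d (lin h0 x))"
  by (simp add: h1_def[abs_def] lin_lin)

lemma h1_G: "x \<in> G (Suc n) \<Longrightarrow> lin h1 x \<in> G (Suc (Suc n))"
  unfolding lin_h1 by (intro h0_G d_G)

lemma dh1: assumes "x \<in> G (Suc (Suc n))" shows "d (lin h1 x) + lin h1 (d x) = x - lin \<zeta> (lin p0 x)"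
proof -
  have "d (lin h1 x) = - d (lin h0 x)" unfolding lin_h1 by (rule dh0_boundary[OF h0_G[OF assms]])
  moreover have "lin h1 (d x) = - lin h0 (d x)" unfolding lin_h1 dh0_boundary[OF assms] by simp
  ultimately show ?thesis using dh0[OF assms] by (simp add: algebra_simps)
qed

lemma h1\<zeta>: "x \<in> cgrade H (Suc n) \<Longrightarrow> lin h1 (lin \<zeta> x) = 0"
  using dh0[OF \<zeta>_G] d\<zeta> p\<zeta>0 by (simp add: lin_h1)

text \<open>The element \<open>h1 x\<close> satisfies the premise of \<open>p0_zero\<close>, because
  \<open>d h0 d = - d\<close>.\<close>

lemma ph1: assumes "x \<in> G (Suc n)" shows "lin p0 (lin h1 x) = 0"
proof -
  note y = h0_G[OF assms]
  have "lin h0 (d (lin h0 (d (lin h0 x)))) = - lin h0 (d (lin h0 x))" unfolding dh0_boundary[OF y] by simp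
  then show ?thesis unfolding lin_h1 by (intro p0_zero[OF h0_G[OF d_G[OF y]]]) simp
qed

text \<open>The homotopy identity for \<open>h0\<close> at \<open>h1 x\<close>, together with
  \<open>p0 h1 = 0\<close>, gives \<open>d h0 h1 = 0\<close>; one more \<open>h0\<close> on the left
  produces the claim.\<close>

lemma h1h1: assumes "x \<in> G (Suc n)" shows "lin h1 (lin h1 x) = 0"
proof -
  note y = h0_G[OF assms]
  note y' = h0_G[OF d_G[OF y]]
  have "d (lin h0 (lin h1 x)) = 0"
    using dh0[OF y'] ph1[OF assms] dh0_boundary[OF y] unfolding lin_h1 by simp
  then show ?thesis unfolding lin_h1[of "lin h1 x"] by simp
qed

text \<open>A basis element of \<open>H\<close> in degree 1 or 2 would be represented by the zero
  cycle, a boundary, and would thus be 0.\<close>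

lemma unitH: "SH = {h \<in> basis H. 3 \<le> deg H h}"
proof -
  have "deg H h \<noteq> Suc 0 \<and> deg H h \<noteq> 2" if h: "h \<in> basis H" for h
  proof -
    have g: "gen h \<in> cgrade H (deg H h)" using h by (simp add: G_fsupp)
    have "lin \<zeta> (gen h) \<notin> bd (deg H h)" using \<zeta>_boundary[OF g] by auto
    moreover have "lin \<zeta> (gen h) \<in> G (deg H h)" by (rule \<zeta>_G[OF g])
    moreover have "0 \<in> bd (deg H h)" by (rule pm.subspace_0[OF subspace_bd])
    ultimately show ?thesis using G1 by (metis singletonD)
  qed
  then show ?thesis by (fastforce simp: basis_pos_def)
qed

lemma SH_deg: "h \<in> SH \<Longrightarrow> h \<in> basis H \<and> deg H h = Suc (gH h) \<and> 2 \<le> gH h"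
  by (auto simp: unitH sdeg_def)

lemma gH1: "h \<in> SH \<Longrightarrow> 1 \<le> gH h"
  using SH_deg[of h] by simp

lemma gen_G: "b \<in> S \<Longrightarrow> gen b \<in> G (Suc (Suc (dg b - 1)))" "b \<in> S \<Longrightarrow> gen b \<in> G (Suc (dg b))"
  "h \<in> SH \<Longrightarrow> gen h \<in> cgrade H (Suc (gH h))"
  using SG[of b] dg2[of b] SH_deg[of h] by (auto simp: G_fsupp)

lemma G_S: "G (Suc n) = fsupp {b \<in> S. dg b = n}" "cgrade H (Suc n) = fsupp {h \<in> SH. gH h = n}"
proof -
  have "{b \<in> basis C. deg C b = Suc n} = {b \<in> S. dg b = n}"
    by (auto simp: basis_pos_def sdeg_def)
  then show "G (Suc n) = fsupp {b \<in> S. dg b = n}" by (simp add: G_fsupp)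
  have "{h \<in> basis H. deg H h = Suc n} = {h \<in> SH. gH h = n}"
    by (auto simp: basis_pos_def sdeg_def)
  then show "cgrade H (Suc n) = fsupp {h \<in> SH. gH h = n}" by (simp add: G_fsupp)
qed

lemma letters_deg:
  "b \<in> S \<Longrightarrow> - cdif C b \<in> fsupp {y \<in> S. dg y + 1 = dg b}"
  "b \<in> S \<Longrightarrow> h1 b \<in> fsupp {y \<in> S. dg y = dg b + 1}"
  "h \<in> SH \<Longrightarrow> \<zeta> h \<in> fsupp {y \<in> S. dg y = gH h}"
  "b \<in> S \<Longrightarrow> p0 b \<in> fsupp {y \<in> SH. gH y = dg b}"
  using cdif_mem[of b] h1_G[OF gen_G(2), of b] \<zeta>_G[OF gen_G(3), of h] p0_G[OF gen_G(2), of b]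
  unfolding G_S by (auto intro: uminus_in_fsupp)

lemma neg_cdif: "lin (\<lambda>c. - cdif C c) x = - d x"
  by (rule lin_uminus_fun)

lemma sdr_letters: "sdr (fsupp S) (fsupp SH) (lin (\<lambda>c. - cdif C c)) (lin h1) (lin \<zeta>) (lin p0) (lin (\<lambda>h. 0))"
proof unfold_locales
  note mem = letters_deg
  show "lin (\<lambda>c. - cdif C c) x \<in> fsupp S" if "x \<in> fsupp S" for x
    by (rule lin_mem_on[OF that]) (auto intro: subsetD[OF fsupp_mono mem(1)])
  show "lin h1 x \<in> fsupp S" if "x \<in> fsupp S" for x
    by (rule lin_mem_on[OF that]) (auto intro: subsetD[OF fsupp_mono mem(2)])
  show "lin \<zeta> x \<in> fsupp S" if "x \<in> fsupp SH" for x
    by (rule lin_mem_on[OF that]) (auto intro: subsetD[OF fsupp_mono mem(3)])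
  show "lin p0 x \<in> fsupp SH" if "x \<in> fsupp S" for x
    by (rule lin_mem_on[OF that]) (auto intro: subsetD[OF fsupp_mono mem(4)])
  show "lin (\<lambda>c. - cdif C c) (lin (\<lambda>c. - cdif C c) x) = 0" if "x \<in> fsupp S" for x
    unfolding neg_cdif using that
    by (rule lmap_eq_onI[of _ _ "\<lambda>x. - d (- d x)"]; (intro lmap_intros)?) (use dd[OF gen_G(2)] in simp)
  show "lin (\<lambda>c. - cdif C c) (lin \<zeta> y) = lin \<zeta> (lin (\<lambda>h. 0) y)" if "y \<in> fsupp SH" for y
    unfolding neg_cdif using that
    by (rule lmap_eq_onI[of _ _ "\<lambda>x. - d (lin \<zeta> x)"]; (intro lmap_intros)?) (use d\<zeta>[OF gen_G(3)] in simp)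
  show "lin p0 (lin (\<lambda>c. - cdif C c) x) = lin (\<lambda>h. 0) (lin p0 x)" if "x \<in> fsupp S" for x
    unfolding neg_cdif using that
    by (rule lmap_eq_onI[of _ _ "\<lambda>x. lin p0 (- d x)"]; (intro lmap_intros)?) (use pd0[OF gen_G(1)] in simp)
  show "lin (\<lambda>c. - cdif C c) (lin h1 x) + lin h1 (lin (\<lambda>c. - cdif C c) x) = lin \<zeta> (lin p0 x) - x" if "x \<in> fsupp S" for x
    unfolding neg_cdif using that
  proof (rule lmap_eq_onI[of _ _ "\<lambda>x. - d (lin h1 x) + lin h1 (- d x)"]; (intro lmap_intros)?)
    fix b assume "b \<in> S"
    from arg_cong[OF dh1[OF gen_G(1)[OF this]], of uminus]
    show "- d (lin h1 (gen b)) + lin h1 (- d (gen b)) = lin \<zeta> (lin p0 (gen b)) - gen b" by simp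
  qed
  show "lin p0 (lin \<zeta> y) = y" if "y \<in> fsupp SH" for y
    using that by (rule lmap_eq_onI[of _ _ "\<lambda>x. lin p0 (lin \<zeta> x)"]; (intro lmap_intros)?) (rule p\<zeta>0[OF gen_G(3)])
  show "lin h1 (lin \<zeta> y) = 0" if "y \<in> fsupp SH" for y
    using that by (rule lmap_eq_onI[of _ _ "\<lambda>x. lin h1 (lin \<zeta> x)"]; (intro lmap_intros)?) (rule h1\<zeta>[OF gen_G(3)])
  show "lin p0 (lin h1 x) = 0" if "x \<in> fsupp S" for x
    using that by (rule lmap_eq_onI[of _ _ "\<lambda>x. lin p0 (lin h1 x)"]; (intro lmap_intros)?) (rule ph1[OF gen_G(2)])
  show "lin h1 (lin h1 x) = 0" if "x \<in> fsupp S" for x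
    using that by (rule lmap_eq_onI[of _ _ "\<lambda>x. lin h1 (lin h1 x)"]; (intro lmap_intros)?) (rule h1h1[OF gen_G(2)])
qed simp_all

lemma D_eq: "c \<in> S \<Longrightarrow> lt (- cdif C c) + cobar_quad C c = D c"
  by (simp only: D_letters)

text \<open>The first transfer. The desuspended differential \<open>- cdif C\<close> acts on
  letters, the quadratic part from the comultiplication is the perturbation, and \<open>H\<close>
  has zero differential.\<close>

sublocale L1: letter_sdr S SH "\<lambda>c. - cdif C c" h1 \<zeta> p0 "\<lambda>h. 0" dg gH "cobar_quad C"
proof (rule letter_sdr.intro[OF sdr_letters], rule letter_sdr_axioms.intro)
  show "der dg (\<lambda>x. lt (- cdif C x) + cobar_quad C x) (der dg (\<lambda>x. lt (- cdif C x) + cobar_quad C x) (gen w)) = 0"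
    if "set w \<subseteq> S" for w
  proof -
    have w: "w \<in> lists S" "gen w \<in> fsupp (lists S)" using that by auto
    have "der dg (\<lambda>x. lt (- cdif C x) + cobar_quad C x) y = der dg D y" if "y \<in> fsupp (lists S)" for y
      using that D_eq by (rule der_cong)
    then show ?thesis using w dA_lists[OF w(2)] der_der by simp
  qed
qed (use letters_deg dg1 gH1 quad_WS in auto)

lemma L1_total: "x \<in> fsupp (lists S) \<Longrightarrow> L1.Td x + L1.Tt x = der dg D x"
proof -
  assume x: "x \<in> fsupp (lists S)"
  have "L1.Td x + L1.Tt x = der dg (\<lambda>c. lt (- cdif C c) + cobar_quad C c) x"
    by (simp only: der_add_fun)
  also have "\<dots> = der dg D x" using x D_eq by (rule der_cong)
  finally show ?thesis .
qed

section \<open>The second transfer: nonempty words as letters\<close>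

definition NH :: "'h list set" where "NH = lists SH - {[]}"
definition aH :: "'h list \<Rightarrow> nat" where "aH w = wdeg gH w - 1"

lemma wdeg_NH: "w \<in> NH \<Longrightarrow> 2 \<le> wdeg gH w"
proof -
  have "w \<in> lists SH \<Longrightarrow> w \<noteq> [] \<Longrightarrow> 2 \<le> wdeg gH w" for w
    by (induction w) (use SH_deg in force)+
  then show "w \<in> NH \<Longrightarrow> 2 \<le> wdeg gH w" by (simp add: NH_def)
qed

lemma wset_NE: "0 < n \<Longrightarrow> wset S dg n \<subseteq> {w \<in> NE. adg w = n - 1}"
  "0 < n \<Longrightarrow> wset SH gH n \<subseteq> {w \<in> NH. aH w = n - 1}"
  by (auto simp: wset_def NE_def adg_def NH_def aH_def)

lemma L2_deg:
  "w \<in> NE \<Longrightarrow> - L1.word.H (gen w) \<in> fsupp {y \<in> NE. adg y = adg w + 1}"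
  "w \<in> NE \<Longrightarrow> L1.word.P (gen w) \<in> fsupp {y \<in> NH. aH y = adg w}"
  "v \<in> NH \<Longrightarrow> L1.word.I (gen v) \<in> fsupp {y \<in> NE. adg y = aH v}"
  "v \<in> NH \<Longrightarrow> - L1.word.D (gen v) \<in> fsupp {y \<in> NH. aH y + 1 = aH v}"
proof -
  show "w \<in> NE \<Longrightarrow> - L1.word.H (gen w) \<in> fsupp {y \<in> NE. adg y = adg w + 1}"
  proof (rule uminus_in_fsupp)
    assume w: "w \<in> NE"
    have "gen w \<in> fsupp (wset S dg (wdeg dg w))" using NE_lists(1)[OF w] by (rule gen_wset)
    from L1.word_deg(2)[OF this] show "L1.word.H (gen w) \<in> fsupp {y \<in> NE. adg y = adg w + 1}"
      by (rule subsetD[OF fsupp_mono, rotated]) (use wset_NE(1)[of "Suc (wdeg dg w)"] wdeg_NE[OF w] in \<open>auto simp: adg_def\<close>)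
  qed
  show "w \<in> NE \<Longrightarrow> L1.word.P (gen w) \<in> fsupp {y \<in> NH. aH y = adg w}"
  proof -
    assume w: "w \<in> NE"
    have "gen w \<in> fsupp (wset S dg (wdeg dg w))" using NE_lists(1)[OF w] by (rule gen_wset)
    from L1.word_deg(3)[OF this] show "L1.word.P (gen w) \<in> fsupp {y \<in> NH. aH y = adg w}"
      by (rule subsetD[OF fsupp_mono, rotated]) (use wset_NE(2)[of "wdeg dg w"] wdeg_NE[OF w] in \<open>auto simp: adg_def\<close>)
  qed
  show "v \<in> NH \<Longrightarrow> L1.word.I (gen v) \<in> fsupp {y \<in> NE. adg y = aH v}"
  proof -
    assume v: "v \<in> NH"
    have "gen v \<in> fsupp (wset SH gH (wdeg gH v))" using v by (auto simp: NH_def wset_def)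
    from L1.word_deg(1)[OF this] show "L1.word.I (gen v) \<in> fsupp {y \<in> NE. adg y = aH v}"
      by (rule subsetD[OF fsupp_mono, rotated]) (use wset_NE(1)[of "wdeg gH v"] wdeg_NH[OF v] in \<open>auto simp: aH_def\<close>)
  qed
  show "v \<in> NH \<Longrightarrow> - L1.word.D (gen v) \<in> fsupp {y \<in> NH. aH y + 1 = aH v}"
  proof (rule uminus_in_fsupp)
    assume v: "v \<in> NH"
    obtain k where k: "wdeg gH v = Suc k" "0 < k" using wdeg_NH[OF v] by (cases "wdeg gH v") auto
    have "gen v \<in> fsupp (wset SH gH (Suc k))" using v k by (auto simp: NH_def wset_def)
    from L1.word_deg(4)[OF this] show "L1.word.D (gen v) \<in> fsupp {y \<in> NH. aH y + 1 = aH v}"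
      by (rule subsetD[OF fsupp_mono, rotated]) (use wset_NE(2)[OF k(2)] k in \<open>auto simp: aH_def\<close>)
  qed
qed

lemma neg_fun: "lmap f \<Longrightarrow> lin (\<lambda>w. - f (gen w)) x = - f x"
  by (simp add: lin_uminus_fun lin_lmap)

lemma L2_maps:
  "lin (\<lambda>w. - der dg D (gen w)) x = - der dg D x" "lin (\<lambda>w. - L1.word.H (gen w)) x = - L1.word.H x"
  "lin (\<lambda>w. L1.word.I (gen w)) y = L1.word.I y" "lin (\<lambda>w. L1.word.P (gen w)) x = L1.word.P x"
  "lin (\<lambda>w. - L1.word.D (gen w)) y = - L1.word.D y"
  by (simp_all only: neg_fun lmap_der' L1.word.lmap_IHPD lin_lmap)

lemma NE_sub: "x \<in> fsupp NE \<Longrightarrow> x \<in> fsupp (lists S)" "y \<in> fsupp NH \<Longrightarrow> y \<in> fsupp (lists SH)"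
  by (erule subsetD[OF fsupp_mono, rotated]; auto simp: NE_def NH_def)+

text \<open>Desuspending once more changes the sign of the differential. Negating the homotopy and
  the small differential along with it, but not \<open>I\<close> and \<open>P\<close>, keeps all
  identities; since degrees are positive, the maps preserve nonempty words.\<close>

lemma L2_sdr: "sdr (fsupp NE) (fsupp NH) (lin (\<lambda>w. - der dg D (gen w))) (lin (\<lambda>w. - L1.word.H (gen w)))
    (lin (\<lambda>w. L1.word.I (gen w))) (lin (\<lambda>w. L1.word.P (gen w))) (lin (\<lambda>w. - L1.word.D (gen w)))"
proof -
  note s = L1.word.perturbed
  note l = lmap_der' L1.word.lmap_IHPD
  note lneg = l[THEN lmap_uminus]
  note deg = L2_deg dA_NE
  show ?thesis
  proof unfold_locales
    show "lin (\<lambda>w. - der dg D (gen w)) x \<in> fsupp NE" if "x \<in> fsupp NE" for x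
      by (rule lin_mem_on[OF that]) (auto intro: subsetD[OF fsupp_mono deg(5)])
    show "lin (\<lambda>w. - L1.word.H (gen w)) x \<in> fsupp NE" if "x \<in> fsupp NE" for x
      by (rule lin_mem_on[OF that]) (auto intro: subsetD[OF fsupp_mono deg(1)])
    show "lin (\<lambda>w. L1.word.I (gen w)) x \<in> fsupp NE" if "x \<in> fsupp NH" for x
      by (rule lin_mem_on[OF that]) (auto intro: subsetD[OF fsupp_mono deg(3)])
    show "lin (\<lambda>w. L1.word.P (gen w)) x \<in> fsupp NH" if "x \<in> fsupp NE" for x
      by (rule lin_mem_on[OF that]) (auto intro: subsetD[OF fsupp_mono deg(2)])
    show "lin (\<lambda>w. - L1.word.D (gen w)) x \<in> fsupp NH" if "x \<in> fsupp NH" for x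
      by (rule lin_mem_on[OF that subspace_fsupp], rule subsetD[OF fsupp_mono deg(4)]) auto
  next
    fix x :: "'b list \<Rightarrow>\<^sub>0 'r" assume "x \<in> fsupp NE"
    then have x: "x \<in> fsupp (lists S)" by (rule NE_sub)
    have dx: "der dg D x \<in> fsupp (lists S)" by (rule dA_lists[OF x])
    have Hx: "L1.word.H x \<in> fsupp (lists S)" by (rule L1.word.closed_IHPD(2)[OF x])
    note sx = sdr.dd[OF s x] sdr.pd[OF s x] sdr.dh[OF s x] sdr.ph[OF s x] sdr.hh[OF s x]
    note sx' = sx[unfolded L1_total[OF x] L1_total[OF dx] L1_total[OF Hx]]
    show "lin (\<lambda>w. - der dg D (gen w)) (lin (\<lambda>w. - der dg D (gen w)) x) = 0"
      unfolding L2_maps using sx'(1) by simp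
    show "lin (\<lambda>w. L1.word.P (gen w)) (lin (\<lambda>w. - der dg D (gen w)) x) = lin (\<lambda>w. - L1.word.D (gen w)) (lin (\<lambda>w. L1.word.P (gen w)) x)"
      unfolding L2_maps using sx'(2) by (simp add: lneg)
    show "lin (\<lambda>w. - der dg D (gen w)) (lin (\<lambda>w. - L1.word.H (gen w)) x) + lin (\<lambda>w. - L1.word.H (gen w)) (lin (\<lambda>w. - der dg D (gen w)) x)
      = lin (\<lambda>w. L1.word.I (gen w)) (lin (\<lambda>w. L1.word.P (gen w)) x) - x"
      unfolding L2_maps using sx'(3) by (simp add: lneg)
    show "lin (\<lambda>w. L1.word.P (gen w)) (lin (\<lambda>w. - L1.word.H (gen w)) x) = 0"
      unfolding L2_maps using sx'(4) by (simp add: lneg)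
    show "lin (\<lambda>w. - L1.word.H (gen w)) (lin (\<lambda>w. - L1.word.H (gen w)) x) = 0"
      unfolding L2_maps using sx'(5) by (simp add: lneg)
  next
    fix y :: "'h list \<Rightarrow>\<^sub>0 'r" assume "y \<in> fsupp NH"
    then have y: "y \<in> fsupp (lists SH)" by (rule NE_sub)
    have Iy: "L1.word.I y \<in> fsupp (lists S)" by (rule L1.word.closed_IHPD(1)[OF y])
    note sy = sdr.\<delta>\<delta>[OF s y] sdr.di[OF s y] sdr.pi[OF s y] sdr.hi[OF s y]
    note sy' = sy[unfolded L1_total[OF Iy]]
    show "lin (\<lambda>w. - L1.word.D (gen w)) (lin (\<lambda>w. - L1.word.D (gen w)) y) = 0"
      unfolding L2_maps using sy'(1) by (simp only: lneg minus_minus)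
    show "lin (\<lambda>w. - der dg D (gen w)) (lin (\<lambda>w. L1.word.I (gen w)) y) = lin (\<lambda>w. L1.word.I (gen w)) (lin (\<lambda>w. - L1.word.D (gen w)) y)"
      unfolding L2_maps using sy'(2) by (simp add: lneg)
    show "lin (\<lambda>w. L1.word.P (gen w)) (lin (\<lambda>w. L1.word.I (gen w)) y) = y"
      unfolding L2_maps using sy'(3) by simp
    show "lin (\<lambda>w. - L1.word.H (gen w)) (lin (\<lambda>w. L1.word.I (gen w)) y) = 0"
      unfolding L2_maps using sy'(4) by simp
  qed simp_all
qed

text \<open>The differential left on the small side by the first transfer becomes, up to sign, a
  differential on the new letters; the perturbation is now the quadratic part coming from
  \<psi>.\<close>

sublocale L2: letter_sdr NE NH "\<lambda>w. - der dg D (gen w)" "\<lambda>w. - L1.word.H (gen w)" "\<lambda>w. L1.word.I (gen w)"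
  "\<lambda>w. L1.word.P (gen w)" "\<lambda>w. - L1.word.D (gen w)" adg aH QA
proof (rule letter_sdr.intro[OF L2_sdr], rule letter_sdr_axioms.intro)
  show "der adg (\<lambda>x. lt (- der dg D (gen x)) + QA x) (der adg (\<lambda>x. lt (- der dg D (gen x)) + QA x) (gen w)) = 0"
    if "set w \<subseteq> NE" for w
    using DA_square[OF that] by (simp add: DA_def[abs_def])
  show "1 \<le> aH y" if "y \<in> NH" for y using wdeg_NH[OF that] by (simp add: aH_def)
qed (fact adg_pos dA_NE L2_deg QA_WS)+

lemma L2_total: "L2.Td x + L2.Tt x = der adg DA x"
  by (simp only: der_add_fun DA_def[abs_def])

end

section \<open>Sub chain algebras of a tensor algebra\<close>

lemma independent_image:
  fixes F :: "'y \<Rightarrow> ('x \<Rightarrow>\<^sub>0 'r::comm_ring_1)"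
  assumes inj: "\<And>p. p \<in> fsupp Y \<Longrightarrow> lin F p = 0 \<Longrightarrow> p = 0"
  shows "pm.independent (F ` Y)" "pm.span (F ` Y) = lin F ` fsupp Y" "inj_on F Y"
proof -
  show injF: "inj_on F Y"
  proof (rule inj_onI)
    fix x y assume "x \<in> Y" "y \<in> Y" "F x = F y"
    then have "gen x - gen y = (0 :: 'y \<Rightarrow>\<^sub>0 'r)" by (intro inj) auto
    then show "x = y" by (metis eq_iff_diff_eq_0 keys_gen singleton_inject)
  qed
  show "pm.independent (F ` Y)"
    unfolding pm.independent_explicit_module
  proof (intro allI impI)
    fix t u v assume t: "finite t" "t \<subseteq> F ` Y" "(\<Sum>v\<in>t. smul (u v) v) = 0" "v \<in> t"
    obtain Z where Z: "Z \<subseteq> Y" "t = F ` Z" using t(2) by (rule subset_imageE)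
    have injZ: "inj_on F Z" using injF Z(1) by (rule inj_on_subset)
    then have fin: "finite Z" using t(1) Z(2) by (simp add: finite_image_iff)
    define p where "p = (\<Sum>z\<in>Z. smul (u (F z)) (gen z))"
    have "lin F p = (\<Sum>z\<in>Z. smul (u (F z)) (F z))" by (simp add: p_def lin_sum)
    also have "\<dots> = 0" using t(3) unfolding Z(2) by (simp add: sum.reindex[OF injZ])
    finally have "lin F p = 0" .
    moreover have "p \<in> fsupp Y" unfolding p_def using Z(1) by (intro pm.subspace_sum smul_in_fsupp subspace_fsupp) auto
    ultimately have "p = 0" by (intro inj)
    obtain z where z: "z \<in> Z" "v = F z" using t(4) Z(2) by blast
    have "Poly_Mapping.lookup p z = (\<Sum>y\<in>Z. u (F y) * (if y = z then 1 else 0))"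
      unfolding p_def by (simp add: lookup_sum lookup_gen)
    also have "\<dots> = u v" using z fin by (simp add: if_distrib cong: if_cong)
    finally show "u v = 0" using \<open>p = 0\<close> by simp
  qed
  show "pm.span (F ` Y) = lin F ` fsupp Y"
  proof
    have "F y \<in> lin F ` fsupp Y" if "y \<in> Y" for y
      using that by (intro image_eqI[of _ _ "gen y"]) auto
    then show "pm.span (F ` Y) \<subseteq> lin F ` fsupp Y"
      by (intro pm.span_minimal subspace_image) auto
    show "lin F ` fsupp Y \<subseteq> pm.span (F ` Y)"
    proof
      fix x assume "x \<in> lin F ` fsupp Y"
      then obtain p where "p \<in> fsupp Y" "x = lin F p" by blast
      then show "x \<in> pm.span (F ` Y)"
        using lin_mem_on[of p Y "pm.span (F ` Y)" F] by (auto intro: pm.span_base)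
    qed
  qed
qed

lemma homogeneous_sum_zero:
  assumes x: "\<And>n. x n \<in> fsupp (wset U dg n)" and fin: "finite {n. x n \<noteq> 0}" and sum: "(\<Sum>n | x n \<noteq> 0. x n) = 0"
  shows "x n = 0"
proof (rule poly_mapping_eqI)
  fix w
  have other: "Poly_Mapping.lookup (x m) w = 0" if "m \<noteq> wdeg dg w" for m
    using fsuppD[OF x, of w m] that by (auto simp: wset_def in_keys_iff)
  show "Poly_Mapping.lookup (x n) w = Poly_Mapping.lookup 0 w"
  proof (cases "n = wdeg dg w \<and> x n \<noteq> 0")
    case True
    have "0 = (\<Sum>m | x m \<noteq> 0. Poly_Mapping.lookup (x m) w)" using arg_cong[OF sum, of "\<lambda>p. Poly_Mapping.lookup p w"] by (simp add: lookup_sum)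
    also have "\<dots> = (\<Sum>m\<in>{n}. Poly_Mapping.lookup (x m) w)"
      by (rule sum.mono_neutral_right) (use fin True other in auto)
    finally show ?thesis by simp
  next
    case False
    then show ?thesis using other[of n] by (cases "n = wdeg dg w") auto
  qed
qed

text \<open>This is used for the double-loop algebra and for its small model. Injectivity of
  \<Theta> supplies bases of the homogeneous parts, while the algebra laws and the Leibniz rule come
  from the ambient tensor algebra.\<close>

lemma sub_chain_algebra:
  fixes A :: "('x list, 'r::comm_ring_1) dga" and \<Theta> :: "('y \<Rightarrow>\<^sub>0 'r) \<Rightarrow> ('x list \<Rightarrow>\<^sub>0 'r)"
  assumes A: "mul A = cat" "one A = gen []" "dif A = der dg f"
    and \<Theta>: "lmap \<Theta>" "\<And>n p. p \<in> fsupp (Y n) \<Longrightarrow> \<Theta> p = 0 \<Longrightarrow> p = 0"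
    and grade: "\<And>n. grade A n = \<Theta> ` fsupp (Y n)" "\<And>n. grade A n \<subseteq> fsupp (wset U dg n)"
    and closed: "\<And>m n x y. x \<in> grade A m \<Longrightarrow> y \<in> grade A n \<Longrightarrow> cat x y \<in> grade A (m + n)" "gen [] \<in> grade A 0"
    and d: "\<And>x. x \<in> grade A 0 \<Longrightarrow> der dg f x = 0" "\<And>n x. x \<in> grade A (Suc n) \<Longrightarrow> der dg f x \<in> grade A n"
      "\<And>n x. x \<in> grade A n \<Longrightarrow> der dg f (der dg f x) = 0"
  shows "chain_algebra A"
proof -
  have "lin (\<lambda>y. \<Theta> (gen y)) = \<Theta>" using lin_lmap[OF \<Theta>(1)] by blast
  then have "pm.independent ((\<lambda>y. \<Theta> (gen y)) ` Y n) \<and> pm.span ((\<lambda>y. \<Theta> (gen y)) ` Y n) = grade A n" for n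
    using independent_image[of "Y n" "\<lambda>y. \<Theta> (gen y)"] \<Theta>(2) by (simp add: grade(1))
  then have "\<exists>X. pm.independent X \<and> pm.span X = grade A n" for n by blast
  moreover have "x n = 0" if "\<forall>n. x n \<in> grade A n" "finite {n. x n \<noteq> 0}" "(\<Sum>n | x n \<noteq> 0. x n) = 0" for x :: "nat \<Rightarrow> 'x list \<Rightarrow>\<^sub>0 'r" and n
  proof (rule homogeneous_sum_zero[OF _ that(2,3)])
    show "x n \<in> fsupp (wset U dg n)" for n using that(1) grade(2)[of n] by blast
  qed
  ultimately have free: "free_graded_module (grade A)" unfolding free_graded_module_def by blast
  have lin_on: "linear_on X g" if "lmap g" for X :: "('x list \<Rightarrow>\<^sub>0 'r) set" and g :: "('x list \<Rightarrow>\<^sub>0 'r) \<Rightarrow> ('x list \<Rightarrow>\<^sub>0 'r)"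
    using that by (simp add: linear_on_def)
  have graded: "graded_algebra A"
    unfolding graded_algebra_def A using free closed by (auto simp: cat_assoc intro!: lin_on lmap_cat)
  have sq: "der dg f (der dg f x) = 0" if "x \<in> carr (grade A)" for x
  proof -
    have "pm.subspace {x. der dg f (der dg f x) = 0}" by (rule pm.subspaceI) auto
    then have "carr (grade A) \<subseteq> {x. der dg f (der dg f x) = 0}"
      unfolding carr_def by (intro pm.span_minimal) (use d(3) in auto)
    then show ?thesis using that by blast
  qed
  have leibniz: "der dg f (cat x y) = cat (der dg f x) y + smul (sg m) (cat x (der dg f y))" if "x \<in> grade A m" for m x y
    by (rule der_cat[of _ U]) (use that grade(2) in blast)
  show ?thesis
    unfolding chain_algebra_def A
  proof (intro conjI)
    show "linear_on (carr (grade A)) (der dg f)" by (rule lin_on[OF lmap_der'])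
    show "\<forall>x\<in>grade A 0. der dg f x = 0" using d(1) by blast
    show "\<forall>n. \<forall>x\<in>grade A (Suc n). der dg f x \<in> grade A n" using d(2) by blast
    show "\<forall>x\<in>carr (grade A). der dg f (der dg f x) = 0" using sq by blast
    show "\<forall>m. \<forall>x\<in>grade A m. \<forall>y\<in>carr (grade A). der dg f (cat x y) = cat (der dg f x) y + smul (sg m) (cat x (der dg f y))"
      using leibniz by blast
  qed (rule graded)
qed

text \<open>The two last assumptions are surjectivity and injectivity on homology, stated with
  elements; the proof passes to cosets.\<close>

lemma quasi_iso_inclusion:
  fixes G G' :: "nat \<Rightarrow> ('x \<Rightarrow>\<^sub>0 'r::comm_ring_1) set"
  assumes d: "lmap d" and sub: "\<And>n. pm.subspace (G n)" "\<And>n. pm.subspace (G' n)" "\<And>n. G' n \<subseteq> G n"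
    and surj: "\<And>n z. z \<in> G n \<Longrightarrow> d z = 0 \<Longrightarrow> \<exists>z' \<in> G' n. d z' = 0 \<and> z - z' \<in> d ` G (Suc n)"
    and inj: "\<And>n z. z \<in> G' n \<Longrightarrow> z \<in> d ` G (Suc n) \<Longrightarrow> z \<in> d ` G' (Suc n)"
  shows "quasi_iso G' d G d (\<lambda>x. x)"
proof -
  have sb: "pm.subspace (d ` G (Suc n))" "pm.subspace (d ` G' (Suc n))" for n
    using sub d by (auto intro: subspace_image)
  have equiv: "equiv (cycles G d n) (hrel G d n)" "equiv (cycles G' d n) (hrel G' d n)" for n
  proof -
    have *: "equiv (cycles M d n) (hrel M d n)" if s: "pm.subspace (d ` M (Suc n))" for M :: "nat \<Rightarrow> ('x \<Rightarrow>\<^sub>0 'r) set"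
    proof (rule equivI)
      show "hrel M d n \<subseteq> cycles M d n \<times> cycles M d n" by (auto simp: hrel_def)
      show "refl_on (cycles M d n) (hrel M d n)" using pm.subspace_0[OF s] by (auto simp: refl_on_def hrel_def)
      show "sym (hrel M d n)"
      proof (rule symI)
        fix x y assume "(x, y) \<in> hrel M d n"
        then show "(y, x) \<in> hrel M d n" using pm.subspace_neg[OF s, of "x - y"] by (simp add: hrel_def)
      qed
      show "trans (hrel M d n)"
      proof (rule transI)
        fix x y z assume "(x, y) \<in> hrel M d n" "(y, z) \<in> hrel M d n"
        then show "(x, z) \<in> hrel M d n" using pm.subspace_add[OF s, of "x - y" "y - z"] by (simp add: hrel_def)
      qed
    qed
    show "equiv (cycles G d n) (hrel G d n)" "equiv (cycles G' d n) (hrel G' d n)"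
      by (rule *[where M = G, OF sb(1)], rule *[where M = G', OF sb(2)])
  qed
  have cyc: "cycles G' d n \<subseteq> cycles G d n" for n using sub(3) by (auto simp: cycles_def)
  have hsub: "hrel G' d n \<subseteq> hrel G d n" for n using sub(3)[of n] sub(3)[of "Suc n"] by (auto simp: hrel_def cycles_def)
  \<comment> \<open>Every representative in the smaller complex has the same class in the larger
    one, so the union in the definition of the induced map is a single class.\<close>
  have img: "(\<Union>z\<in>hrel G' d n `` {x}. hrel G d n `` {z}) = hrel G d n `` {x}" if x: "x \<in> cycles G' d n" for x n
  proof -
    have a: "hrel G d n `` {z} = hrel G d n `` {x}" if "z \<in> hrel G' d n `` {x}" for z
    proof -
      have "(x, z) \<in> hrel G d n" using that hsub by blast
      from equiv_class_eq[OF equiv(1) this] show ?thesis by simp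
    qed
    show ?thesis
      by (rule UN_constant_eq[OF equiv_class_self[OF equiv(2) x]]) (rule ballI, rule a)
  qed
  show ?thesis
    unfolding quasi_iso_def
  proof (intro allI, rule bij_betwI')
    fix n X Y assume "X \<in> homology G' d n" "Y \<in> homology G' d n"
    then obtain x y where xy: "x \<in> cycles G' d n" "X = hrel G' d n `` {x}" "y \<in> cycles G' d n" "Y = hrel G' d n `` {y}"
      unfolding homology_def by (auto elim!: quotientE)
    have "(x, y) \<in> hrel G' d n" if "(x, y) \<in> hrel G d n"
      using that xy inj[of "x - y" n] pm.subspace_diff[OF sub(2)] by (auto simp: hrel_def cycles_def)
    then have "(x, y) \<in> hrel G' d n \<longleftrightarrow> (x, y) \<in> hrel G d n" using hsub by blast
    then have "hrel G' d n `` {x} = hrel G' d n `` {y} \<longleftrightarrow> hrel G d n `` {x} = hrel G d n `` {y}"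
      using eq_equiv_class_iff[OF equiv(1) subsetD[OF cyc xy(1)] subsetD[OF cyc xy(3)]] eq_equiv_class_iff[OF equiv(2) xy(1,3)]
      by simp
    then show "((\<Union>z\<in>X. hrel G d n `` {z}) = (\<Union>z\<in>Y. hrel G d n `` {z})) = (X = Y)"
      using xy img by simp
  next
    fix n X assume "X \<in> homology G' d n"
    then obtain x where x: "x \<in> cycles G' d n" "X = hrel G' d n `` {x}"
      unfolding homology_def by (auto elim!: quotientE)
    then show "(\<Union>z\<in>X. hrel G d n `` {z}) \<in> homology G d n"
      using img[OF x(1)] quotientI[OF subsetD[OF cyc x(1)], of "hrel G d n"] by (simp add: homology_def)
  next
    fix n Y assume "Y \<in> homology G d n"
    then obtain y where y: "y \<in> cycles G d n" "Y = hrel G d n `` {y}"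
      unfolding homology_def by (auto elim!: quotientE)
    obtain x where x: "x \<in> G' n" "d x = 0" "y - x \<in> d ` G (Suc n)" using surj[of y n] y by (auto simp: cycles_def)
    then have xc: "x \<in> cycles G' d n" by (simp add: cycles_def)
    have "(y, x) \<in> hrel G d n" using x(3) y(1) subsetD[OF cyc xc] by (simp add: hrel_def)
    then have "Y = hrel G d n `` {x}" unfolding y(2) by (rule equiv_class_eq[OF equiv(1)])
    then show "\<exists>X\<in>homology G' d n. Y = (\<Union>z\<in>X. hrel G d n `` {z})"
      using img[OF xc] quotientI[OF xc, of "hrel G' d n"] unfolding homology_def by (intro bexI[of _ "hrel G' d n `` {x}"]) simp_all
  qed
qed

section \<open>Iterated brackets\<close>

locale bracket_letters =
  fixes SH :: "'h set" and gH :: "'h \<Rightarrow> nat"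
  assumes gH: "\<And>h. h \<in> SH \<Longrightarrow> 2 \<le> gH h"
begin

definition bdg :: "'h + 'h \<Rightarrow> nat" where "bdg = case_sum gH (\<lambda>h. gH h - 1)"

text \<open>A nonempty word stands for the right-normed bracket whose innermost entry is its last
  letter, taken from the second copy of the alphabet.\<close>

fun br :: "'h list \<Rightarrow> (('h + 'h) list \<Rightarrow>\<^sub>0 'r::comm_ring_1)" where
  "br [] = 0"
| "br [h] = gen [Inr h]"
| "br (h # h' # w) = gbracket bdg (gen [Inl h]) (br (h' # w))"

text \<open>A left inverse of \<open>br\<close>. In \<open>[v, x] = vx - (sign) xv\<close> the
  second term ends in a letter of the first kind and is discarded, so only one word of an iterated
  bracket remains. Independence of the brackets follows without any theory of free Lie
  algebras.\<close>

definition strip :: "('h + 'h) list \<Rightarrow> ('h list \<Rightarrow>\<^sub>0 'r::comm_ring_1)" where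
  "strip y = (if y \<noteq> [] \<and> \<not> isl (last y) then gen (map (case_sum id id) y) else 0)"

definition neW :: "'h list set" where "neW = lists SH - {[]}"

definition neD :: "'h list \<Rightarrow> nat" where "neD w = wdeg gH w - 1"

lemma br_Cons: "w \<noteq> [] \<Longrightarrow> br (h # w) = gbracket bdg (gen [Inl h]) (br w)"
  by (cases w) auto

lemma lmap_gbracket: "lmap (gbracket a x)" "lmap (\<lambda>x. gbracket a x y)"
  unfolding gbracket_def by (intro lmap_bilin1 lmap_bilin2 lmap_intros)+

lemma br_mem: "w \<in> lists SH \<Longrightarrow> w \<noteq> [] \<Longrightarrow> (br w :: _ \<Rightarrow>\<^sub>0 'r::comm_ring_1) \<in> fsupp {y \<in> wset (SH <+> SH) bdg (neD w). y \<noteq> []}"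
proof (induction w)
  case (Cons h w)
  show ?case
  proof (cases "w = []")
    case True
    then show ?thesis using Cons gH[of h] by (auto simp: wset_def neD_def bdg_def)
  next
    case False
    have h: "h \<in> SH" "w \<in> lists SH" using Cons by auto
    have "1 \<le> wdeg gH w" using False h(2) gH by (cases w) fastforce+
    then have deg: "neD (h # w) = gH h + neD w" by (simp add: neD_def)
    show ?thesis unfolding br_Cons[OF False] deg gbracket_def
      by (rule bilin_mem[OF _ Cons.IH(1)[OF h(2) False], where S = "{[Inl h]}"])
        (use h in \<open>auto simp: wset_def bdg_def intro!: diff_in_fsupp smul_in_fsupp\<close>)
  qed
qed simp

lemma strip_br: "w \<in> lists SH \<Longrightarrow> w \<noteq> [] \<Longrightarrow> lin strip (br w :: _ \<Rightarrow>\<^sub>0 'r::comm_ring_1) = gen w"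
proof (induction w)
  case (Cons h w)
  show ?case
  proof (cases "w = []")
    case False
    have w: "w \<in> lists SH" using Cons by auto
    have "lin strip (gbracket bdg (gen [Inl h]) (br w :: _ \<Rightarrow>\<^sub>0 'r)) = cat (gen [h]) (lin strip (br w))"
      by (rule lmap_eq_onI[OF br_mem[OF w False], of "\<lambda>p. lin strip (gbracket bdg (gen [Inl h]) p)"])
        (auto intro!: lmap_intros simp: lmap_intros gbracket_def bilin_gen1 strip_def lin_lin
          intro: lmapI)
    then show ?thesis using Cons False w by (simp add: br_Cons)
  qed (simp add: strip_def)
qed simp

lemma br_inj: "p \<in> fsupp neW \<Longrightarrow> lin br p = (0 :: _ \<Rightarrow>\<^sub>0 'r::comm_ring_1) \<Longrightarrow> p = 0"
proof -
  assume p: "p \<in> fsupp neW" "lin br p = 0"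
  have "lin strip (lin br p) = p"
    using p(1) by (rule lmap_eq_onI[of _ _ "\<lambda>p. lin strip (lin br p)"]; (intro lmap_intros)?) (simp add: strip_br neW_def)
  then show "p = 0" using p(2) by simp
qed

abbreviation "AD \<equiv> ad_module SH gH SH (\<lambda>h. gH h - 1)"

text \<open>The entries of an iterated bracket are arbitrary linear combinations of letters. By
  bilinearity the arguments may be checked on generators of their spans, one after the
  other.\<close>

lemma iter_br:
  "iter_brackets bdg (pm.span ((\<lambda>v. gen [Inl v]) ` SH)) (pm.span ((\<lambda>w. gen [Inr w]) ` SH)) \<subseteq> pm.span (br ` neW :: (_ \<Rightarrow>\<^sub>0 'r::comm_ring_1) set)"
proof
  fix x :: "('h + 'h) list \<Rightarrow>\<^sub>0 'r"
  let ?X = "pm.span (br ` neW :: (_ \<Rightarrow>\<^sub>0 'r) set)"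
  assume "x \<in> iter_brackets bdg (pm.span ((\<lambda>v. gen [Inl v]) ` SH)) (pm.span ((\<lambda>w. gen [Inr w]) ` SH))"
  then show "x \<in> ?X"
  proof induction
    case (base w)
    have "(\<lambda>w. gen [Inr w]) ` SH \<subseteq> ?X"
    proof
      fix x :: "('h + 'h) list \<Rightarrow>\<^sub>0 'r" assume "x \<in> (\<lambda>w. gen [Inr w]) ` SH"
      then obtain h where "h \<in> SH" "x = br [h]" by auto
      then have "x \<in> br ` neW" by (intro image_eqI[of _ _ "[h]"]) (simp_all add: neW_def)
      then show "x \<in> ?X" by (rule pm.span_base)
    qed
    then show ?case using base pm.span_minimal[OF _ pm.subspace_span] by blast
  next
    case (step v x)
    have s: "pm.subspace {v. gbracket bdg v x \<in> ?X}" for x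
      by (rule pm.subspaceI) (auto simp: lmap_zero[OF lmap_gbracket(2)] lmap_add[OF lmap_gbracket(2)] lmap_smul[OF lmap_gbracket(2)]
          intro: pm.span_zero pm.span_add pm.span_scale)
    have s': "pm.subspace {x. gbracket bdg v x \<in> ?X}" for v
      by (rule pm.subspaceI) (auto simp: lmap_zero[OF lmap_gbracket(1)] lmap_add[OF lmap_gbracket(1)] lmap_smul[OF lmap_gbracket(1)]
          intro: pm.span_zero pm.span_add pm.span_scale)
    have "gbracket bdg (gen [Inl h]) x \<in> ?X" if h: "h \<in> SH" for h
    proof -
      have "br ` neW \<subseteq> {x. gbracket bdg (gen [Inl h]) x \<in> ?X}"
      proof clarify
        fix w assume w: "w \<in> neW"
        then have "gbracket bdg (gen [Inl h]) (br w :: _ \<Rightarrow>\<^sub>0 'r) = br (h # w)" by (simp add: br_Cons neW_def)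
        moreover have "h # w \<in> neW" using w h by (simp add: neW_def)
        ultimately show "gbracket bdg (gen [Inl h]) (br w) \<in> ?X" by (auto intro!: pm.span_base)
      qed
      then have "?X \<subseteq> {x. gbracket bdg (gen [Inl h]) x \<in> ?X}" by (rule pm.span_minimal[OF _ s'])
      then show ?thesis using step.IH by blast
    qed
    then have "(\<lambda>v. gen [Inl v]) ` SH \<subseteq> {v. gbracket bdg v x \<in> ?X}" by blast
    then have "pm.span ((\<lambda>v. gen [Inl v]) ` SH) \<subseteq> {v. gbracket bdg v x \<in> ?X}" by (rule pm.span_minimal[OF _ s])
    then show ?case using step.hyps by blast
  qed
qed

lemma br_iter: "w \<in> lists SH \<Longrightarrow> w \<noteq> [] \<Longrightarrow>
  (br w :: _ \<Rightarrow>\<^sub>0 'r::comm_ring_1) \<in> iter_brackets bdg (pm.span ((\<lambda>v. gen [Inl v]) ` SH)) (pm.span ((\<lambda>w. gen [Inr w]) ` SH))"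
proof (induction w)
  case (Cons h w)
  show ?case
  proof (cases "w = []")
    case True
    then show ?thesis using Cons by (auto intro!: iter_brackets.base pm.span_base)
  next
    case False
    then show ?thesis using Cons by (auto simp: br_Cons intro!: iter_brackets.step pm.span_base)
  qed
qed simp

lemma br_AD: "w \<in> neW \<Longrightarrow> br w \<in> (AD (neD w) :: (_ \<Rightarrow>\<^sub>0 'r::comm_ring_1) set)"
proof -
  assume w: "w \<in> neW"
  have "br w \<in> fsupp (wset (SH <+> SH) bdg (neD w))"
    by (rule subsetD[OF fsupp_mono br_mem]) (use w in \<open>auto simp: neW_def\<close>)
  then show ?thesis using w br_iter[of w]
    unfolding ad_module_def bdg_def[symmetric] by (auto simp: neW_def intro: pm.span_base)
qed

lemma AD_homogeneous_basis: "homogeneous_basis (AD :: _ \<Rightarrow> (_ \<Rightarrow>\<^sub>0 'r::comm_ring_1) set) (br ` neW)"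
  unfolding homogeneous_basis_def
proof (intro conjI)
  show "br ` neW \<subseteq> (\<Union>n. AD n :: (_ \<Rightarrow>\<^sub>0 'r) set)" using br_AD by blast
  show "pm.independent (br ` neW :: (_ \<Rightarrow>\<^sub>0 'r) set)" by (rule independent_image(1)[OF br_inj])
  show "pm.span (br ` neW) = (carr AD :: (_ \<Rightarrow>\<^sub>0 'r) set)"
  proof
    show "pm.span (br ` neW) \<subseteq> (carr AD :: (_ \<Rightarrow>\<^sub>0 'r) set)"
      unfolding carr_def by (rule pm.span_mono) (use br_AD in blast)
    have "AD n \<subseteq> (pm.span (br ` neW) :: (_ \<Rightarrow>\<^sub>0 'r) set)" for n
      unfolding ad_module_def bdg_def[symmetric] using pm.span_minimal[OF iter_br pm.subspace_span] by blast
    then show "(carr AD :: (_ \<Rightarrow>\<^sub>0 'r) set) \<subseteq> pm.span (br ` neW)"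
      unfolding carr_def by (intro pm.span_minimal) auto
  qed
qed

lemma elem_degree_br: "w \<in> neW \<Longrightarrow> elem_degree AD (br w :: _ \<Rightarrow>\<^sub>0 'r::comm_ring_1) = neD w"
  unfolding elem_degree_def
proof (rule the_equality)
  show "w \<in> neW \<Longrightarrow> (br w :: _ \<Rightarrow>\<^sub>0 'r) \<in> AD (neD w)" by (rule br_AD)
  fix n assume w: "w \<in> neW" and n: "(br w :: _ \<Rightarrow>\<^sub>0 'r) \<in> AD n"
  have 1: "br w \<in> (fsupp (wset (SH <+> SH) bdg n) :: (_ \<Rightarrow>\<^sub>0 'r) set)"
    using n unfolding ad_module_def bdg_def[symmetric] by simp
  have 2: "br w \<in> (fsupp (wset (SH <+> SH) bdg (neD w)) :: (_ \<Rightarrow>\<^sub>0 'r) set)"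
    by (rule subsetD[OF fsupp_mono br_mem]) (use w in \<open>auto simp: neW_def\<close>)
  have "lin strip (br w :: _ \<Rightarrow>\<^sub>0 'r) \<noteq> 0" using w by (simp add: strip_br neW_def)
  then have "(br w :: _ \<Rightarrow>\<^sub>0 'r) \<noteq> 0" by auto
  then have "wset (SH <+> SH) bdg n \<inter> wset (SH <+> SH) bdg (neD w) \<noteq> {}" using fsupp_disjoint[OF 1 2] by blast
  then show "n = neD w" by (auto simp: wset_def)
qed

text \<open>The alphabet of the required tensor algebra consists of the bracket elements themselves.
  The inverse of \<open>br\<close> relabels them by nonempty words, where \<Theta> is
  available.\<close>

lemma is_tensor_algebra_on_AD:
  fixes B :: "('y, 'r::comm_ring_1, 'z) galg_scheme" and \<Theta> :: "('h list list \<Rightarrow>\<^sub>0 'r) \<Rightarrow> ('y \<Rightarrow>\<^sub>0 'r)"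
  assumes \<Theta>: "lmap \<Theta>" "\<And>p. p \<in> fsupp (lists neW) \<Longrightarrow> \<Theta> p = 0 \<Longrightarrow> p = 0"
    "\<And>p q. p \<in> fsupp (lists neW) \<Longrightarrow> q \<in> fsupp (lists neW) \<Longrightarrow> \<Theta> (cat p q) = mul B (\<Theta> p) (\<Theta> q)" "\<Theta> (gen []) = one B"
    and B: "\<And>n. grade B n = \<Theta> ` fsupp (wset neW neD n)"
  shows "is_tensor_algebra_on B (AD :: _ \<Rightarrow> (_ \<Rightarrow>\<^sub>0 'r) set)"
proof -
  let ?X = "br ` neW :: (('h + 'h) list \<Rightarrow>\<^sub>0 'r) set"
  let ?ed = "elem_degree (AD :: _ \<Rightarrow> (_ \<Rightarrow>\<^sub>0 'r) set)"
  let ?inv = "inv_into neW (br :: _ \<Rightarrow> (_ \<Rightarrow>\<^sub>0 'r))"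
  have injbr: "inj_on (br :: _ \<Rightarrow> (_ \<Rightarrow>\<^sub>0 'r)) neW"
    by (rule independent_image(3)) (rule br_inj)
  define rl where "rl = lin (\<lambda>xs. gen (map ?inv xs) :: 'h list list \<Rightarrow>\<^sub>0 'r)"
  define rl' where "rl' = lin (\<lambda>ws. gen (map (br :: _ \<Rightarrow> (_ \<Rightarrow>\<^sub>0 'r)) ws) :: _ \<Rightarrow>\<^sub>0 'r)"
  have inv: "?inv x \<in> neW" "br (?inv x) = x" "neD (?inv x) = ?ed x" if "x \<in> ?X" for x
    using that inv_into_f_f[OF injbr] by (auto simp: elem_degree_br simp del: One_nat_def)
  have inv': "?inv (br w) = w" if "w \<in> neW" for w using inv_into_f_f[OF injbr that] .
  have word: "map ?inv xs \<in> wset neW neD n \<and> map br (map ?inv xs) = xs" if "xs \<in> wset ?X ?ed n" for xs n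
  proof -
    have "set xs \<subseteq> ?X" "wdeg ?ed xs = n" using that by (auto simp: wset_def)
    then show ?thesis by (induction xs arbitrary: n) (auto simp: wset_def inv inv' elem_degree_br simp del: One_nat_def)
  qed
  have word': "map br ws \<in> wset ?X ?ed n \<and> map ?inv (map br ws) = ws" if "ws \<in> wset neW neD n" for ws n
  proof -
    have "set ws \<subseteq> neW" "wdeg neD ws = n" using that by (auto simp: wset_def)
    then show ?thesis by (induction ws arbitrary: n) (auto simp: wset_def inv' elem_degree_br simp del: One_nat_def)
  qed
  have "bij_betw rl (fsupp (wset ?X ?ed n)) (fsupp (wset neW neD n))" for n
  proof (rule bij_betw_byWitness[where f' = rl'])
    show "\<forall>a\<in>fsupp (wset ?X ?ed n). rl' (rl a) = a"
    proof
      fix a :: "(('h + 'h) list \<Rightarrow>\<^sub>0 'r) list \<Rightarrow>\<^sub>0 'r" assume "a \<in> fsupp (wset ?X ?ed n)"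
      then show "rl' (rl a) = a" unfolding rl_def rl'_def
        by (rule lmap_eq_onI[of _ _ "\<lambda>a. lin _ (lin _ a)"]; (intro lmap_intros)?) (use word in simp)
    qed
    show "\<forall>a\<in>fsupp (wset neW neD n). rl (rl' a) = a"
    proof
      fix a :: "'h list list \<Rightarrow>\<^sub>0 'r" assume "a \<in> fsupp (wset neW neD n)"
      then show "rl (rl' a) = a" unfolding rl_def rl'_def
        by (rule lmap_eq_onI[of _ _ "\<lambda>a. lin _ (lin _ a)"]; (intro lmap_intros)?) (use word' in simp)
    qed
    show "rl ` fsupp (wset ?X ?ed n) \<subseteq> fsupp (wset neW neD n)"
      unfolding rl_def by (auto intro!: lin_mem_on[where S = "wset ?X ?ed n"] dest: word)
    show "rl' ` fsupp (wset neW neD n) \<subseteq> fsupp (wset ?X ?ed n)"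
      unfolding rl'_def by (auto intro!: lin_mem_on[where S = "wset neW neD n"] dest: word')
  qed
  moreover have "bij_betw \<Theta> (fsupp (wset neW neD n)) (grade B n)" for n
    unfolding bij_betw_def B
  proof (intro conjI refl inj_onI)
    fix x y assume xy: "x \<in> fsupp (wset neW neD n)" "y \<in> fsupp (wset neW neD n)" "\<Theta> x = \<Theta> y"
    then have "x - y \<in> fsupp (lists neW)" by (intro fsupp_wset_lists[of _ neW neD n] diff_in_fsupp)
    then have "x - y = 0" by (rule \<Theta>(2)) (simp add: xy(3) lmap_diff[OF \<Theta>(1)])
    then show "x = y" by simp
  qed
  ultimately have bij: "bij_betw (\<Theta> \<circ> rl) (grade (tensor_algebra ?X ?ed) n) (grade B n)" for n
    unfolding grade_tensor by (rule bij_betw_trans)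
  have rl_lists: "rl x \<in> fsupp (lists neW)" if "x \<in> fsupp (lists ?X)" for x
    using that unfolding rl_def by (rule lin_mem_on) (auto intro!: inv(1))
  have rl_cat: "rl (cat x y) = cat (rl x) (rl y)" for x y
    unfolding rl_def by (rule bilin_eqI[where m = "\<lambda>x y. lin _ (cat x y)"]; (intro lmap_intros)?; simp)
  have "alg_hom (tensor_algebra ?X ?ed) B (\<Theta> \<circ> rl)"
    unfolding alg_hom_def carr_tensor
  proof (intro conjI ballI allI)
    show "linear_on (fsupp (lists ?X)) (\<Theta> \<circ> rl)"
      by (simp add: linear_on_def rl_def lmap_add[OF \<Theta>(1)] lmap_smul[OF \<Theta>(1)])
    show "(\<Theta> \<circ> rl) ` grade (tensor_algebra ?X ?ed) n \<subseteq> grade B n" for n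
      using bij_betw_imp_surj_on[OF bij] by blast
    show "(\<Theta> \<circ> rl) (mul (tensor_algebra ?X ?ed) x y) = mul B ((\<Theta> \<circ> rl) x) ((\<Theta> \<circ> rl) y)"
      if "x \<in> fsupp (lists ?X)" "y \<in> fsupp (lists ?X)" for x y
      using that by (simp add: tensor_algebra_def rl_cat \<Theta>(3) rl_lists)
    show "(\<Theta> \<circ> rl) (one (tensor_algebra ?X ?ed)) = one B"
      by (simp add: tensor_algebra_def rl_def \<Theta>(4))
  qed
  then have "alg_isomorphic (tensor_algebra ?X ?ed) B"
    unfolding alg_isomorphic_def using bij by blast
  then show ?thesis unfolding is_tensor_algebra_on_def using AD_homogeneous_basis by blast
qed

end

section \<open>The small model\<close>

context hom_model
begin

definition \<Theta> :: "('h list list \<Rightarrow>\<^sub>0 'r) \<Rightarrow> (('b + 'b) list \<Rightarrow>\<^sub>0 'r)" where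
  "\<Theta> x = \<Phi> (L2.word.I x)"

text \<open>Realised as a subalgebra of the double-loop algebra: the differential is inherited, the
  comparison map is the inclusion, and both algebras live over the same type.\<close>

definition small :: "(('b + 'b) list, 'r) dga" where
  "small = \<lparr> grade = (\<lambda>n. \<Theta> ` fsupp (wset NH aH n)), mul = cat, one = gen [], dif = der edg (cobar_dgen PC) \<rparr>"

abbreviation "DL \<equiv> double_loop (C, \<Psi>)"

lemma lmap_\<Theta>: "lmap \<Theta>"
  unfolding \<Theta>_def[abs_def] using L2.word.lmap_IHPD(1) by (intro lmap_intros)

lemma I_lists: "x \<in> fsupp (lists NH) \<Longrightarrow> L2.word.I x \<in> fsupp (lists NE)"
  by (rule L2.word.closed_IHPD(1))

lemma \<Theta>_inj: "x \<in> fsupp (lists NH) \<Longrightarrow> \<Theta> x = 0 \<Longrightarrow> x = 0"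
  unfolding \<Theta>_def using \<Phi>_inj[OF I_lists] L2.word.PI lmap_zero[OF L2.word.lmap_IHPD(3)] by metis

lemma \<Theta>_cat: "x \<in> fsupp (lists NH) \<Longrightarrow> y \<in> fsupp (lists NH) \<Longrightarrow> \<Theta> (cat x y) = cat (\<Theta> x) (\<Theta> y)"
proof -
  assume x: "x \<in> fsupp (lists NH)" and y: "y \<in> fsupp (lists NH)"
  note l = L2.word.lmap_IHPD(1)
  have "L2.word.I (cat x y) = cat (L2.word.I x) (L2.word.I y)"
  proof (rule lmap_eq_onI[OF x, of "\<lambda>x. L2.word.I (cat x y)"])
    show "lmap (\<lambda>x. L2.word.I (cat x y))" "lmap (\<lambda>x. cat (L2.word.I x) (L2.word.I y))"
      by (rule lmapI; simp add: lmap_add[OF l] lmap_smul[OF l])+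
    fix u assume u: "u \<in> lists NH"
    show "L2.word.I (cat (gen u) y) = cat (L2.word.I (gen u)) (L2.word.I y)"
    proof (rule lmap_eq_onI[OF y, of "\<lambda>y. L2.word.I (cat (gen u) y)"])
      show "lmap (\<lambda>y. L2.word.I (cat (gen u) y))" "lmap (\<lambda>y. cat (L2.word.I (gen u)) (L2.word.I y))"
        by (rule lmapI; simp add: lmap_add[OF l] lmap_smul[OF l])+
      show "L2.word.I (cat (gen u) (gen v)) = cat (L2.word.I (gen u)) (L2.word.I (gen v))" if "v \<in> lists NH" for v
        unfolding cat_gen by (rule L2.I_append[OF u that])
    qed
  qed
  then show ?thesis by (simp add: \<Theta>_def aext_cat)
qed

lemma \<Theta>_Nil: "\<Theta> (gen []) = gen []"
  by (simp only: \<Theta>_def L2.I_gen_Nil alg_ext_Nil)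

lemma dE_cobar: "x \<in> K n \<Longrightarrow> der edg (cobar_dgen PC) x = dE x"
proof (rule dE_PC)
  assume "x \<in> K n"
  then have "x \<in> fsupp (wset SE edg n)" by (simp add: K_def)
  then show "x \<in> fsupp (lists SE)" by (rule fsupp_wset_lists)
qed

lemma K_sub: "K n \<subseteq> fsupp (wset SE edg n)" by (auto simp: K_def)

lemma \<Theta>_K: "x \<in> fsupp (wset NH aH n) \<Longrightarrow> \<Theta> x \<in> K n"
  unfolding K_eq \<Theta>_def by (intro imageI L2.word_deg)

lemma NE_lists': "x \<in> fsupp (wset NE adg n) \<Longrightarrow> x \<in> fsupp (lists NE)" "y \<in> fsupp (wset NH aH n) \<Longrightarrow> y \<in> fsupp (lists NH)"
  by (erule fsupp_wset_lists)+

lemma dI2: "y \<in> fsupp (lists NH) \<Longrightarrow> der adg DA (L2.word.I y) = L2.word.I (L2.word.D y)"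
  using L2.word.dI unfolding L2_total .

lemma d\<Theta>: "x \<in> fsupp (lists NH) \<Longrightarrow> dE (\<Theta> x) = \<Theta> (L2.word.D x)"
  unfolding \<Theta>_def using \<Phi>_chain[OF I_lists] dI2 by metis

lemma SE_wset_0: "x \<in> fsupp (wset SE edg 0) \<Longrightarrow> der edg f x = 0"
proof (erule lmap_eq_onI[of _ _ "der edg f"]; (intro lmap_intros lmap_der')?)
  fix w assume "w \<in> wset SE edg 0"
  then have "w = []" using length_le_wdeg[of SE edg w] edg_pos by (auto simp: wset_def)
  then show "der edg f (gen w) = 0" by simp
qed

lemma K_square: "x \<in> K n \<Longrightarrow> dE (dE x) = 0"
  using K_sub by (intro dE_square' fsupp_wset_lists) blast

lemma der_DA_deg: "x \<in> fsupp (wset NE adg (Suc n)) \<Longrightarrow> der adg DA x \<in> fsupp (wset NE adg n)"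
proof (erule lmap_mem[OF lmap_der' _ subspace_fsupp])
  fix w assume "w \<in> wset NE adg (Suc n)"
  then have w: "gen w \<in> (fsupp (wset NE adg (Suc n)) :: (_ \<Rightarrow>\<^sub>0 'r) set)" "set w \<subseteq> NE" "wdeg adg w = Suc n"
    by (auto simp: wset_def)
  have "L2.Td (gen w) \<in> fsupp (wset NE adg n)"
    by (rule subsetD[OF fsupp_mono L2.word_WS(1)[OF w(2)]]) (auto simp: WS_def wset_def w(3))
  then show "der adg DA (gen w) \<in> fsupp (wset NE adg n)"
    unfolding L2_total[symmetric] by (intro add_in_fsupp L2.Tt_deg w)
qed

lemma dE_K: "x \<in> K (Suc n) \<Longrightarrow> dE x \<in> K n"
proof -
  assume "x \<in> K (Suc n)"
  then obtain z where z: "z \<in> fsupp (wset NE adg (Suc n))" "x = \<Phi> z" unfolding K_eq by blast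
  then have "dE x = \<Phi> (der adg DA z)" using \<Phi>_chain[OF NE_lists'(1)] by simp
  then show ?thesis unfolding K_eq using der_DA_deg[OF z(1)] by blast
qed

lemma K_cat: "x \<in> K m \<Longrightarrow> y \<in> K n \<Longrightarrow> cat x y \<in> K (m + n)"
proof -
  assume "x \<in> K m" "y \<in> K n"
  then obtain p q where "p \<in> fsupp (wset NE adg m)" "q \<in> fsupp (wset NE adg n)" "x = \<Phi> p" "y = \<Phi> q" unfolding K_eq by blast
  then show ?thesis unfolding K_eq by (intro image_eqI[of _ _ "cat p q"]) (auto simp: aext_cat intro: cat_wset)
qed

lemma chain_algebra_DL: "chain_algebra DL"
proof (rule sub_chain_algebra[OF double_loop_sel, of \<Phi> "\<lambda>n. wset NE adg n" SE])
  show "grade DL n = \<Phi> ` fsupp (wset NE adg n)" "grade DL n \<subseteq> fsupp (wset SE edg n)" for n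
    using K_eq K_sub by (simp_all add: double_loop_grade)
  show "p \<in> fsupp (wset NE adg n) \<Longrightarrow> \<Phi> p = 0 \<Longrightarrow> p = 0" for p n by (rule \<Phi>_inj[OF NE_lists'(1)])
  show "gen [] \<in> grade DL 0"
    unfolding double_loop_grade K_eq by (rule image_eqI[of _ _ "gen []"]) (simp_all add: wset_def)
  show "der edg (cobar_dgen PC) x = 0" if "x \<in> grade DL 0" for x
    using that K_sub unfolding double_loop_grade by (intro SE_wset_0) blast
  show "der edg (cobar_dgen PC) x \<in> grade DL n" if "x \<in> grade DL (Suc n)" for x n
    using that dE_K unfolding double_loop_grade by (simp add: dE_cobar)
  show "der edg (cobar_dgen PC) (der edg (cobar_dgen PC) x) = 0" if "x \<in> grade DL n" for x n
  proof (cases n)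
    case 0
    then show ?thesis using that K_sub unfolding double_loop_grade by (subst SE_wset_0) auto
  next
    case (Suc m)
    then have x: "x \<in> K (Suc m)" using that unfolding double_loop_grade by simp
    then show ?thesis using dE_cobar[OF x] dE_cobar[OF dE_K[OF x]] K_square[OF x] by simp
  qed
qed (simp_all add: double_loop_grade K_cat)

lemma small_sel: "mul small = cat" "one small = gen []" "dif small = der edg (cobar_dgen PC)"
  "grade small n = \<Theta> ` fsupp (wset NH aH n)"
  by (simp_all add: small_def)

lemma small_K: "grade small n \<subseteq> K n"
  unfolding small_sel using \<Theta>_K by blast

lemma dE_small: "x \<in> grade small (Suc n) \<Longrightarrow> dE x \<in> grade small n"
proof -
  assume "x \<in> grade small (Suc n)"
  then obtain z where z: "z \<in> fsupp (wset NH aH (Suc n))" "x = \<Theta> z" unfolding small_sel by blast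
  then have "dE x = \<Theta> (L2.word.D z)" using d\<Theta>[OF NE_lists'(2)] by simp
  then show ?thesis unfolding small_sel using L2.word_deg(4)[OF z(1)] by blast
qed

lemma chain_algebra_small: "chain_algebra small"
proof (rule sub_chain_algebra[OF small_sel(1-3) lmap_\<Theta>, of "\<lambda>n. wset NH aH n" SE])
  show "p \<in> fsupp (wset NH aH n) \<Longrightarrow> \<Theta> p = 0 \<Longrightarrow> p = 0" for p n by (rule \<Theta>_inj[OF NE_lists'(2)])
  show "grade small n = \<Theta> ` fsupp (wset NH aH n)" for n by (rule small_sel)
  show "grade small n \<subseteq> fsupp (wset SE edg n)" for n using small_K K_sub by blast
  show "cat x y \<in> grade small (m + n)" if xy: "x \<in> grade small m" "y \<in> grade small n" for x y m n
  proof -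
    obtain p q where "p \<in> fsupp (wset NH aH m)" "q \<in> fsupp (wset NH aH n)" "x = \<Theta> p" "y = \<Theta> q"
      using xy unfolding small_sel by blast
    then show ?thesis unfolding small_sel
      by (intro image_eqI[of _ _ "cat p q"]) (auto simp: \<Theta>_cat NE_lists' intro: cat_wset)
  qed
  show "gen [] \<in> grade small 0"
    unfolding small_sel by (rule image_eqI[of _ _ "gen []"]) (simp_all add: wset_def \<Theta>_Nil)
  show "der edg (cobar_dgen PC) x = 0" if "x \<in> grade small 0" for x
    using that K_sub small_K by (intro SE_wset_0) blast
  show d: "der edg (cobar_dgen PC) x \<in> grade small n" if "x \<in> grade small (Suc n)" for x n
  proof -
    have "x \<in> K (Suc n)" using that small_K by blast
    then show ?thesis using dE_small[OF that] dE_cobar by simp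
  qed
  show "der edg (cobar_dgen PC) (der edg (cobar_dgen PC) x) = 0" if "x \<in> grade small n" for x n
  proof (cases n)
    case 0
    have "x \<in> fsupp (wset SE edg 0)" using that K_sub small_K unfolding 0 by blast
    then show ?thesis by (simp add: SE_wset_0)
  next
    case (Suc m)
    then have x: "x \<in> K (Suc m)" using that small_K by blast
    then show ?thesis using dE_cobar[OF x] dE_cobar[OF dE_K[OF x]] K_square[OF x] by simp
  qed
qed

lemma quasi_iso_small: "quasi_iso (grade small) (dif small) (grade DL) (dif DL) (\<lambda>x. x)"
  unfolding double_loop_sel small_sel(3)
proof (rule quasi_iso_inclusion)
  show "lmap (der edg (cobar_dgen PC))" by (rule lmap_der')
  show "pm.subspace (grade DL n)" "pm.subspace (grade small n)" "grade small n \<subseteq> grade DL n" for n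
    unfolding double_loop_grade using small_K by (auto simp: K_eq small_sel(4) intro!: subspace_image lmap_alg_ext lmap_\<Theta>)
  let ?d = "der edg (cobar_dgen PC)"
  fix n z
  {
    assume z: "z \<in> grade DL n" "?d z = 0"
    then obtain y where y: "y \<in> fsupp (wset NE adg n)" "z = \<Phi> y" unfolding double_loop_grade K_eq by blast
    note yl = NE_lists'(1)[OF y(1)]
    have "\<Phi> (der adg DA y) = 0"
      using z y \<Phi>_chain[OF yl] dE_cobar[of z n] unfolding double_loop_grade by simp
    then have dy: "der adg DA y = 0" by (rule \<Phi>_inj[OF der_DA_lists[OF yl]])
    \<comment> \<open>The projection of \<open>y\<close> gives the cycle in the small model, and the
      homotopy gives the boundary connecting it with \<open>z\<close>.\<close>
    let ?H = "L2.word.H y" and ?P = "L2.word.P y"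
    have Hd: "?H \<in> fsupp (wset NE adg (Suc n))" "?P \<in> fsupp (wset NH aH n)" using L2.word_deg(2,3)[OF y(1)] by auto
    have "der adg DA ?H + L2.word.H (der adg DA y) = L2.word.I ?P - y"
      using L2.word.dH[OF yl] unfolding L2_total .
    then have "der adg DA ?H = L2.word.I ?P - y"
      by (simp only: dy lmap_zero[OF L2.word.lmap_IHPD(2)] add_0_right)
    then have "y - L2.word.I ?P = der adg DA (- ?H)"
      by (simp only: der_lin_simps minus_diff_eq)
    then have "z - \<Theta> ?P = \<Phi> (der adg DA (- ?H))" by (simp add: y \<Theta>_def flip: alg_ext_lin_simps)
    also have "\<dots> = dE (\<Phi> (- ?H))" by (rule \<Phi>_chain) (rule NE_lists'(1)[OF uminus_in_fsupp[OF Hd(1)]])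
    also have "\<dots> = ?d (\<Phi> (- ?H))"
      by (rule dE_cobar[symmetric]) (use Hd(1) in \<open>auto simp: K_eq simp del: alg_ext_lin_simps\<close>)
    finally have eq: "z - \<Theta> ?P = ?d (\<Phi> (- ?H))" .
    have "dE (\<Theta> ?P) = \<Theta> (L2.word.D ?P)" by (rule d\<Theta>[OF NE_lists'(2)[OF Hd(2)]])
    also have "L2.word.D ?P = L2.word.P (der adg DA y)" using L2.word.Pd[OF yl] unfolding L2_total by simp
    finally have "dE (\<Theta> ?P) = 0" by (simp only: dy lmap_zero[OF L2.word.lmap_IHPD(3)] lmap_zero[OF lmap_\<Theta>])
    then have "?d (\<Theta> ?P) = 0" using dE_cobar[OF \<Theta>_K[OF Hd(2)]] by simp
    moreover have "\<Phi> (- ?H) \<in> grade DL (Suc n)" unfolding double_loop_grade K_eq using Hd(1) by blast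
    ultimately show "\<exists>z'\<in>grade small n. ?d z' = 0 \<and> z - z' \<in> ?d ` grade DL (Suc n)"
      using Hd(2) unfolding small_sel(4) eq[symmetric]
      by (intro bexI[of _ "\<Theta> ?P"] conjI imageI) (simp_all only: eq imageI)
  next
    assume z: "z \<in> grade small n" "z \<in> ?d ` grade DL (Suc n)"
    obtain m where m: "m \<in> fsupp (wset NH aH n)" "z = \<Theta> m" using z unfolding small_sel(4) by blast
    obtain y where y: "y \<in> fsupp (wset NE adg (Suc n))" "z = ?d (\<Phi> y)" using z(2) unfolding double_loop_grade K_eq by blast
    note yl = NE_lists'(1)[OF y(1)] and ml = NE_lists'(2)[OF m(1)]
    have "\<Phi> y \<in> K (Suc n)" unfolding K_eq using y(1) by blast
    then have "z = \<Phi> (der adg DA y)" using y(2) dE_cobar \<Phi>_chain[OF yl] by simp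
    then have "\<Phi> (L2.word.I m - der adg DA y) = 0" using m(2) by (simp add: \<Theta>_def)
    then have "L2.word.I m - der adg DA y = 0"
      by (rule \<Phi>_inj[rotated]) (intro diff_in_fsupp I_lists ml der_DA_lists yl)
    then have "L2.word.I m = der adg DA y" by simp
    \<comment> \<open>Applying \<open>P\<close>, which inverts \<open>I\<close> on the left and is a
      chain map, pulls the bounding element back to the small model.\<close>
    then have "m = L2.word.P (der adg DA y)" using L2.word.PI[OF ml] by simp
    also have "\<dots> = L2.word.D (L2.word.P y)" using L2.word.Pd[OF yl] unfolding L2_total .
    finally have mD: "m = L2.word.D (L2.word.P y)" .
    have P: "L2.word.P y \<in> fsupp (wset NH aH (Suc n))" by (rule L2.word_deg(3)[OF y(1)])
    have "z = dE (\<Theta> (L2.word.P y))" using m(2) mD d\<Theta>[OF NE_lists'(2)[OF P]] by simp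
    also have "\<dots> = ?d (\<Theta> (L2.word.P y))" by (rule dE_cobar[symmetric, OF \<Theta>_K[OF P]])
    finally show "z \<in> ?d ` grade small (Suc n)" unfolding small_sel(4) using P by blast
  }
qed

lemma weak_equivalence: "chain_alg_weakly_equivalent DL small"
proof -
  have "chain_alg_hom small DL (\<lambda>x. x)"
    unfolding chain_alg_hom_def alg_hom_def
    using small_K by (auto simp: linear_on_def small_sel(1-3) double_loop_sel double_loop_grade)
  then have "alg_quasi_iso small DL"
    unfolding alg_quasi_iso_def using chain_algebra_DL chain_algebra_small quasi_iso_small by blast
  then show ?thesis
    unfolding chain_alg_weakly_equivalent_def using chain_algebra_DL chain_algebra_small
    by (meson equivclp_sym r_into_equivclp)
qed

lemma small_tensor: "is_tensor_algebra_on small (ad_module SH (\<lambda>h. deg H h - 1) SH (\<lambda>h. deg H h - 2))"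
proof -
  interpret br: bracket_letters SH gH by unfold_locales (use SH_deg in blast)
  have NH: "br.neW = NH" by (simp add: br.neW_def NH_def)
  have aH: "br.neD = aH" by (rule ext) (simp add: br.neD_def aH_def)
  have g: "gH = (\<lambda>h. deg H h - 1)" "(\<lambda>h. gH h - 1) = (\<lambda>h. deg H h - 2)" by (auto simp: sdeg_def)
  have "is_tensor_algebra_on small (ad_module SH gH SH (\<lambda>h. gH h - 1))"
    by (rule br.is_tensor_algebra_on_AD[of \<Theta>])
      (simp_all add: lmap_\<Theta> NH aH \<Theta>_Nil \<Theta>_inj \<Theta>_cat small_sel)
  from this[unfolded g(2), unfolded g(1)] show ?thesis .
qed

end

theorem corollary6p9:
  fixes C :: "('b, 'r::idom) coalg"
    and \<Psi> :: "('b list \<Rightarrow>\<^sub>0 'r) \<Rightarrow> (('b \<times> 'b) list \<Rightarrow>\<^sub>0 'r)"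
    and H :: "('h, 'r) coalg"
  assumes ring: "(2::'r) dvd 1 \<or> ((2::'r) = 0 \<and> (\<forall>x::'r. x \<noteq> 0 \<longrightarrow> x dvd 1))"
    and aw: "aw_coalgebra (C, \<Psi>)"
    and conn: "\<forall>c\<in>basis C. deg C c \<noteq> 1 \<and> deg C c \<noteq> 2"
    and formal: "aw_formal (C, \<Psi>)"
    and H: "homology_coalgebra C H"
  shows "\<exists>B :: (('b + 'b) list, 'r) dga.
    chain_alg_weakly_equivalent (double_loop (C, \<Psi>)) B \<and>
    is_tensor_algebra_on B
      (ad_module (basis_pos H) (\<lambda>h. deg H h - 1) (basis_pos H) (\<lambda>h. deg H h - 2))"
proof -
  from H obtain \<zeta> where \<zeta>: "\<forall>h\<in>basis H. \<zeta> h \<in> cycles (cgrade C) (lin (cdif C)) (deg H h)"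
    "\<forall>n. bij_betw (\<lambda>x. hrel (cgrade C) (lin (cdif C)) n `` {lin \<zeta> x})
               (cgrade H n) (homology (cgrade C) (lin (cdif C)) n)"
    unfolding homology_coalgebra_def by blast
  interpret hom_model C \<Psi> H \<zeta>
    by unfold_locales (use aw conn \<zeta> in auto)
  show ?thesis using weak_equivalence small_tensor by blast
qed

end
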